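(* For any integers $i,j\ge 0$, the largest dimension for (effective) algebraic torus actions on the Milnor hypersurface $H_{i,j}$ is equal to $\max\{i,j\}$.
   Context: For integers $i,j\ge 0$ the Milnor hypersurface $H_{i,j}\subset \mathbb{P}^i\times\mathbb{P}^j$ (over $\mathbb{C}$) is the nonsingular hypersurface given by $\sum_{k=0}^{\min\{i,j\}} z_k w_k=0$ in the homogeneous coordinates $([z_0:\dots:z_i],[w_0:\dots:w_j])$ of $\mathbb{P}^i\times\mathbb{P}^j$. An algebraic torus action on a variety $X$ is an action of $(\mathbb{C}^\times)^r$ on $X$ by automorphisms such that the action map is a morphism of varieties; it is effective if only the identity element acts trivially. The dimension of the action is $r$.
   Formalization: The formal theorem assumes that i and j are both zero or both positive: if exactly one is 0, say i = 0 < j, then H_{0,j} is P^{j-1}, whose effective torus actions have dimension at most j-1, so the claim as stated fails there (e.g. H_{0,1} is a point). *)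

theory Defs
  imports "HOL-Analysis.Abstract_Topology" "HOL-Algebra.Group_Action"
begin

section \<open>Affine and projective coordinates\<close>

text \<open>A vector of \<open>\<complex>\<^sup>n\<close> is a sequence vanishing from index \<open>n\<close> on.\<close>

type_synonym vec = "nat \<Rightarrow> complex"

definition cspace :: "nat \<Rightarrow> vec set" where
  "cspace n = {v. \<forall>k\<ge>n. v k = 0}"

definition proj_rel :: "nat \<Rightarrow> (vec \<times> vec) set" where
  "proj_rel n = {(v, w). v \<in> cspace (Suc n) - {\<lambda>_. 0} \<and> w \<in> cspace (Suc n) - {\<lambda>_. 0}
      \<and> (\<exists>c. c \<noteq> 0 \<and> w = (\<lambda>k. c * v k))}"

text \<open>A point of \<open>\<P>\<^sup>n\<close> is thus the set of all its homogeneous coordinate vectors.\<close>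

definition proj_space :: "nat \<Rightarrow> vec set set" where
  "proj_space n = (cspace (Suc n) - {\<lambda>_. 0}) // proj_rel n"

definition milnor_hypersurface :: "nat \<Rightarrow> nat \<Rightarrow> (vec set \<times> vec set) set" where
  "milnor_hypersurface i j =
    {(P, Q). P \<in> proj_space i \<and> Q \<in> proj_space j \<and>
      (\<forall>z\<in>P. \<forall>w\<in>Q. (\<Sum>k\<le>min i j. z k * w k) = 0)}"

text \<open>
  For \<open>j \<ge> 1\<close> the hypersurface \<open>H\<^sub>0\<^sub>,\<^sub>j\<close> is the hyperplane \<open>w\<^sub>0 = 0\<close> of \<open>\<P>\<^sup>j\<close>, i.e. \<open>\<P>\<^sup>j\<^sup>-\<^sup>1\<close>, whose
  largest effective torus actions have dimension \<open>j - 1\<close> and not \<open>max 0 j\<close>; symmetrically for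
  \<open>H\<^sub>i\<^sub>,\<^sub>0\<close>. \<open>H\<^sub>0\<^sub>,\<^sub>0\<close> is empty.
\<close>

section \<open>Varieties as spaces with functions\<close>

text \<open>
  \<open>bihom_poly r i j d e F\<close>: \<open>F\<close> is a polynomial function in \<open>t\<^sub>0,\<dots>,t\<^sub>r\<^sub>-\<^sub>1\<close>,
  \<open>z\<^sub>0,\<dots>,z\<^sub>i\<close>, \<open>w\<^sub>0,\<dots>,w\<^sub>j\<close>, homogeneous of degree \<open>d\<close> in \<open>z\<close> and of degree \<open>e\<close> in \<open>w\<close>
  (and of arbitrary degree in \<open>t\<close>).
\<close>

inductive bihom_poly ::
    "nat \<Rightarrow> nat \<Rightarrow> nat \<Rightarrow> nat \<Rightarrow> nat \<Rightarrow> (vec \<times> vec \<times> vec \<Rightarrow> complex) \<Rightarrow> bool"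
  for r i j where
    const: "bihom_poly r i j 0 0 (\<lambda>_. c)"
  | var_t: "k < r \<Longrightarrow> bihom_poly r i j 0 0 (\<lambda>(t, z, w). t k)"
  | var_z: "k \<le> i \<Longrightarrow> bihom_poly r i j 1 0 (\<lambda>(t, z, w). z k)"
  | var_w: "k \<le> j \<Longrightarrow> bihom_poly r i j 0 1 (\<lambda>(t, z, w). w k)"
  | add: "bihom_poly r i j d e F \<Longrightarrow> bihom_poly r i j d e G \<Longrightarrow>
      bihom_poly r i j d e (\<lambda>v. F v + G v)"
  | mult: "bihom_poly r i j d e F \<Longrightarrow> bihom_poly r i j d' e' G \<Longrightarrow>
      bihom_poly r i j (d + d') (e + e') (\<lambda>v. F v * G v)"

text \<open>
  A variety is given by its Zariski topology and, for every open set, the regular functions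
  on it. Functions are total in HOL; only the values on the open set matter.
\<close>

record 'a fun_space =
  zariski :: "'a topology"
  regular :: "'a set \<Rightarrow> ('a \<Rightarrow> complex) set"

text \<open>
  The structure of a locally closed subset \<open>X\<close> of \<open>\<A>\<^sup>r \<times> \<P>\<^sup>i \<times> \<P>\<^sup>j\<close>, where \<open>hc x\<close> is the set of
  all coordinate triples \<open>(t, z, w)\<close> of the point \<open>x\<close>: open sets are unions of nonvanishing
  loci of bihomogeneous polynomials (these loci are closed under intersection), and regular
  functions are locally quotients of two such polynomials of the same bidegree.
\<close>

definition zariski_topology ::
    "nat \<Rightarrow> nat \<Rightarrow> nat \<Rightarrow> ('a \<Rightarrow> (vec \<times> vec \<times> vec) set) \<Rightarrow> 'a set \<Rightarrow> 'a topology" where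
  "zariski_topology r i j hc X =
    topology_generated_by {{x \<in> X. \<forall>v\<in>hc x. F v \<noteq> 0} | F d e. bihom_poly r i j d e F}"

definition regular_functions ::
    "nat \<Rightarrow> nat \<Rightarrow> nat \<Rightarrow> ('a \<Rightarrow> (vec \<times> vec \<times> vec) set) \<Rightarrow> 'a set \<Rightarrow>
      'a set \<Rightarrow> ('a \<Rightarrow> complex) set" where
  "regular_functions r i j hc X U =
    {f. \<forall>x\<in>U. \<exists>V d e F G.
        openin (zariski_topology r i j hc X) V \<and> x \<in> V \<and> V \<subseteq> U \<and>
        bihom_poly r i j d e F \<and> bihom_poly r i j d e G \<and>
        (\<forall>y\<in>V. \<forall>v\<in>hc y. G v \<noteq> 0 \<and> f y = F v / G v)}"

definition embedded_variety ::
    "nat \<Rightarrow> nat \<Rightarrow> nat \<Rightarrow> ('a \<Rightarrow> (vec \<times> vec \<times> vec) set) \<Rightarrow> 'a set \<Rightarrow> 'a fun_space" where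
  "embedded_variety r i j hc X =
    \<lparr>zariski = zariski_topology r i j hc X, regular = regular_functions r i j hc X\<rparr>"

definition variety_morphism :: "'a fun_space \<Rightarrow> 'b fun_space \<Rightarrow> ('a \<Rightarrow> 'b) \<Rightarrow> bool" where
  "variety_morphism A B f \<longleftrightarrow>
    continuous_map (zariski A) (zariski B) f \<and>
    (\<forall>V g. openin (zariski B) V \<longrightarrow> g \<in> regular B V \<longrightarrow>
      g \<circ> f \<in> regular A {x \<in> topspace (zariski A). f x \<in> V})"

definition variety_automorphism :: "'a fun_space \<Rightarrow> ('a \<Rightarrow> 'a) \<Rightarrow> bool" where
  "variety_automorphism A f \<longleftrightarrow> variety_morphism A A f \<and>
    (\<exists>g. variety_morphism A A g \<and>
      (\<forall>x\<in>topspace (zariski A). g (f x) = x \<and> f (g x) = x))"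

section \<open>Algebraic torus actions\<close>

definition torus :: "nat \<Rightarrow> vec monoid" where
  "torus r = \<lparr>carrier = {t \<in> cspace r. \<forall>k<r. t k \<noteq> 0},
              mult = (\<lambda>s t k. s k * t k),
              one = (\<lambda>k. if k < r then 1 else 0)\<rparr>"

text \<open>A subset \<open>X\<close> of \<open>\<P>\<^sup>i \<times> \<P>\<^sup>j = \<A>\<^sup>0 \<times> \<P>\<^sup>i \<times> \<P>\<^sup>j\<close>; the only point of \<open>\<A>\<^sup>0\<close> is the zero sequence.\<close>

definition biproj_variety ::
    "nat \<Rightarrow> nat \<Rightarrow> (vec set \<times> vec set) set \<Rightarrow> (vec set \<times> vec set) fun_space" where
  "biproj_variety i j X = embedded_variety 0 i j (\<lambda>(P, Q). {\<lambda>_. 0} \<times> P \<times> Q) X"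

text \<open>The product variety \<open>(\<complex>\<^sup>\<times>)\<^sup>r \<times> X\<close>, inside \<open>\<A>\<^sup>r \<times> \<P>\<^sup>i \<times> \<P>\<^sup>j\<close>.\<close>

definition torus_times_variety ::
    "nat \<Rightarrow> nat \<Rightarrow> nat \<Rightarrow> (vec set \<times> vec set) set \<Rightarrow>
      (vec \<times> vec set \<times> vec set) fun_space" where
  "torus_times_variety r i j X =
    embedded_variety r i j (\<lambda>(t, P, Q). {t} \<times> P \<times> Q) (carrier (torus r) \<times> X)"

definition algebraic_torus_action ::
    "nat \<Rightarrow> nat \<Rightarrow> nat \<Rightarrow> (vec set \<times> vec set) set \<Rightarrow>
      (vec \<Rightarrow> vec set \<times> vec set \<Rightarrow> vec set \<times> vec set) \<Rightarrow> bool" where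
  "algebraic_torus_action r i j X \<phi> \<longleftrightarrow>
    group_action (torus r) X \<phi> \<and>
    (\<forall>t\<in>carrier (torus r). variety_automorphism (biproj_variety i j X) (\<phi> t)) \<and>
    variety_morphism (torus_times_variety r i j X) (biproj_variety i j X) (\<lambda>(t, x). \<phi> t x)"

definition effective_torus_action ::
    "nat \<Rightarrow> nat \<Rightarrow> nat \<Rightarrow> (vec set \<times> vec set) set \<Rightarrow>
      (vec \<Rightarrow> vec set \<times> vec set \<Rightarrow> vec set \<times> vec set) \<Rightarrow> bool" where
  "effective_torus_action r i j X \<phi> \<longleftrightarrow>
    algebraic_torus_action r i j X \<phi> \<and>
    (\<forall>t\<in>carrier (torus r). (\<forall>x\<in>X. \<phi> t x = x) \<longrightarrow> t = one (torus r))"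

definition is_largest_torus_action_dim :: "nat \<Rightarrow> nat \<Rightarrow> (vec set \<times> vec set) set \<Rightarrow> nat \<Rightarrow> bool" where
  "is_largest_torus_action_dim i j X m \<longleftrightarrow>
    (\<exists>\<phi>. effective_torus_action m i j X \<phi>) \<and>
    (\<forall>r \<phi>. effective_torus_action r i j X \<phi> \<longrightarrow> r \<le> m)"

end

theory Submission
  imports
    Defs
    "HOL-Complex_Analysis.Cauchy_Integral_Formula"
    "HOL-Homology.Invariance_of_Domain"
begin

text \<open>
  A torus of dimension \<open>j\<close> acts on \<open>H\<^sub>i\<^sub>,\<^sub>j\<close> for \<open>i \<le> j\<close> by \<open>z\<^sub>k \<mapsto> t\<^sub>k z\<^sub>k\<close> and \<open>w\<^sub>k \<mapsto> t\<^sub>k\<inverse> w\<^sub>k\<close> with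
  \<open>t\<^sub>0 = 1\<close>: every product \<open>z\<^sub>k w\<^sub>k\<close> is invariant, and the ratios \<open>w\<^sub>k / w\<^sub>0\<close> show that the action is
  effective (\<open>standard_action_effective\<close>). Exchanging the two factors reduces everything to the case
  \<open>i \<le> j\<close>, and \<open>H\<^sub>0\<^sub>,\<^sub>0\<close> is empty.

  For the upper bound let \<open>1 \<le> i \<le> j\<close> and let a torus \<open>T\<close> of dimension \<open>r\<close> act effectively. The bound
  \<open>r \<le> j\<close> holds because \<open>T\<close> then also acts effectively on \<open>\<P>\<^sup>j\<close>.

  First, the action descends to both factors. Two points with the same \<open>w\<close> lie on a line
  \<open>(z + s (z' - z), w)\<close> in the hypersurface. If \<open>t\<close> is close to \<open>1\<close> in the classical topology, then by
  compactness \<open>t\<close> moves no point far, so the second component of the image of the line stays in one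
  affine chart and is bounded there; by Liouville's theorem it is constant. Every \<open>t\<close> is a power of
  an element close to \<open>1\<close>, so \<open>t\<close> maps fibres to fibres (\<open>action_preserves_fibres\<close>). This is a hands-on
  form of Blanchard's lemma.

  Second, an element \<open>t\<close> that acts trivially on \<open>\<P>\<^sup>j\<close> is trivial. It maps \<open>(z, w)\<close> to \<open>(z', w)\<close>, where
  \<open>z'\<close> depends only on \<open>z\<close>, so \<open>z'\<close> is orthogonal to all \<open>w\<close> that are orthogonal to \<open>z\<close>; as \<open>i \<le> j\<close>,
  these \<open>w\<close> determine \<open>z\<close> up to a scalar (\<open>trivial_if_trivial_on_projection\<close>).

  Third, a torus that acts effectively on \<open>\<P>\<^sup>j\<close> has dimension at most \<open>j\<close>. None of the finitely many
  \<open>\<epsilon> \<noteq> 1\<close> in \<open>{1, -1}\<^sup>r\<close> acts trivially on \<open>\<P>\<^sup>j\<close>, and the points that \<open>\<epsilon>\<close> moves form an open set;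
  by irreducibility (\<open>milnor_cone_irreducible\<close>) some point of \<open>\<P>\<^sup>j\<close> is moved by all \<open>\<epsilon>\<close>. Its
  stabiliser \<open>S\<close> is a Zariski closed subgroup of \<open>T\<close> that contains no such \<open>\<epsilon>\<close>. Linear independence
  of characters turns each \<open>\<epsilon> \<notin> S\<close> into a character that is trivial on \<open>S\<close> and not at \<open>\<epsilon>\<close>, and
  elimination with odd pivots shows that these characters leave only finitely many elements for \<open>S\<close>
  (\<open>separated_from_signs_finite\<close>). Hence the orbit map is injective near \<open>1\<close>, and it maps an open
  subset of \<open>\<complex>\<^sup>r\<close> continuously to an affine chart \<open>\<complex>\<^sup>j\<close>; by invariance of domain, \<open>r \<le> j\<close>.
\<close>

section \<open>Bihomogeneous polynomials and morphisms\<close>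

lemma bihom_poly_scale:
  assumes "bihom_poly r i j d e F"
  shows "F (t, \<lambda>k. a * z k, \<lambda>k. b * w k) = a ^ d * b ^ e * F (t, z, w)"
  using assms by induction (simp_all add: power_add algebra_simps)

lemma bihom_poly_subst:
  assumes "bihom_poly r i j d e F"
    and "\<And>k. k < r \<Longrightarrow> bihom_poly r' i' j' 0 0 (\<lambda>v. T v k)"
    and "\<And>k. k \<le> i \<Longrightarrow> bihom_poly r' i' j' a b (\<lambda>v. Z v k)"
    and "\<And>k. k \<le> j \<Longrightarrow> bihom_poly r' i' j' a' b' (\<lambda>v. W v k)"
  shows "bihom_poly r' i' j' (d * a + e * a') (d * b + e * b') (\<lambda>v. F (T v, Z v, W v))"
  using assms(1)
proof induction
  case (mult d e F d' e' G)
  then show ?case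
    using bihom_poly.mult[OF mult.IH] by (simp add: algebra_simps)
qed (use assms(2-4) in \<open>simp_all add: bihom_poly.intros\<close>)

lemma bihom_poly_cmult:
  "bihom_poly r i j d e F \<Longrightarrow> bihom_poly r i j d e (\<lambda>v. c * F v)"
  using bihom_poly.mult[OF bihom_poly.const[of _ _ _ c]] by force

lemma bihom_poly_diff:
  assumes "bihom_poly r i j d e F" "bihom_poly r i j d e G"
  shows "bihom_poly r i j d e (\<lambda>v. F v - G v)"
  using bihom_poly.add[OF assms(1) bihom_poly_cmult[OF assms(2), of "-1"]] by simp

lemma bihom_poly_prod:
  assumes "finite A" "\<And>k. k \<in> A \<Longrightarrow> bihom_poly r i j 0 0 (F k)"
  shows "bihom_poly r i j 0 0 (\<lambda>v. \<Prod>k\<in>A. F k v)"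
  using assms
proof (induction A)
  case (insert k A)
  then show ?case
    using bihom_poly.mult[of r i j 0 0 "F k" 0 0 "\<lambda>v. \<Prod>k\<in>A. F k v"] by simp
qed (simp add: bihom_poly.const)

text \<open>
  For such a coordinate map, nonvanishing of a bihomogeneous polynomial and the quotient of two
  polynomials of the same bidegree can be read off from any one representative of a point.
\<close>

definition homogeneous_coords :: "('a \<Rightarrow> (Defs.vec \<times> Defs.vec \<times> Defs.vec) set) \<Rightarrow> 'a set \<Rightarrow> bool" where
  "homogeneous_coords hc X \<longleftrightarrow> (\<forall>x\<in>X. hc x \<noteq> {} \<and>
    (\<forall>t z w t' z' w'. (t, z, w) \<in> hc x \<longrightarrow> (t', z', w') \<in> hc x \<longrightarrow>
       t' = t \<and> (\<exists>a b. a \<noteq> 0 \<and> b \<noteq> 0 \<and> z' = (\<lambda>k. a * z k) \<and> w' = (\<lambda>k. b * w k))))"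

lemma homogeneous_coords_scale:
  assumes "homogeneous_coords hc X" "x \<in> X" "u \<in> hc x" "v \<in> hc x"
  obtains a b where "a \<noteq> 0" "b \<noteq> 0"
    "\<And>r i j d e F. bihom_poly r i j d e F \<Longrightarrow> F v = a ^ d * b ^ e * F u"
proof -
  obtain t z w t' z' w' where u: "u = (t, z, w)" and v: "v = (t', z', w')"
    by (metis prod_cases3)
  obtain a b where ab: "a \<noteq> 0" "b \<noteq> 0" "t' = t" "z' = (\<lambda>k. a * z k)" "w' = (\<lambda>k. b * w k)"
    using assms unfolding homogeneous_coords_def u v by blast
  show thesis
    by (rule that[of a b]) (use ab in \<open>simp_all add: u v bihom_poly_scale\<close>)
qed

lemma homogeneous_coords_nonzero_iff:
  assumes "homogeneous_coords hc X" "x \<in> X" "v \<in> hc x" "bihom_poly r i j d e F"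
  shows "(\<forall>u\<in>hc x. F u \<noteq> 0) \<longleftrightarrow> F v \<noteq> 0"
proof safe
  fix u assume u: "F v \<noteq> 0" "u \<in> hc x" "F u = 0"
  obtain a b where "F v = a ^ d * b ^ e * F u"
    using homogeneous_coords_scale[OF assms(1,2) u(2) assms(3)] assms(4) by metis
  with u show False by simp
qed (use assms in auto)

lemma homogeneous_coords_quotient:
  assumes "homogeneous_coords hc X" "x \<in> X" "u \<in> hc x" "v \<in> hc x"
    "bihom_poly r i j d e F" "bihom_poly r i j d e G"
  shows "F v / G v = F u / G u"
proof -
  obtain a b where "a \<noteq> 0" "b \<noteq> 0"
    "\<And>r i j d e F. bihom_poly r i j d e F \<Longrightarrow> F v = a ^ d * b ^ e * F u"
    using homogeneous_coords_scale[OF assms(1-4)] by metis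
  from this(1,2) this(3)[OF assms(5)] this(3)[OF assms(6)] show ?thesis by simp
qed

lemma topspace_zariski [simp]: "topspace (zariski_topology r i j hc X) = X"
proof -
  have "X = {x \<in> X. \<forall>v\<in>hc x. (\<lambda>_. 1) v \<noteq> (0::complex)}" by simp
  moreover have "bihom_poly r i j 0 0 (\<lambda>_. 1)" by (rule bihom_poly.const)
  ultimately have "X \<in> {{x \<in> X. \<forall>v\<in>hc x. F v \<noteq> 0} | F d e. bihom_poly r i j d e F}"
    by (intro CollectI exI[of _ "\<lambda>_. 1"] exI[of _ 0]) blast
  then show ?thesis
    unfolding zariski_topology_def topology_generated_by_topspace by blast
qed

lemma openin_zariski_nonvanishing:
  "bihom_poly r i j d e F \<Longrightarrow> openin (zariski_topology r i j hc X) {x \<in> X. \<forall>v\<in>hc x. F v \<noteq> 0}"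
  unfolding zariski_topology_def by (rule topology_generated_by_Basis) blast

text \<open>
  The nonvanishing loci form a base, not only a subbase, because \<open>H \<noteq> 0\<close> and \<open>H' \<noteq> 0\<close> together say
  \<open>H H' \<noteq> 0\<close>.
\<close>

lemma zariski_nonvanishing_base:
  assumes "openin (zariski_topology r i j hc X) V" "x \<in> V"
  shows "\<exists>d e H. bihom_poly r i j d e H \<and> x \<in> X \<and> (\<forall>v\<in>hc x. H v \<noteq> 0) \<and>
    {y \<in> X. \<forall>v\<in>hc y. H v \<noteq> 0} \<subseteq> V"
proof -
  have "generate_topology_on {{x \<in> X. \<forall>v\<in>hc x. F v \<noteq> 0} | F d e. bihom_poly r i j d e F} V"
    using assms(1) unfolding zariski_topology_def openin_topology_generated_by_iff .
  then show ?thesis using assms(2)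
  proof induction
    case (Int A B)
    from Int.IH(1)[OF IntD1[OF Int.prems]] obtain d e H where
      *: "bihom_poly r i j d e H" "x \<in> X" "\<forall>v\<in>hc x. H v \<noteq> 0" "{y \<in> X. \<forall>v\<in>hc y. H v \<noteq> 0} \<subseteq> A"
      by blast
    from Int.IH(2)[OF IntD2[OF Int.prems]] obtain d' e' H' where
      **: "bihom_poly r i j d' e' H'" "\<forall>v\<in>hc x. H' v \<noteq> 0" "{y \<in> X. \<forall>v\<in>hc y. H' v \<noteq> 0} \<subseteq> B"
      by blast
    have "{y \<in> X. \<forall>v\<in>hc y. H v * H' v \<noteq> 0} \<subseteq> A \<inter> B"
      using *(4) **(3) by (auto simp: subset_iff)
    moreover have "\<forall>v\<in>hc x. H v * H' v \<noteq> 0" using *(3) **(2) by simp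
    ultimately show ?case
      using bihom_poly.mult[OF *(1) **(1)] *(2) by blast
  next
    case (UN K)
    then obtain k where "k \<in> K" "x \<in> k" by blast
    with UN.IH[of k] show ?case by blast
  next
    case (Basis U)
    then show ?case by blast
  qed simp
qed

text \<open>
  The form in which regular functions are used: the neighbourhood \<open>V\<close> is replaced by the locus
  \<open>H \<noteq> 0\<close> of a single polynomial, so that everything is expressed by polynomials in coordinates.
\<close>

lemma regular_function_local_quotient:
  assumes "homogeneous_coords hc X" "f \<in> regular_functions r i j hc X U" "x \<in> U" "x \<in> X"
  obtains d e d' e' H F G where
    "bihom_poly r i j d e F" "bihom_poly r i j d e G" "bihom_poly r i j d' e' H"
    "\<And>v. v \<in> hc x \<Longrightarrow> H v \<noteq> 0"
    "\<And>y v. y \<in> X \<Longrightarrow> v \<in> hc y \<Longrightarrow> H v \<noteq> 0 \<Longrightarrow> y \<in> U \<and> G v \<noteq> 0 \<and> f y = F v / G v"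
proof -
  obtain V d e F G where V: "openin (zariski_topology r i j hc X) V" "x \<in> V" "V \<subseteq> U"
    "bihom_poly r i j d e F" "bihom_poly r i j d e G"
    "\<forall>y\<in>V. \<forall>v\<in>hc y. G v \<noteq> 0 \<and> f y = F v / G v"
    using assms(2,3) unfolding regular_functions_def by blast
  obtain d' e' H where H: "bihom_poly r i j d' e' H" "\<forall>v\<in>hc x. H v \<noteq> 0"
    "{y \<in> X. \<forall>v\<in>hc y. H v \<noteq> 0} \<subseteq> V"
    using zariski_nonvanishing_base[OF V(1,2)] by blast
  show thesis
  proof (rule that[OF V(4,5) H(1)])
    fix y v assume y: "y \<in> X" "v \<in> hc y" "H v \<noteq> 0"
    then have "y \<in> V"
      using H(3) homogeneous_coords_nonzero_iff[OF assms(1) y(1,2) H(1)] by blast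
    then show "y \<in> U \<and> G v \<noteq> 0 \<and> f y = F v / G v" using V y by blast
  qed (use H in blast)
qed

text \<open>
  A map that is given in coordinates by a polynomial substitution \<open>\<sigma>\<close> is a morphism: \<open>\<sigma>\<close> pulls back
  nonvanishing loci to nonvanishing loci, and quotients of bihomogeneous polynomials to such
  quotients. The functions \<open>D\<close> and \<open>E\<close> allow \<open>\<sigma>\<close> to change the bidegree, as the exchange of the two
  factors does.
\<close>

lemma variety_morphism_subst:
  assumes hom: "homogeneous_coords hc' Y" and X: "\<And>x. x \<in> X \<Longrightarrow> hc x \<noteq> {}"
    and fX: "\<And>x. x \<in> X \<Longrightarrow> f x \<in> Y"
    and \<sigma>: "\<And>x v. x \<in> X \<Longrightarrow> v \<in> hc x \<Longrightarrow> \<sigma> v \<in> hc' (f x)"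
    and poly: "\<And>d e F. bihom_poly r' i' j' d e F \<Longrightarrow> bihom_poly r i j (D d e) (E d e) (\<lambda>v. F (\<sigma> v))"
  shows "variety_morphism (embedded_variety r i j hc X) (embedded_variety r' i' j' hc' Y) f"
proof -
  have pull: "(\<forall>v\<in>hc x. F (\<sigma> v) \<noteq> 0) \<longleftrightarrow> (\<forall>u\<in>hc' (f x). F u \<noteq> 0)"
    if "x \<in> X" "bihom_poly r' i' j' d e F" for x d e F
    using homogeneous_coords_nonzero_iff[OF hom fX[OF that(1)] \<sigma>[OF that(1)] that(2)] X[OF that(1)]
      that(1) by blast
  have cont: "continuous_map (zariski_topology r i j hc X) (zariski_topology r' i' j' hc' Y) f"
    unfolding zariski_topology_def[of r' i' j' hc' Y] continuous_on_generated_topo_iff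
  proof (intro conjI allI impI)
    fix U assume "U \<in> {{x \<in> Y. \<forall>v\<in>hc' x. F v \<noteq> 0} |F d e. bihom_poly r' i' j' d e F}"
    then obtain F d e where F: "bihom_poly r' i' j' d e F" "U = {x \<in> Y. \<forall>v\<in>hc' x. F v \<noteq> 0}"
      by blast
    have "f -` U \<inter> X = {x \<in> X. \<forall>v\<in>hc x. F (\<sigma> v) \<noteq> 0}"
      using pull[OF _ F(1)] fX unfolding F(2) by blast
    then show "openin (zariski_topology r i j hc X) (f -` U \<inter> topspace (zariski_topology r i j hc X))"
      using openin_zariski_nonvanishing[OF poly[OF F(1)]] by simp
  next
    show "f ` topspace (zariski_topology r i j hc X) \<subseteq> \<Union> {{x \<in> Y. \<forall>v\<in>hc' x. F v \<noteq> 0} |F d e. bihom_poly r' i' j' d e F}"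
      using fX topspace_zariski[of r' i' j' hc' Y]
      unfolding zariski_topology_def[of r' i' j' hc' Y] topology_generated_by_topspace by auto
  qed
  moreover have "g \<circ> f \<in> regular_functions r i j hc X {x \<in> X. f x \<in> V}"
    if V: "openin (zariski_topology r' i' j' hc' Y) V" and g: "g \<in> regular_functions r' i' j' hc' Y V"
    for V g
    unfolding regular_functions_def
  proof safe
    fix x assume x: "x \<in> X" "f x \<in> V"
    obtain d e d' e' H F G where
      H: "bihom_poly r' i' j' d e F" "bihom_poly r' i' j' d e G" "bihom_poly r' i' j' d' e' H"
        "\<And>v. v \<in> hc' (f x) \<Longrightarrow> H v \<noteq> 0"
        "\<And>y v. y \<in> Y \<Longrightarrow> v \<in> hc' y \<Longrightarrow> H v \<noteq> 0 \<Longrightarrow> y \<in> V \<and> G v \<noteq> 0 \<and> g y = F v / G v"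
      using regular_function_local_quotient[OF hom g x(2) fX[OF x(1)]] by metis
    let ?V = "{y \<in> X. \<forall>v\<in>hc y. H (\<sigma> v) \<noteq> 0}"
    show "\<exists>W d e F G. openin (zariski_topology r i j hc X) W \<and> x \<in> W \<and> W \<subseteq> {x \<in> X. f x \<in> V} \<and>
        bihom_poly r i j d e F \<and> bihom_poly r i j d e G \<and>
        (\<forall>y\<in>W. \<forall>v\<in>hc y. G v \<noteq> 0 \<and> (g \<circ> f) y = F v / G v)"
    proof (intro exI conjI)
      show "openin (zariski_topology r i j hc X) ?V"
        by (rule openin_zariski_nonvanishing[OF poly[OF H(3)]])
      show "bihom_poly r i j (D d e) (E d e) (\<lambda>v. F (\<sigma> v))" "bihom_poly r i j (D d e) (E d e) (\<lambda>v. G (\<sigma> v))"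
        using poly H by blast+
      show "x \<in> ?V" using x H(4) \<sigma> by blast
      show "?V \<subseteq> {x \<in> X. f x \<in> V}" using H(5) fX \<sigma> X by blast
      show "\<forall>y\<in>?V. \<forall>v\<in>hc y. G (\<sigma> v) \<noteq> 0 \<and> (g \<circ> f) y = F (\<sigma> v) / G (\<sigma> v)"
        unfolding o_def using H(5)[OF fX \<sigma>] by blast
    qed
  qed
  ultimately show ?thesis
    by (simp add: variety_morphism_def embedded_variety_def)
qed

lemma variety_morphism_compose:
  assumes "variety_morphism A B f" "variety_morphism B C g"
  shows "variety_morphism A C (g \<circ> f)"
  unfolding variety_morphism_def
proof (intro conjI allI impI)
  have f: "continuous_map (zariski A) (zariski B) f" and g: "continuous_map (zariski B) (zariski C) g"
    using assms unfolding variety_morphism_def by blast+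
  show "continuous_map (zariski A) (zariski C) (g \<circ> f)"
    by (rule continuous_map_compose[OF f g])
  fix V h assume V: "openin (zariski C) V" "h \<in> regular C V"
  let ?W = "{x \<in> topspace (zariski B). g x \<in> V}"
  have "openin (zariski B) ?W" by (rule openin_continuous_map_preimage[OF g V(1)])
  moreover have "h \<circ> g \<in> regular B ?W"
    using assms(2) V unfolding variety_morphism_def by blast
  ultimately have "(h \<circ> g) \<circ> f \<in> regular A {x \<in> topspace (zariski A). f x \<in> ?W}"
    using assms(1) unfolding variety_morphism_def by blast
  moreover have "{x \<in> topspace (zariski A). f x \<in> ?W} = {x \<in> topspace (zariski A). (g \<circ> f) x \<in> V}"
    using continuous_map_image_subset_topspace[OF f] by (auto simp: image_subset_iff)
  ultimately show "h \<circ> (g \<circ> f) \<in> regular A {x \<in> topspace (zariski A). (g \<circ> f) x \<in> V}"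
    by (simp add: comp_assoc)
qed

text \<open>
  Functions are total, so a map that is restricted to the variety (as group actions are) has to be
  compared with the unrestricted composition of morphisms.
\<close>

lemma variety_morphism_cong:
  assumes "variety_morphism (embedded_variety r i j hc X) B f" "\<And>x. x \<in> X \<Longrightarrow> f x = g x"
  shows "variety_morphism (embedded_variety r i j hc X) B g"
proof -
  let ?A = "embedded_variety r i j hc X"
  have top: "topspace (zariski ?A) = X" by (simp add: embedded_variety_def)
  have "continuous_map (zariski ?A) (zariski B) g"
  proof (rule continuous_map_eq)
    show "continuous_map (zariski ?A) (zariski B) f" using assms(1) unfolding variety_morphism_def by blast
  qed (use assms(2) top in simp)
  moreover have "h \<circ> g \<in> regular ?A {x \<in> X. g x \<in> V}"
    if "openin (zariski B) V" "h \<in> regular B V" for V h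
  proof -
    have f: "h \<circ> f \<in> regular ?A {x \<in> X. f x \<in> V}"
      using assms(1) that unfolding variety_morphism_def top by blast
    have U: "{x \<in> X. f x \<in> V} = {x \<in> X. g x \<in> V}" using assms(2) by auto
    show ?thesis unfolding embedded_variety_def regular_functions_def
    proof (simp only: fun_space.simps, intro CollectI ballI)
      fix x assume x: "x \<in> {x \<in> X. g x \<in> V}"
      then obtain W d e F G where W: "openin (zariski_topology r i j hc X) W" "x \<in> W" "W \<subseteq> {x \<in> X. g x \<in> V}"
        "bihom_poly r i j d e F" "bihom_poly r i j d e G"
        "\<forall>y\<in>W. \<forall>v\<in>hc y. G v \<noteq> 0 \<and> (h \<circ> f) y = F v / G v"
        using f unfolding U embedded_variety_def regular_functions_def fun_space.simps by blast
      have "\<forall>y\<in>W. \<forall>v\<in>hc y. G v \<noteq> 0 \<and> (h \<circ> g) y = F v / G v"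
        using W(3,6) assms(2) by (simp add: subset_iff)
      then show "\<exists>W d e F G. openin (zariski_topology r i j hc X) W \<and> x \<in> W \<and> W \<subseteq> {x \<in> X. g x \<in> V} \<and>
        bihom_poly r i j d e F \<and> bihom_poly r i j d e G \<and> (\<forall>y\<in>W. \<forall>v\<in>hc y. G v \<noteq> 0 \<and> (h \<circ> g) y = F v / G v)"
        using W(1-5) by blast
    qed
  qed
  ultimately show ?thesis unfolding variety_morphism_def top by blast
qed

lemma topspace_biproj [simp]: "topspace (zariski (biproj_variety i j X)) = X"
  by (simp add: biproj_variety_def embedded_variety_def)

lemma homogeneous_coords_nonempty: "homogeneous_coords hc X \<Longrightarrow> x \<in> X \<Longrightarrow> hc x \<noteq> {}"
  by (drule homogeneous_coords_def[THEN iffD1], drule (1) bspec, erule conjunct1)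

section \<open>Points of the hypersurface\<close>

definition nonzero_vecs :: "nat \<Rightarrow> Defs.vec set" where
  "nonzero_vecs n = cspace (Suc n) - {\<lambda>_. 0}"

definition proj_class :: "nat \<Rightarrow> Defs.vec \<Rightarrow> Defs.vec set" where
  "proj_class n v = proj_rel n `` {v}"

lemma nonzero_vecs_scale:
  "v \<in> nonzero_vecs n \<Longrightarrow> c \<noteq> 0 \<Longrightarrow> (\<lambda>k. c * v k) \<in> nonzero_vecs n"
  by (auto simp: nonzero_vecs_def cspace_def fun_eq_iff)

lemma nonzero_vecs_coord: "v \<in> nonzero_vecs n \<Longrightarrow> \<exists>k\<le>n. v k \<noteq> 0"
  by (force simp: nonzero_vecs_def cspace_def fun_eq_iff not_less_eq_eq)

lemma mem_proj_class:
  "v \<in> nonzero_vecs n \<Longrightarrow> w \<in> proj_class n v \<longleftrightarrow> (\<exists>c. c \<noteq> 0 \<and> w = (\<lambda>k. c * v k))"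
  using nonzero_vecs_scale[of v n] 
  by (auto simp: proj_class_def proj_rel_def nonzero_vecs_def)

lemma self_mem_proj_class: "v \<in> nonzero_vecs n \<Longrightarrow> v \<in> proj_class n v"
  unfolding mem_proj_class by (rule exI[of _ 1]) simp

lemma proj_space_eq: "proj_space n = proj_class n ` nonzero_vecs n"
  by (auto simp: proj_space_def quotient_def proj_class_def nonzero_vecs_def)

lemma proj_class_scale:
  assumes "v \<in> nonzero_vecs n" "c \<noteq> 0"
  shows "proj_class n (\<lambda>k. c * v k) = proj_class n v"
proof (rule Set.set_eqI)
  fix w :: Defs.vec
  have "(\<exists>a. a \<noteq> 0 \<and> w = (\<lambda>k. a * (c * v k))) \<longleftrightarrow> (\<exists>a. a \<noteq> 0 \<and> w = (\<lambda>k. a * v k))"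
  proof safe
    fix a :: complex assume "a \<noteq> 0"
    then show "\<exists>b. b \<noteq> 0 \<and> (\<lambda>k. a * (c * v k)) = (\<lambda>k. b * v k)"
      by (intro exI[of _ "a * c"]) (use assms in auto)
    show "\<exists>b. b \<noteq> 0 \<and> (\<lambda>k. a * v k) = (\<lambda>k. b * (c * v k))"
      by (intro exI[of _ "a / c"]) (use assms \<open>a \<noteq> 0\<close> in auto)
  qed
  then show "w \<in> proj_class n (\<lambda>k. c * v k) \<longleftrightarrow> w \<in> proj_class n v"
    using assms by (simp add: mem_proj_class nonzero_vecs_scale)
qed

lemma proj_class_eq_iff:
  assumes "v \<in> nonzero_vecs n" "w \<in> nonzero_vecs n"
  shows "proj_class n v = proj_class n w \<longleftrightarrow> (\<exists>c. c \<noteq> 0 \<and> w = (\<lambda>k. c * v k))"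
  using assms self_mem_proj_class[of w n] mem_proj_class[of v n w] proj_class_scale[of v n] by metis

lemma proj_class_eqI:
  assumes v: "v \<in> nonzero_vecs n" and w: "w \<in> nonzero_vecs n"
    and k: "w k \<noteq> 0" and eq: "\<And>l. v l * w k = w l * v k"
  shows "proj_class n v = proj_class n w"
proof -
  have "v k \<noteq> 0"
  proof
    assume "v k = 0"
    then have "v l = 0" for l using eq[of l] k by simp
    then show False using nonzero_vecs_coord[OF v] by simp
  qed
  then show ?thesis
    unfolding proj_class_eq_iff[OF v w]
    by (intro exI[of _ "w k / v k"]) (use k eq in \<open>auto simp: fun_eq_iff field_simps\<close>)
qed

lemma proj_space_mem:
  assumes "P \<in> proj_space n" "v \<in> P"
  shows "v \<in> nonzero_vecs n" "P = proj_class n v"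
proof -
  obtain u where u: "u \<in> nonzero_vecs n" "P = proj_class n u"
    using assms unfolding proj_space_eq by blast
  then obtain c where "c \<noteq> 0" "v = (\<lambda>k. c * u k)" using assms(2) mem_proj_class by blast
  then show "v \<in> nonzero_vecs n" "P = proj_class n v"
    using u nonzero_vecs_scale proj_class_scale by simp_all
qed

definition milnor_cone :: "nat \<Rightarrow> nat \<Rightarrow> (Defs.vec \<times> Defs.vec) set" where
  "milnor_cone i j = {(z, w). z \<in> nonzero_vecs i \<and> w \<in> nonzero_vecs j \<and> (\<Sum>k\<le>min i j. z k * w k) = 0}"

definition biproj_point :: "nat \<Rightarrow> nat \<Rightarrow> Defs.vec \<Rightarrow> Defs.vec \<Rightarrow> Defs.vec set \<times> Defs.vec set" where
  "biproj_point i j z w = (proj_class i z, proj_class j w)"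

lemma biproj_point_mem_iff:
  assumes "z \<in> nonzero_vecs i" "w \<in> nonzero_vecs j"
  shows "biproj_point i j z w \<in> milnor_hypersurface i j \<longleftrightarrow> (z, w) \<in> milnor_cone i j"
proof -
  have "(\<Sum>k\<le>min i j. (a * z k) * (b * w k)) = a * b * (\<Sum>k\<le>min i j. z k * w k)" for a b
    by (simp add: sum_distrib_left algebra_simps)
  moreover have "z \<in> proj_class i z" "w \<in> proj_class j w"
    using assms self_mem_proj_class by auto
  ultimately have "(\<forall>a\<in>proj_class i z. \<forall>b\<in>proj_class j w. (\<Sum>k\<le>min i j. a k * b k) = 0) \<longleftrightarrow>
      (\<Sum>k\<le>min i j. z k * w k) = 0"
    using mem_proj_class[OF assms(1)] mem_proj_class[OF assms(2)]
      self_mem_proj_class[OF assms(1)] self_mem_proj_class[OF assms(2)] by fastforce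
  then show ?thesis
    using assms by (simp add: milnor_hypersurface_def milnor_cone_def biproj_point_def proj_space_eq)
qed

lemma milnor_hypersurface_coords:
  assumes "x \<in> milnor_hypersurface i j" "z \<in> fst x" "w \<in> snd x"
  shows "(z, w) \<in> milnor_cone i j" "x = biproj_point i j z w"
  using assms proj_space_mem[of "fst x" i z] proj_space_mem[of "snd x" j w]
  by (auto simp: milnor_hypersurface_def milnor_cone_def biproj_point_def)

lemma proj_space_nonempty: "P \<in> proj_space n \<Longrightarrow> \<exists>v. v \<in> P"
  using self_mem_proj_class unfolding proj_space_eq by blast

lemma milnor_hypersurface_cases:
  assumes "x \<in> milnor_hypersurface i j"
  obtains z w where "(z, w) \<in> milnor_cone i j" "x = biproj_point i j z w"
proof -
  have "fst x \<in> proj_space i" "snd x \<in> proj_space j"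
    using assms by (auto simp: milnor_hypersurface_def)
  then show thesis
    using milnor_hypersurface_coords[OF assms] proj_space_nonempty that by metis
qed

lemma milnor_coneD:
  assumes "(z, w) \<in> milnor_cone i j"
  shows "z \<in> nonzero_vecs i" "w \<in> nonzero_vecs j" "(\<Sum>k\<le>min i j. z k * w k) = 0"
    "biproj_point i j z w \<in> milnor_hypersurface i j" "z \<in> proj_class i z" "w \<in> proj_class j w"
  using assms biproj_point_mem_iff[of z i w j] self_mem_proj_class by (auto simp: milnor_cone_def)

lemma homogeneous_coords_torus_times:
  assumes "X \<subseteq> proj_space i \<times> proj_space j"
  shows "homogeneous_coords (\<lambda>(t, P, Q). {t} \<times> P \<times> Q) (T \<times> X)"
proof -
  have *: "\<exists>c. c \<noteq> 0 \<and> w = (\<lambda>k. c * v k)" if "P \<in> proj_space n" "v \<in> P" "w \<in> P" for P n v w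
    using that proj_space_mem[OF that(1)] proj_class_eq_iff[of v n w] by metis
  have **: "\<exists>a b. a \<noteq> 0 \<and> b \<noteq> 0 \<and> z' = (\<lambda>k. a * z k) \<and> w' = (\<lambda>k. b * w k)"
    if "(P, Q) \<in> X" "z \<in> P" "z' \<in> P" "w \<in> Q" "w' \<in> Q" for P Q z z' w w'
    using that assms *[of P i z z'] *[of Q j w w'] by blast
  have ne: "P \<noteq> {}" "Q \<noteq> {}" if "(P, Q) \<in> X" for P Q
    using that assms proj_space_nonempty[of P i] proj_space_nonempty[of Q j] by blast+
  show "homogeneous_coords (\<lambda>(t, P, Q). {t} \<times> P \<times> Q) (T \<times> X)"
    unfolding homogeneous_coords_def
  proof (intro ballI conjI allI impI)
    fix x assume "x \<in> T \<times> X"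
    then obtain s P Q where x: "x = (s, P, Q)" "(P, Q) \<in> X" by auto
    show "(case x of (t, P, Q) \<Rightarrow> {t} \<times> P \<times> Q) \<noteq> {}" using ne x by auto
    fix t z w t' z' w'
    assume "(t, z, w) \<in> (case x of (t, P, Q) \<Rightarrow> {t} \<times> P \<times> Q)"
      "(t', z', w') \<in> (case x of (t, P, Q) \<Rightarrow> {t} \<times> P \<times> Q)"
    then have m: "t = s" "t' = s" "z \<in> P" "z' \<in> P" "w \<in> Q" "w' \<in> Q" using x by auto
    then show "t' = t" by simp
    show "\<exists>a b. a \<noteq> 0 \<and> b \<noteq> 0 \<and> z' = (\<lambda>k. a * z k) \<and> w' = (\<lambda>k. b * w k)"
      by (rule **[OF x(2) m(3-6)])
  qed
qed

lemma homogeneous_coords_biproj: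
  assumes "X \<subseteq> proj_space i \<times> proj_space j"
  shows "homogeneous_coords (\<lambda>(P, Q). {\<lambda>_. 0} \<times> P \<times> Q) X"
  unfolding homogeneous_coords_def
proof (rule ballI, goal_cases)
  case (1 x)
  then have "(\<lambda>_. 0, x) \<in> {\<lambda>_. 0} \<times> X" by simp
  from bspec[OF homogeneous_coords_torus_times[OF assms, unfolded homogeneous_coords_def] this]
  show ?case unfolding prod.case .
qed

lemma milnor_subset: "milnor_hypersurface i j \<subseteq> proj_space i \<times> proj_space j"
  by (auto simp: milnor_hypersurface_def)

lemma milnor_cone_scale:
  assumes "(z, w) \<in> milnor_cone i j" "a \<noteq> 0" "b \<noteq> 0"
  shows "(\<lambda>k. a * z k, \<lambda>k. b * w k) \<in> milnor_cone i j"
    "biproj_point i j (\<lambda>k. a * z k) (\<lambda>k. b * w k) = biproj_point i j z w"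
proof -
  have "(\<Sum>k\<le>min i j. (a * z k) * (b * w k)) = a * b * (\<Sum>k\<le>min i j. z k * w k)"
    by (simp add: sum_distrib_left algebra_simps)
  then show "(\<lambda>k. a * z k, \<lambda>k. b * w k) \<in> milnor_cone i j"
    using assms by (simp add: milnor_cone_def nonzero_vecs_scale)
  show "biproj_point i j (\<lambda>k. a * z k) (\<lambda>k. b * w k) = biproj_point i j z w"
    using milnor_coneD(1,2)[OF assms(1)] assms(2,3) by (simp add: biproj_point_def proj_class_scale)
qed

section \<open>Torus actions in coordinates\<close>

lemma continuous_on_bihom_poly:
  assumes "bihom_poly r i j d e F"
  shows "continuous_on UNIV F"
  using assms
proof induction
  case (var_t k)
  have "continuous_on UNIV (\<lambda>v :: Defs.vec \<times> Defs.vec \<times> Defs.vec. fst v k)"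
    by (rule continuous_on_product_then_coordinatewise[OF continuous_on_fst[OF continuous_on_id]])
  then show ?case by (simp only: case_prod_unfold)
next
  case (var_z k)
  have "continuous_on UNIV (\<lambda>v :: Defs.vec \<times> Defs.vec \<times> Defs.vec. fst (snd v) k)"
    by (rule continuous_on_product_then_coordinatewise[OF continuous_on_fst[OF continuous_on_snd[OF continuous_on_id]]])
  then show ?case by (simp only: case_prod_unfold)
next
  case (var_w k)
  have "continuous_on UNIV (\<lambda>v :: Defs.vec \<times> Defs.vec \<times> Defs.vec. snd (snd v) k)"
    by (rule continuous_on_product_then_coordinatewise[OF continuous_on_snd[OF continuous_on_snd[OF continuous_on_id]]])
  then show ?case by (simp only: case_prod_unfold)
qed (rule continuous_on_const continuous_on_add continuous_on_mult; assumption)+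

text \<open>
  Along a polynomial curve a polynomial becomes a polynomial in one variable. This gives
  holomorphy for Liouville's theorem, and the finiteness of zero sets for irreducibility.
\<close>

lemma bihom_poly_on_curve:
  assumes "bihom_poly r i j d e F"
  shows "\<exists>p. \<forall>s. F (t, \<lambda>k. poly (Z k) s, \<lambda>k. poly (W k) s) = poly p s"
  using assms
proof induction
  case (const c)
  show ?case by (rule exI[of _ "[:c:]"]) simp
next
  case (var_t k)
  show ?case by (rule exI[of _ "[:t k:]"]) simp
next
  case (add d e F G)
  then show ?case by (metis poly_add)
next
  case (mult d e F d' e' G)
  then show ?case by (metis poly_mult)
qed auto

lemma torus_simps [simp]:
  "carrier (torus r) = {t \<in> cspace r. \<forall>k<r. t k \<noteq> 0}"
  "s \<otimes>\<^bsub>torus r\<^esub> t = (\<lambda>k. s k * t k)"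
  "\<one>\<^bsub>torus r\<^esub> = (\<lambda>k. if k < r then 1 else 0)"
  by (simp_all add: torus_def)

lemma torus_eqI:
  "s \<in> cspace r \<Longrightarrow> t \<in> cspace r \<Longrightarrow> (\<And>k. k < r \<Longrightarrow> s k = t k) \<Longrightarrow> s = t"
  unfolding cspace_def by (rule ext) (metis (mono_tags, lifting) linorder_not_less mem_Collect_eq)

lemma torus_group: "group (torus r)"
proof (rule groupI)
  fix t assume t: "t \<in> carrier (torus r)"
  then show "\<exists>s\<in>carrier (torus r). s \<otimes>\<^bsub>torus r\<^esub> t = \<one>\<^bsub>torus r\<^esub>"
    by (intro bexI[of _ "\<lambda>k. inverse (t k)"]) (auto simp: cspace_def fun_eq_iff)
qed (auto simp: cspace_def fun_eq_iff mult.assoc)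

lemma group_actionI:
  fixes G (structure)
  assumes "group G"
    and ext: "\<And>g. g \<in> carrier G \<Longrightarrow> \<phi> g \<in> extensional E"
    and closed: "\<And>g x. g \<in> carrier G \<Longrightarrow> x \<in> E \<Longrightarrow> \<phi> g x \<in> E"
    and one: "\<And>x. x \<in> E \<Longrightarrow> \<phi> \<one>\<^bsub>G\<^esub> x = x"
    and mult: "\<And>g h x. g \<in> carrier G \<Longrightarrow> h \<in> carrier G \<Longrightarrow> x \<in> E \<Longrightarrow> \<phi> (g \<otimes>\<^bsub>G\<^esub> h) x = \<phi> g (\<phi> h x)"
  shows "group_action G E \<phi>"
proof -
  interpret group G by fact
  have bij: "\<phi> g \<in> Bij E" if g: "g \<in> carrier G" for g
  proof -
    have "bij_betw (\<phi> g) E E"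
    proof (rule bij_betw_byWitness[where f' = "\<phi> (inv g)"])
      show "\<forall>x\<in>E. \<phi> (inv g) (\<phi> g x) = x"
        using mult[of "inv g" g] one g by simp
      show "\<forall>x\<in>E. \<phi> g (\<phi> (inv g) x) = x"
        using mult[of g "inv g"] one g by simp
    qed (use closed g in auto)
    then show ?thesis using ext[OF g] by (simp add: Bij_def)
  qed
  have "\<phi> (g \<otimes> h) = compose E (\<phi> g) (\<phi> h)" if "g \<in> carrier G" "h \<in> carrier G" for g h
    using that ext[of "g \<otimes> h"] mult by (intro extensionalityI[of _ E]) (auto simp: compose_def)
  then have "\<phi> \<in> hom G (BijGroup E)"
    using bij by (auto simp: hom_def BijGroup_def)
  then show ?thesis
    unfolding group_action_def group_hom_def group_hom_axioms_def
    using group_BijGroup group_axioms by blast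
qed

locale milnor_torus_action =
  fixes r i j :: nat and \<phi> :: "Defs.vec \<Rightarrow> Defs.vec set \<times> Defs.vec set \<Rightarrow> Defs.vec set \<times> Defs.vec set"
  assumes action: "algebraic_torus_action r i j (milnor_hypersurface i j) \<phi>"
begin

abbreviation "T \<equiv> carrier (torus r)"
abbreviation "X \<equiv> milnor_hypersurface i j"
abbreviation "pt \<equiv> biproj_point i j"
abbreviation "e \<equiv> \<one>\<^bsub>torus r\<^esub>"

sublocale group_action "torus r" X \<phi>
  using action unfolding algebraic_torus_action_def by blast

lemma one_in_T: "e \<in> T"
  by (auto simp: cspace_def)

lemma act_in: "t \<in> T \<Longrightarrow> x \<in> X \<Longrightarrow> \<phi> t x \<in> X"
  using element_image by blast

lemma act_one: "x \<in> X \<Longrightarrow> \<phi> e x = x"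
  by (metis id_eq_one restrict_apply')

lemma act_mult: "s \<in> T \<Longrightarrow> t \<in> T \<Longrightarrow> x \<in> X \<Longrightarrow> \<phi> (\<lambda>k. s k * t k) x = \<phi> s (\<phi> t x)"
  using composition_rule[of x s t] by simp

lemma mult_in_T: "s \<in> T \<Longrightarrow> t \<in> T \<Longrightarrow> (\<lambda>k. s k * t k) \<in> T"
  by (auto simp: cspace_def)

text \<open>
  The morphism condition on the action, applied to the regular function \<open>w\<^sub>l / w\<^sub>k\<close> on the chart
  \<open>w\<^sub>k \<noteq> 0\<close>: near \<open>(t\<^sub>0, (z\<^sub>0, w\<^sub>0))\<close> the ratio of these two coordinates of the image point is a quotient
  of polynomials. In this form the action can be treated by analysis in coordinates.
\<close>

lemma local_ratio:
  assumes t0: "t0 \<in> T" and p0: "(z0, w0) \<in> milnor_cone i j"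
    and w1: "w1 \<in> snd (\<phi> t0 (pt z0 w0))" "w1 k \<noteq> 0" and kl: "k \<le> j" "l \<le> j"
  obtains d d' d'' e' H F G where
    "bihom_poly r i j d d' H" "bihom_poly r i j d'' e' F" "bihom_poly r i j d'' e' G"
    "H (t0, z0, w0) \<noteq> 0"
    "\<And>t z w. t \<in> T \<Longrightarrow> (z, w) \<in> milnor_cone i j \<Longrightarrow> H (t, z, w) \<noteq> 0 \<Longrightarrow> G (t, z, w) \<noteq> 0"
    "\<And>t z w w'. t \<in> T \<Longrightarrow> (z, w) \<in> milnor_cone i j \<Longrightarrow> H (t, z, w) \<noteq> 0 \<Longrightarrow>
      w' \<in> snd (\<phi> t (pt z w)) \<Longrightarrow> w' k \<noteq> 0 \<and> w' l / w' k = F (t, z, w) / G (t, z, w)"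
proof -
  let ?hc = "\<lambda>(P, Q). {\<lambda>_. 0} \<times> P \<times> Q :: (Defs.vec \<times> Defs.vec \<times> Defs.vec) set"
  let ?hcT = "\<lambda>(t, P, Q). {t} \<times> P \<times> Q :: (Defs.vec \<times> Defs.vec \<times> Defs.vec) set"
  define U where "U = {x \<in> X. \<forall>v\<in>?hc x. (case v of (t, z, w) \<Rightarrow> w k) \<noteq> 0}"
  define q where "q x = (let w = SOME w. w \<in> snd x in w l / w k)" for x :: "Defs.vec set \<times> Defs.vec set"
  have hom: "homogeneous_coords ?hc X" "homogeneous_coords ?hcT (T \<times> X)"
    by (rule homogeneous_coords_biproj[OF milnor_subset] homogeneous_coords_torus_times[OF milnor_subset])+
  have mor: "variety_morphism (torus_times_variety r i j X) (biproj_variety i j X) (\<lambda>(t, x). \<phi> t x)"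
    using action unfolding algebraic_torus_action_def by blast
  have U: "openin (zariski_topology 0 i j ?hc X) U"
    unfolding U_def by (rule openin_zariski_nonvanishing[OF bihom_poly.var_w[OF kl(1)]])
  have Q: "w' l / w' k = q x \<and> (x \<in> U \<longleftrightarrow> w' k \<noteq> 0)" if x: "x \<in> X" and w': "w' \<in> snd x" for x w'
  proof -
    obtain z where z: "z \<in> fst x"
      using x proj_space_nonempty[of "fst x" i] by (auto simp: milnor_hypersurface_def)
    have u: "(\<lambda>_. 0, z, w') \<in> ?hc x" using z w' by (cases x) simp
    have "(SOME w. w \<in> snd x) \<in> snd x" using w' by (metis someI_ex)
    then have v: "(\<lambda>_. 0, z, SOME w. w \<in> snd x) \<in> ?hc x" using z by (cases x) simp
    have "w' l / w' k = q x"
      using homogeneous_coords_quotient[OF hom(1) x v u bihom_poly.var_w[OF kl(2)] bihom_poly.var_w[OF kl(1)]]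
      by (simp add: q_def Let_def)
    moreover have "x \<in> U \<longleftrightarrow> w' k \<noteq> 0"
      using homogeneous_coords_nonzero_iff[OF hom(1) x u bihom_poly.var_w[OF kl(1)]] x
      by (simp add: U_def)
    ultimately show ?thesis by simp
  qed
  have "q \<in> regular_functions 0 i j ?hc X U"
    unfolding regular_functions_def
  proof (intro CollectI ballI exI conjI)
    fix x assume x: "x \<in> U"
    show "openin (zariski_topology 0 i j ?hc X) U" "x \<in> U" "U \<subseteq> U" using U x by auto
    show "bihom_poly 0 i j 0 1 (\<lambda>(t, z, w). w l)" "bihom_poly 0 i j 0 1 (\<lambda>(t, z, w). w k)"
      by (rule bihom_poly.var_w, rule kl)+
    fix y v assume y: "y \<in> U" "v \<in> ?hc y"
    then obtain z w where v: "v = (\<lambda>_. 0, z, w)" "w \<in> snd y" by (cases y) auto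
    have "y \<in> X" using y(1) by (simp add: U_def)
    then show "(case v of (t, z, w) \<Rightarrow> w k) \<noteq> 0"
      "q y = (case v of (t, z, w) \<Rightarrow> w l) / (case v of (t, z, w) \<Rightarrow> w k)"
      using Q[of y w] v y(1) by auto
  qed
  then have reg: "q \<circ> (\<lambda>(t, x). \<phi> t x) \<in> regular_functions r i j ?hcT (T \<times> X)
      {y \<in> T \<times> X. (\<lambda>(t, x). \<phi> t x) y \<in> U}"
    using mor U unfolding variety_morphism_def biproj_variety_def torus_times_variety_def embedded_variety_def
    by (simp del: torus_simps)
  have m0: "(t0, pt z0 w0) \<in> T \<times> X" using t0 milnor_coneD(4)[OF p0] by blast
  then have "\<phi> t0 (pt z0 w0) \<in> U" using Q[OF act_in w1(1)] w1(2) by simp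
  then have m: "(t0, pt z0 w0) \<in> {y \<in> T \<times> X. (\<lambda>(t, x). \<phi> t x) y \<in> U}"
    using m0 by simp
  obtain d e d' e' H F G where
    R: "bihom_poly r i j d e F" "bihom_poly r i j d e G" "bihom_poly r i j d' e' H"
    "\<And>v. v \<in> ?hcT (t0, pt z0 w0) \<Longrightarrow> H v \<noteq> 0"
    "\<And>y v. y \<in> T \<times> X \<Longrightarrow> v \<in> ?hcT y \<Longrightarrow> H v \<noteq> 0 \<Longrightarrow> y \<in> {y \<in> T \<times> X. (\<lambda>(t, x). \<phi> t x) y \<in> U} \<and>
       G v \<noteq> 0 \<and> (q \<circ> (\<lambda>(t, x). \<phi> t x)) y = F v / G v"
    by (rule regular_function_local_quotient[OF hom(2) reg m m0]) (rule that)
  have mem: "(t, z, w) \<in> ?hcT (t, pt z w)" if "(z, w) \<in> milnor_cone i j" for t z w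
    using milnor_coneD(5,6)[OF that] by (simp add: biproj_point_def)
  have *: "\<phi> t (pt z w) \<in> U" "G (t, z, w) \<noteq> 0" "q (\<phi> t (pt z w)) = F (t, z, w) / G (t, z, w)"
    if t: "t \<in> T" and zw: "(z, w) \<in> milnor_cone i j" and nz: "H (t, z, w) \<noteq> 0" for t z w
  proof -
    have x: "(t, pt z w) \<in> T \<times> X" using t milnor_coneD(4)[OF zw] by blast
    from R(5)[OF x mem[OF zw] nz] show "\<phi> t (pt z w) \<in> U" "G (t, z, w) \<noteq> 0"
      "q (\<phi> t (pt z w)) = F (t, z, w) / G (t, z, w)" by auto
  qed
  show thesis
  proof (rule that[OF R(3,1,2) R(4)[OF mem[OF p0]] *(2)])
    fix t z w w' assume a: "t \<in> T" "(z, w) \<in> milnor_cone i j" "H (t, z, w) \<noteq> 0" "w' \<in> snd (\<phi> t (pt z w))"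
    show "w' k \<noteq> 0 \<and> w' l / w' k = F (t, z, w) / G (t, z, w)"
      using Q[OF act_in[OF a(1) milnor_coneD(4)[OF a(2)]] a(4)] *[OF a(1-3)] by simp
  qed
qed

end

section \<open>Torus actions preserve the fibres of a projection\<close>

lemma continuous_coord: "continuous_on A (\<lambda>v :: Defs.vec. v k)"
  by (rule continuous_on_product_then_coordinatewise[OF continuous_on_id])

lemma compact_box: "compact {v :: Defs.vec. \<forall>l. v l \<in> (if l \<le> n then cball 0 1 else {0})}"
proof -
  have "{v :: Defs.vec. \<forall>l. v l \<in> (if l \<le> n then cball 0 1 else {0})}
      = (\<Pi>\<^sub>E l\<in>UNIV. if l \<le> n then cball 0 1 else {0})"
    by (auto simp: PiE_def Pi_def)
  moreover have "compactin (product_topology (\<lambda>_. euclidean) UNIV)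
      (\<Pi>\<^sub>E l\<in>(UNIV :: nat set). if l \<le> n then cball (0 :: complex) 1 else {0})"
    unfolding compactin_PiE by simp
  ultimately show ?thesis
    unfolding euclidean_product_topology by simp
qed

text \<open>
  Every point of the hypersurface with \<open>w\<^sub>k\<close> of maximal modulus has a representative in this compact
  set. Replacing the sphere by the maximum norm avoids square roots.
\<close>

definition normalized_cone :: "nat \<Rightarrow> nat \<Rightarrow> nat \<Rightarrow> (Defs.vec \<times> Defs.vec) set" where
  "normalized_cone i j k = {(z, w) \<in> milnor_cone i j.
     (\<forall>l. cmod (z l) \<le> 1) \<and> (\<exists>a\<le>i. cmod (z a) = 1) \<and> (\<forall>l. cmod (w l) \<le> 1) \<and> w k = 1}"

lemma compact_normalized_cone:
  assumes "k \<le> j"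
  shows "compact (normalized_cone i j k)"
proof -
  let ?B = "\<lambda>n. {v :: Defs.vec. \<forall>l. v l \<in> (if l \<le> n then cball 0 1 else {0})}"
  let ?C = "(\<Union>a\<in>{..i}. {p. cmod (fst p a) = 1}) \<inter> {p. snd p k = 1} \<inter>
    {p :: Defs.vec \<times> Defs.vec. (\<Sum>k\<le>min i j. fst p k * snd p k) = 0}"
  have c: "continuous_on UNIV (\<lambda>p :: Defs.vec \<times> Defs.vec. fst p l)"
       "continuous_on UNIV (\<lambda>p :: Defs.vec \<times> Defs.vec. snd p l)" for l
    by (rule continuous_on_product_then_coordinatewise[OF continuous_on_fst[OF continuous_on_id]]
        continuous_on_product_then_coordinatewise[OF continuous_on_snd[OF continuous_on_id]])+
  have "closed {p :: Defs.vec \<times> Defs.vec. cmod (fst p a) = 1}" for a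
    by (intro closed_Collect_eq continuous_on_norm c continuous_on_const)
  then have "closed ?C"
    by (intro closed_Int closed_UN closed_Collect_eq c continuous_on_const
        continuous_on_sum continuous_on_mult) auto
  then have "compact ((?B i \<times> ?B j) \<inter> ?C)"
    by (intro compact_Int_closed compact_Times compact_box)
  also have "(?B i \<times> ?B j) \<inter> ?C = normalized_cone i j k"
  proof (intro equalityI subsetI)
    fix p assume "p \<in> (?B i \<times> ?B j) \<inter> ?C"
    then obtain a where p: "fst p \<in> ?B i" "snd p \<in> ?B j" "a \<le> i" "cmod (fst p a) = 1" "snd p k = 1"
      "(\<Sum>k\<le>min i j. fst p k * snd p k) = 0" by auto
    have b: "cmod (v l) \<le> 1" "n < l \<Longrightarrow> v l = 0" if "v \<in> ?B n" for v n l
      using that by (auto dest!: spec[of _ l] split: if_splits)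
    have "fst p a \<noteq> 0" "snd p k \<noteq> 0" using p by auto
    then have "fst p \<noteq> (\<lambda>_. 0)" "snd p \<noteq> (\<lambda>_. 0)" by auto
    moreover have "fst p \<in> cspace (Suc i)" "snd p \<in> cspace (Suc j)"
      using b(2)[OF p(1)] b(2)[OF p(2)] by (auto simp: cspace_def Suc_le_eq)
    ultimately show "p \<in> normalized_cone i j k"
      using p b(1)[OF p(1)] b(1)[OF p(2)]
      by (auto simp: normalized_cone_def milnor_cone_def nonzero_vecs_def case_prod_unfold)
  next
    fix p assume "p \<in> normalized_cone i j k"
    then show "p \<in> (?B i \<times> ?B j) \<inter> ?C"
      by (auto simp: normalized_cone_def milnor_cone_def nonzero_vecs_def cspace_def)
  qed
  finally show ?thesis .
qed

lemma nonzero_vecs_max: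
  assumes "v \<in> nonzero_vecs n"
  obtains k where "k \<le> n" "v k \<noteq> 0" "\<And>l. cmod (v l) \<le> cmod (v k)"
proof -
  let ?M = "(\<lambda>l. cmod (v l)) ` {..n}"
  have "Max ?M \<in> ?M" by (rule Max_in) auto
  then obtain k where "Max ?M = cmod (v k)" "k \<in> {..n}" by (rule imageE)
  then have k: "k \<le> n" "cmod (v k) = Max ?M" by simp_all
  have *: "cmod (v l) \<le> cmod (v k)" for l
  proof (cases "l \<le> n")
    case True
    then show ?thesis unfolding k(2) by (intro Max_ge) auto
  next
    case False
    then have "v l = 0" using assms by (auto simp: nonzero_vecs_def cspace_def)
    then show ?thesis by simp
  qed
  moreover have "v k \<noteq> 0"
    using nonzero_vecs_coord[OF assms] * by fastforce
  ultimately show thesis using that k by blast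
qed

lemma normalize_cone:
  assumes p: "(z, w) \<in> milnor_cone i j" and k: "w k \<noteq> 0" "\<And>l. cmod (w l) \<le> cmod (w k)"
  obtains a b where "a \<noteq> 0" "b \<noteq> 0" "(\<lambda>l. a * z l, \<lambda>l. b * w l) \<in> normalized_cone i j k"
proof -
  obtain m where m: "m \<le> i" "z m \<noteq> 0" "\<And>l. cmod (z l) \<le> cmod (z m)"
    using nonzero_vecs_max[OF milnor_coneD(1)[OF p]] by metis
  have "(\<lambda>l. 1 / z m * z l, \<lambda>l. 1 / w k * w l) \<in> normalized_cone i j k"
    using milnor_cone_scale(1)[OF p, of "1 / z m" "1 / w k"] m k
    by (auto simp: normalized_cone_def norm_divide divide_le_eq)
  then show thesis using that[of "1 / z m" "1 / w k"] m k by simp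
qed

lemma nonzero_line:
  assumes z: "z \<in> nonzero_vecs n" and z': "z' \<in> nonzero_vecs n"
    and ne: "proj_class n z \<noteq> proj_class n z'"
  shows "(\<lambda>k. z k + s * (z' k - z k)) \<in> nonzero_vecs n"
proof -
  have "(\<lambda>k. z k + s * (z' k - z k)) \<noteq> (\<lambda>_. 0)"
  proof
    assume eq: "(\<lambda>k. z k + s * (z' k - z k)) = (\<lambda>_. 0)"
    have k: "z k * (1 - s) = - s * z' k" for k
      using fun_cong[OF eq, of k] by (simp add: algebra_simps)
    have "s \<noteq> 0" using k nonzero_vecs_coord[OF z] by force
    have "s \<noteq> 1" using k nonzero_vecs_coord[OF z'] by force
    then have "z' = (\<lambda>k. ((s - 1) / s) * z k)"
      using \<open>s \<noteq> 0\<close> k by (auto simp: fun_eq_iff field_simps)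
    then show False
      using ne proj_class_scale[OF z, of "(s - 1) / s"] \<open>s \<noteq> 0\<close> \<open>s \<noteq> 1\<close> by simp
  qed
  then show ?thesis using z z' by (simp add: nonzero_vecs_def cspace_def)
qed

context milnor_torus_action
begin

lemma act_class:
  assumes "(z, w) \<in> milnor_cone i j" "t \<in> T"
  obtains z' w' where "(z', w') \<in> milnor_cone i j" "\<phi> t (pt z w) = pt z' w'"
  using milnor_hypersurface_cases[OF act_in[OF assms(2) milnor_coneD(4)[OF assms(1)]]] .

text \<open>
  The triples for which the image still lies in the chart \<open>w\<^sub>k \<noteq> 0\<close>, with the coordinate \<open>w\<^sub>l / w\<^sub>k\<close>
  bounded by 2. For \<open>t = 1\<close> and \<open>w\<^sub>k\<close> of maximal modulus the bound 1 holds, so there is room to move \<open>t\<close>.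
\<close>

definition pivot_bound :: "nat \<Rightarrow> nat \<Rightarrow> (Defs.vec \<times> Defs.vec \<times> Defs.vec) set" where
  "pivot_bound k l = {v. fst v \<in> T \<longrightarrow> snd v \<in> milnor_cone i j \<longrightarrow>
     (\<forall>w'\<in>snd (\<phi> (fst v) (pt (fst (snd v)) (snd (snd v)))). w' k \<noteq> 0 \<and> cmod (w' l) \<le> 2 * cmod (w' k))}"

text \<open>
  By \<open>local_ratio\<close> the coordinate is a quotient of continuous functions near \<open>(1, (z\<^sub>0, w\<^sub>0))\<close>, and its
  value at this point has modulus at most 1.
\<close>

lemma near_one_point:
  assumes p: "(z0, w0) \<in> normalized_cone i j k" and k: "k \<le> j" and l: "l \<le> j"
  shows "(e, z0, w0) \<in> interior (pivot_bound k l)"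
proof -
  have c: "(z0, w0) \<in> milnor_cone i j" "w0 k = 1" "\<And>l. cmod (w0 l) \<le> 1"
    using p by (auto simp: normalized_cone_def)
  have e: "\<phi> e (pt z0 w0) = pt z0 w0" by (rule act_one[OF milnor_coneD(4)[OF c(1)]])
  have w0: "w0 \<in> snd (\<phi> e (pt z0 w0))" "w0 k \<noteq> 0"
    unfolding e using milnor_coneD(6)[OF c(1)] c(2) by (auto simp: biproj_point_def)
  obtain d d' d'' f H F G where
    b: "bihom_poly r i j d d' H" "bihom_poly r i j d'' f F" "bihom_poly r i j d'' f G"
    and h: "H (e, z0, w0) \<noteq> 0"
    and G: "\<And>t z w. t \<in> T \<Longrightarrow> (z, w) \<in> milnor_cone i j \<Longrightarrow> H (t, z, w) \<noteq> 0 \<Longrightarrow> G (t, z, w) \<noteq> 0"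
    and q: "\<And>t z w w'. t \<in> T \<Longrightarrow> (z, w) \<in> milnor_cone i j \<Longrightarrow> H (t, z, w) \<noteq> 0 \<Longrightarrow>
      w' \<in> snd (\<phi> t (pt z w)) \<Longrightarrow> w' k \<noteq> 0 \<and> w' l / w' k = F (t, z, w) / G (t, z, w)"
    by (rule local_ratio[OF one_in_T c(1) w0 k l]) (rule that)
  let ?W = "{v. H v \<noteq> 0} \<inter> {v. cmod (F v) < 2 * cmod (G v)}"
  show ?thesis
  proof (rule interiorI[of ?W])
    show "open ?W"
      by (intro open_Int open_Collect_neq open_Collect_less continuous_on_bihom_poly[OF b(1)]
        continuous_on_norm continuous_on_bihom_poly[OF b(2)] continuous_on_bihom_poly[OF b(3)]
        continuous_on_const continuous_on_mult)
    have g: "G (e, z0, w0) \<noteq> 0" "w0 l = F (e, z0, w0) / G (e, z0, w0)"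
      using G[OF one_in_T c(1) h] q[OF one_in_T c(1) h w0(1)] c(2) by simp_all
    then have "cmod (F (e, z0, w0)) \<le> cmod (G (e, z0, w0))"
      using c(3)[of l] by (simp add: norm_divide divide_le_eq)
    also have "\<dots> < 2 * cmod (G (e, z0, w0))" using g by simp
    finally show "(e, z0, w0) \<in> ?W" using h by simp
    show "?W \<subseteq> pivot_bound k l"
    proof
      fix v assume v: "v \<in> ?W"
      obtain t z w where tzw: "v = (t, z, w)" by (metis prod_cases3)
      have "w' k \<noteq> 0 \<and> cmod (w' l) \<le> 2 * cmod (w' k)"
        if "t \<in> T" "(z, w) \<in> milnor_cone i j" and w': "w' \<in> snd (\<phi> t (pt z w))" for w'
      proof -
        have *: "G (t, z, w) \<noteq> 0" "w' k \<noteq> 0" "w' l / w' k = F (t, z, w) / G (t, z, w)"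
          using G[OF that(1,2)] q[OF that(1,2) _ w'] v unfolding tzw by simp_all
        have "cmod (F (t, z, w) / G (t, z, w)) < 2"
          using v *(1) unfolding tzw by (simp add: norm_divide divide_less_eq)
        then have "cmod (w' l) / cmod (w' k) < 2" using *(3) by (metis norm_divide)
        then show ?thesis using *(2) by (simp add: divide_less_eq)
      qed
      then show "v \<in> pivot_bound k l"
        unfolding pivot_bound_def tzw by (simp del: torus_simps)
    qed
  qed
qed

definition pivot_bounded :: "Defs.vec \<Rightarrow> bool" where
  "pivot_bounded t \<longleftrightarrow> (\<forall>z w k w' l. (z, w) \<in> milnor_cone i j \<longrightarrow> k \<le> j \<longrightarrow> w k \<noteq> 0 \<longrightarrow>
     (\<forall>l. cmod (w l) \<le> cmod (w k)) \<longrightarrow> w' \<in> snd (\<phi> t (pt z w)) \<longrightarrow> l \<le> j \<longrightarrow>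
     w' k \<noteq> 0 \<and> cmod (w' l) \<le> 2 * cmod (w' k))"

text \<open>
  The neighbourhood of 1 can be chosen uniformly for all points, by the tube lemma on the compact
  sets \<open>normalized_cone i j k\<close>.
\<close>

lemma near_one:
  obtains N where "open N" "e \<in> N"
    "\<And>t. t \<in> N \<Longrightarrow> t \<in> T \<Longrightarrow> pivot_bounded t"
proof -
  define W where "W k = (\<Inter>l\<in>{..j}. interior (pivot_bound k l))" for k
  have "\<exists>N. e \<in> N \<and> open N \<and> N \<times> normalized_cone i j k \<subseteq> W k" if k: "k \<le> j" for k
  proof (rule Elementary_Topology.tube_lemma[OF compact_normalized_cone[OF k]])
    show "open (W k)" unfolding W_def by (intro open_INT) auto
    show "{e} \<times> normalized_cone i j k \<subseteq> W k"
      unfolding W_def using near_one_point[OF _ k] by (auto simp del: torus_simps)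
  qed
  then obtain N where N: "\<And>k. k \<le> j \<Longrightarrow> e \<in> N k \<and> open (N k) \<and> N k \<times> normalized_cone i j k \<subseteq> W k"
    by metis
  show thesis
  proof (rule that[of "\<Inter>k\<in>{..j}. N k"])
    show "open (\<Inter>k\<in>{..j}. N k)" using N by (intro open_INT) auto
    show "e \<in> (\<Inter>k\<in>{..j}. N k)" using N by blast
    fix t assume t: "t \<in> (\<Inter>k\<in>{..j}. N k)" "t \<in> T"
    show "pivot_bounded t" unfolding pivot_bounded_def
    proof (intro allI impI)
      fix z w k w' l
      assume p: "(z, w) \<in> milnor_cone i j" and k: "k \<le> j" "w k \<noteq> 0" "\<forall>l. cmod (w l) \<le> cmod (w k)"
        and w': "w' \<in> snd (\<phi> t (pt z w))" and l: "l \<le> j"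
      obtain a b where ab: "a \<noteq> 0" "b \<noteq> 0" "(\<lambda>l. a * z l, \<lambda>l. b * w l) \<in> normalized_cone i j k"
        by (rule normalize_cone[OF p k(2) spec[OF k(3)]])
      have "t \<in> N k" using t k by simp
      then have "(t, \<lambda>l. a * z l, \<lambda>l. b * w l) \<in> W k" using N[OF k(1)] ab(3) by blast
      then have "(t, \<lambda>l. a * z l, \<lambda>l. b * w l) \<in> pivot_bound k l"
        using l interior_subset unfolding W_def by blast
      then show "w' k \<noteq> 0 \<and> cmod (w' l) \<le> 2 * cmod (w' k)"
        using t(2) milnor_cone_scale[OF p ab(1,2)] w' unfolding pivot_bound_def
        by (simp del: torus_simps)
    qed
  qed
qed

text \<open>
  The fibres are those of the projection to the second factor \<open>\<P>\<^sup>j\<close>.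
\<close>

definition fibre_preserving :: "Defs.vec \<Rightarrow> bool" where
  "fibre_preserving t \<longleftrightarrow> (\<forall>x\<in>X. \<forall>y\<in>X. snd x = snd y \<longrightarrow> snd (\<phi> t x) = snd (\<phi> t y))"

lemma fibre_preserving_mult:
  assumes "s \<in> T" "t \<in> T" "fibre_preserving s" "fibre_preserving t"
  shows "fibre_preserving (\<lambda>k. s k * t k)"
  unfolding fibre_preserving_def
proof (intro ballI impI)
  fix x y assume xy: "x \<in> X" "y \<in> X" "snd x = snd y"
  then have "snd (\<phi> t x) = snd (\<phi> t y)" using assms(4) unfolding fibre_preserving_def by blast
  then have "snd (\<phi> s (\<phi> t x)) = snd (\<phi> s (\<phi> t y))"
    using assms(3) act_in[OF assms(2)] xy unfolding fibre_preserving_def by blast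
  then show "snd (\<phi> (\<lambda>k. s k * t k) x) = snd (\<phi> (\<lambda>k. s k * t k) y)"
    using act_mult[OF assms(1,2)] xy by simp
qed

text \<open>
  Along the line from \<open>(z, w)\<close> to \<open>(z', w)\<close> each affine coordinate of the second component of the
  image is an entire function bounded by 2, hence constant by Liouville's theorem.
\<close>

lemma fibre_preserving_line:
  assumes t: "t \<in> T"
    and bound: "pivot_bounded t"
    and z: "(z, w) \<in> milnor_cone i j" and z': "(z', w) \<in> milnor_cone i j"
    and ne: "proj_class i z \<noteq> proj_class i z'"
  shows "snd (\<phi> t (pt z w)) = snd (\<phi> t (pt z' w))"
proof -
  define \<zeta> where "\<zeta> s k = z k + s * (z' k - z k)" for s k
  have cone: "(\<zeta> s, w) \<in> milnor_cone i j" for s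
  proof -
    have "(\<Sum>k\<le>min i j. \<zeta> s k * w k)
        = (1 - s) * (\<Sum>k\<le>min i j. z k * w k) + s * (\<Sum>k\<le>min i j. z' k * w k)"
      by (simp add: \<zeta>_def sum_distrib_left sum.distrib[symmetric] algebra_simps)
    also have "\<dots> = 0" using milnor_coneD(3)[OF z] milnor_coneD(3)[OF z'] by simp
    finally show ?thesis
      using nonzero_line[OF milnor_coneD(1)[OF z] milnor_coneD(1)[OF z'] ne, of s] milnor_coneD(2)[OF z]
      unfolding milnor_cone_def \<zeta>_def by simp
  qed
  obtain k where k: "k \<le> j" "w k \<noteq> 0" "\<And>l. cmod (w l) \<le> cmod (w k)"
    using nonzero_vecs_max[OF milnor_coneD(2)[OF z]] by metis
  have "\<exists>w'. w' \<in> snd (\<phi> t (pt (\<zeta> s) w)) \<and> w' \<in> nonzero_vecs j \<and> snd (\<phi> t (pt (\<zeta> s) w)) = proj_class j w'" for s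
    using act_class[OF cone t] milnor_coneD(2,6) by (metis biproj_point_def snd_conv)
  then obtain \<omega> where \<omega>: "\<And>s. \<omega> s \<in> snd (\<phi> t (pt (\<zeta> s) w))" "\<And>s. \<omega> s \<in> nonzero_vecs j"
    "\<And>s. snd (\<phi> t (pt (\<zeta> s) w)) = proj_class j (\<omega> s)"
    by metis
  have piv: "\<omega> s k \<noteq> 0 \<and> cmod (\<omega> s l) \<le> 2 * cmod (\<omega> s k)" if "l \<le> j" for s l
    using bound cone k \<omega>(1) that unfolding pivot_bounded_def by blast
  have ratio: "\<omega> 0 l / \<omega> 0 k = \<omega> 1 l / \<omega> 1 k" if l: "l \<le> j" for l
  proof -
    define h where "h s = \<omega> s l / \<omega> s k" for s
    have "h field_differentiable (at s0)" for s0
    proof -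
      obtain d d' d'' f H F G where
        b: "bihom_poly r i j d d' H" "bihom_poly r i j d'' f F" "bihom_poly r i j d'' f G"
        and nz: "H (t, \<zeta> s0, w) \<noteq> 0"
        and G: "\<And>t z w. t \<in> T \<Longrightarrow> (z, w) \<in> milnor_cone i j \<Longrightarrow> H (t, z, w) \<noteq> 0 \<Longrightarrow> G (t, z, w) \<noteq> 0"
        and q: "\<And>t z w w'. t \<in> T \<Longrightarrow> (z, w) \<in> milnor_cone i j \<Longrightarrow> H (t, z, w) \<noteq> 0 \<Longrightarrow>
          w' \<in> snd (\<phi> t (pt z w)) \<Longrightarrow> w' k \<noteq> 0 \<and> w' l / w' k = F (t, z, w) / G (t, z, w)"
        by (rule local_ratio[OF t cone \<omega>(1) conjunct1[OF piv[OF k(1)]] k(1) l]) (rule that)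
      have curve: "\<exists>p. \<forall>s. E (t, \<zeta> s, w) = poly p s" if "bihom_poly r i j a c E" for a c E
        using bihom_poly_on_curve[OF that, of t "\<lambda>k. [:z k, z' k - z k:]" "\<lambda>k. [:w k:]"]
        by (simp add: \<zeta>_def[abs_def])
      obtain p1 p2 p3 where p: "\<And>s. H (t, \<zeta> s, w) = poly p1 s" "\<And>s. F (t, \<zeta> s, w) = poly p2 s"
        "\<And>s. G (t, \<zeta> s, w) = poly p3 s"
        using curve[OF b(1)] curve[OF b(2)] curve[OF b(3)] by blast
      have hq: "poly p3 s \<noteq> 0 \<and> poly p2 s / poly p3 s = h s" if "poly p1 s \<noteq> 0" for s
        using G[OF t cone[of s]] q[OF t cone[of s] _ \<omega>(1)[of s]] that by (simp add: p h_def)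
      have s0: "poly p1 s0 \<noteq> 0" using nz p by simp
      have "(\<lambda>s. poly p2 s / poly p3 s) field_differentiable (at s0)"
        using hq[OF s0] by (intro field_differentiable_divide) (auto intro: poly_DERIV simp: field_differentiable_def)
      then obtain D where "((\<lambda>s. poly p2 s / poly p3 s) has_field_derivative D) (at s0)"
        unfolding field_differentiable_def by blast
      moreover have "open {s. poly p1 s \<noteq> 0}"
        by (intro open_Collect_neq continuous_intros)
      ultimately have "(h has_field_derivative D) (at s0)"
        by (rule has_field_derivative_transform_within_open) (use s0 hq in auto)
      then show ?thesis unfolding field_differentiable_def by blast
    qed
    then have "h holomorphic_on UNIV"
      by (simp add: holomorphic_on_def field_differentiable_at_within)
    moreover have "bounded (range h)"
    proof (rule boundedI)
      fix y assume "y \<in> range h"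
      then obtain s where "y = h s" by blast
      then show "cmod y \<le> 2"
        using piv[OF l, of s] by (simp add: h_def norm_divide divide_le_eq)
    qed
    ultimately have "h constant_on UNIV" by (rule Liouville_theorem)
    then show ?thesis unfolding constant_on_def h_def by (metis UNIV_I)
  qed
  have "proj_class j (\<omega> 0) = proj_class j (\<omega> 1)"
  proof (rule proj_class_eqI[OF \<omega>(2) \<omega>(2)])
    show "\<omega> 1 k \<noteq> 0" using piv k by blast
    fix l show "\<omega> 0 l * \<omega> 1 k = \<omega> 1 l * \<omega> 0 k"
    proof (cases "l \<le> j")
      case True
      then show ?thesis using ratio[OF True] piv[OF k(1)] by (simp add: field_simps)
    next
      case False
      then have "\<omega> s l = 0" for s using \<omega>(2)[of s] by (simp add: nonzero_vecs_def cspace_def)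
      then show ?thesis by simp
    qed
  qed
  moreover have "\<zeta> 0 = z" "\<zeta> 1 = z'" by (auto simp: \<zeta>_def)
  ultimately show ?thesis using \<omega>(3)[of 0] \<omega>(3)[of 1] by simp
qed

lemma fibre_preserving_near_one:
  obtains N where "open N" "e \<in> N" "\<And>t. t \<in> N \<Longrightarrow> t \<in> T \<Longrightarrow> fibre_preserving t"
proof -
  obtain N where N: "open N" "e \<in> N"
    "\<And>t. t \<in> N \<Longrightarrow> t \<in> T \<Longrightarrow> pivot_bounded t"
    by (rule near_one) (rule that)
  have "fibre_preserving t" if t: "t \<in> N" "t \<in> T" for t
    unfolding fibre_preserving_def
  proof (intro ballI impI)
    fix x y assume xy: "x \<in> X" "y \<in> X" "snd x = snd y"
    obtain z w where x: "(z, w) \<in> milnor_cone i j" "x = pt z w" by (rule milnor_hypersurface_cases[OF xy(1)])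
    obtain z' w' where y: "(z', w') \<in> milnor_cone i j" "y = pt z' w'" by (rule milnor_hypersurface_cases[OF xy(2)])
    have y': "y = pt z' w" using xy(3) x y by (simp add: biproj_point_def)
    then have c: "(z', w) \<in> milnor_cone i j"
      using biproj_point_mem_iff[OF milnor_coneD(1)[OF y(1)] milnor_coneD(2)[OF x(1)]] xy(2) by simp
    show "snd (\<phi> t x) = snd (\<phi> t y)"
    proof (cases "proj_class i z = proj_class i z'")
      case True
      then show ?thesis using x(2) y' by (simp add: biproj_point_def)
    next
      case False
      show ?thesis unfolding x(2) y'
        by (rule fibre_preserving_line[OF t(2) N(3)[OF t] x(1) c False])
    qed
  qed
  then show thesis using that N by blast
qed

text \<open>
  An element \<open>t\<close> is the \<open>n\<close>-th power of \<open>exp (Ln t / n)\<close>, which is close to 1 for large \<open>n\<close>, and the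
  fibre preserving elements are closed under multiplication.
\<close>

lemma action_preserves_fibres:
  assumes t: "t \<in> T"
  shows "fibre_preserving t"
proof -
  obtain N where N: "open N" "e \<in> N" "\<And>t. t \<in> N \<Longrightarrow> t \<in> T \<Longrightarrow> fibre_preserving t"
    by (rule fibre_preserving_near_one) (rule that)
  define \<gamma> where "\<gamma> s k = (if k < r then exp (s * Ln (t k)) else 0)" for s k
  have "continuous_on UNIV (\<lambda>s. \<gamma> s k)" for k
    unfolding \<gamma>_def by (cases "k < r") (auto intro!: continuous_intros)
  then have "continuous_on UNIV \<gamma>" by (rule continuous_on_coordinatewise_then_product)
  then have "open (\<gamma> -` N)" using N(1) by (simp add: open_vimage)
  moreover have \<gamma>0: "\<gamma> 0 = e" by (auto simp: \<gamma>_def)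
  then have "0 \<in> \<gamma> -` N" using N(2) by simp
  ultimately obtain \<epsilon> where \<epsilon>: "\<epsilon> > 0" "ball 0 \<epsilon> \<subseteq> \<gamma> -` N" using open_contains_ball by blast
  obtain n where n: "n > 0" "inverse (of_nat n) < \<epsilon>"
    using ex_inverse_of_nat_less[OF \<epsilon>(1)] by blast
  let ?u = "\<gamma> (1 / of_nat n)"
  have u: "?u \<in> N" "?u \<in> T"
  proof -
    have "1 / of_nat n \<in> ball (0 :: complex) \<epsilon>"
      using n by (simp add: norm_divide inverse_eq_divide)
    then show "?u \<in> N" using \<epsilon>(2) by blast
    show "?u \<in> T" by (auto simp: \<gamma>_def cspace_def)
  qed
  have T: "\<gamma> (of_nat m / of_nat n) \<in> T" for m :: nat by (auto simp: \<gamma>_def cspace_def)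
  have "fibre_preserving (\<gamma> (of_nat m / of_nat n))" for m :: nat
  proof (induction m)
    case 0
    show ?case using N(3)[OF N(2) one_in_T] \<gamma>0 by simp
  next
    case (Suc m)
    have "\<gamma> (of_nat (Suc m) / of_nat n) = (\<lambda>k. ?u k * \<gamma> (of_nat m / of_nat n) k)"
      by (auto simp: \<gamma>_def fun_eq_iff add_divide_distrib algebra_simps exp_add[symmetric])
    then show ?case using fibre_preserving_mult[OF u(2) T N(3)[OF u] Suc] by simp
  qed
  from this[of n] have "fibre_preserving (\<gamma> 1)" using n by simp
  moreover have "\<gamma> 1 = t"
    using t by (intro torus_eqI[of _ r]) (auto simp: \<gamma>_def cspace_def)
  ultimately show ?thesis by simp
qed

end

section \<open>Characters and finite subgroups of a torus\<close>

text \<open>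
  Dedekind's theorem, by the usual descent: if \<open>f t \<noteq> g t\<close>, subtracting \<open>g t\<close> times the relation from
  the relation translated by \<open>t\<close> removes the term of \<open>g\<close> and multiplies the coefficient of \<open>f\<close> by a
  nonzero number.
\<close>

lemma independent_characters:
  fixes \<chi> :: "'b \<Rightarrow> complex"
  assumes "finite A"
    and "\<And>f. f \<in> A \<Longrightarrow> (\<exists>s\<in>S. f s \<noteq> 0)"
    and "\<And>f s t. f \<in> A \<Longrightarrow> s \<in> S \<Longrightarrow> t \<in> S \<Longrightarrow> f (m s t) = f s * f t"
    and "\<And>s t. s \<in> S \<Longrightarrow> t \<in> S \<Longrightarrow> m s t \<in> S"
    and "\<And>f g. f \<in> A \<Longrightarrow> g \<in> A \<Longrightarrow> (\<And>s. s \<in> S \<Longrightarrow> f s = g s) \<Longrightarrow> f = g"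
    and "\<And>s. s \<in> S \<Longrightarrow> (\<Sum>f\<in>A. c f * f s) = 0" and "f \<in> A"
  shows "c f = (0 :: complex)"
  using assms(1-3,5-)
proof (induction A arbitrary: c f rule: finite_induct)
  case (insert g A)
  have c0: "c f = 0" if "f \<in> A" for f
  proof -
    have "f \<noteq> g" using that insert.hyps by blast
    then have "\<not> (\<forall>s\<in>S. f s = g s)" using insert.prems(3)[of f g] that by auto
    then obtain t where t: "t \<in> S" "f t \<noteq> g t" by blast
    have "(\<Sum>h\<in>A. (c h * (h t - g t)) * h s) = 0" if s: "s \<in> S" for s
    proof -
      have "(\<Sum>h\<in>insert g A. c h * h (m t s)) - g t * (\<Sum>h\<in>insert g A. c h * h s) = 0"
        using insert.prems(4) s t assms(4) by simp
      moreover have "(\<Sum>h\<in>insert g A. c h * h (m t s)) = (\<Sum>h\<in>insert g A. c h * (h t * h s))"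
        using insert.prems(2) s t by (intro sum.cong) auto
      ultimately have "(\<Sum>h\<in>insert g A. c h * (h t * h s) - g t * (c h * h s)) = 0"
        by (simp only: sum_subtractf sum_distrib_left)
      then show ?thesis using insert.hyps by (simp add: algebra_simps)
    qed
    then have "c f * (f t - g t) = 0"
      using insert.prems that by (intro insert.IH[of "\<lambda>h. c h * (h t - g t)"]) auto
    then show ?thesis using t by simp
  qed
  moreover have "c g = 0"
  proof -
    obtain s where s: "s \<in> S" "g s \<noteq> 0" using insert.prems(1) by blast
    have "(\<Sum>h\<in>insert g A. c h * h s) = c g * g s"
      using c0 insert.hyps by simp
    then show ?thesis using insert.prems(4)[OF s(1)] s(2) by simp
  qed
  ultimately show ?case using insert.prems(5) by blast
qed simp

definition torus_char :: "nat \<Rightarrow> (nat \<Rightarrow> int) \<Rightarrow> Defs.vec \<Rightarrow> complex" where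
  "torus_char r m t = (\<Prod>k<r. t k powi m k)"

lemma torus_char_mult: "torus_char r m (\<lambda>k. s k * t k) = torus_char r m s * torus_char r m t"
  by (simp add: torus_char_def power_int_mult_distrib prod.distrib)

lemma torus_char_nonzero: "(\<And>k. k < r \<Longrightarrow> t k \<noteq> 0) \<Longrightarrow> torus_char r m t \<noteq> 0"
  by (simp add: torus_char_def)

lemma torus_char_add:
  "(\<And>k. k < r \<Longrightarrow> t k \<noteq> 0) \<Longrightarrow> torus_char r (\<lambda>k. m k + n k) t = torus_char r m t * torus_char r n t"
  by (simp add: torus_char_def power_int_add prod.distrib)

lemma torus_char_cmult:
  "torus_char r (\<lambda>k. c * m k) t = torus_char r m t powi c"
  unfolding torus_char_def mult.commute[of c] power_int_mult
  by (induction r) (simp_all add: power_int_mult_distrib)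

text \<open>
  For fixed \<open>z\<close> and \<open>w\<close> a polynomial in \<open>t\<close> is a linear combination of monomials, that is, of
  characters of the torus.
\<close>

lemma bihom_poly_expansion:
  assumes "bihom_poly r i j d e F"
  shows "\<exists>(M :: (complex \<times> (nat \<Rightarrow> int)) list). \<forall>t. (\<forall>k<r. t k \<noteq> 0) \<longrightarrow>
    F (t, z, w) = (\<Sum>(c, m)\<leftarrow>M. c * torus_char r m t)"
  using assms
proof induction
  case (const c)
  show ?case by (rule exI[of _ "[(c, \<lambda>_. 0)]"]) (simp add: torus_char_def)
next
  case (var_t k)
  have "torus_char r (\<lambda>l. if l = k then 1 else 0) t = t k" for t
  proof -
    have "torus_char r (\<lambda>l. if l = k then 1 else 0) t = (\<Prod>l<r. if l = k then t l else 1)"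
      unfolding torus_char_def by (intro prod.cong) auto
    then show ?thesis using var_t by simp
  qed
  then show ?case by (intro exI[of _ "[(1, \<lambda>l. if l = k then 1 else 0)]"]) simp
next
  case (var_z k)
  show ?case by (rule exI[of _ "[(z k, \<lambda>_. 0)]"]) (simp add: torus_char_def)
next
  case (var_w k)
  show ?case by (rule exI[of _ "[(w k, \<lambda>_. 0)]"]) (simp add: torus_char_def)
next
  case (add d e F G)
  then obtain M M' :: "(complex \<times> (nat \<Rightarrow> int)) list" where
    "\<forall>t. (\<forall>k<r. t k \<noteq> 0) \<longrightarrow> F (t, z, w) = (\<Sum>(c, m)\<leftarrow>M. c * torus_char r m t)"
    "\<forall>t. (\<forall>k<r. t k \<noteq> 0) \<longrightarrow> G (t, z, w) = (\<Sum>(c, m)\<leftarrow>M'. c * torus_char r m t)" by blast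
  then show ?case by (intro exI[of _ "M @ M'"]) simp
next
  case (mult d e F d' e' G)
  then obtain M M' :: "(complex \<times> (nat \<Rightarrow> int)) list" where
    M: "\<forall>t. (\<forall>k<r. t k \<noteq> 0) \<longrightarrow> F (t, z, w) = (\<Sum>(c, m)\<leftarrow>M. c * torus_char r m t)"
    "\<forall>t. (\<forall>k<r. t k \<noteq> 0) \<longrightarrow> G (t, z, w) = (\<Sum>(c, m)\<leftarrow>M'. c * torus_char r m t)" by blast
  let ?P = "[(c * c', \<lambda>k. m k + m' k). (c, m) \<leftarrow> M, (c', m') \<leftarrow> M']"
  have "(\<Sum>(c, m)\<leftarrow>M. c * torus_char r m t) * (\<Sum>(c, m)\<leftarrow>M'. c * torus_char r m t)
      = (\<Sum>(c, m)\<leftarrow>?P. c * torus_char r m t)" if "\<forall>k<r. t k \<noteq> 0" for t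
  proof (induction M)
    case (Cons a M)
    obtain c m where a: "a = (c, m)" by (cases a)
    have "(\<Sum>(c, m)\<leftarrow>map (\<lambda>(c', m'). (c * c', \<lambda>k. m k + m' k)) M'. c * torus_char r m t)
       = c * torus_char r m t * (\<Sum>(c, m)\<leftarrow>M'. c * torus_char r m t)"
      using that by (induction M') (auto simp: torus_char_add algebra_simps)
    then show ?case using Cons by (simp add: a algebra_simps)
  qed simp
  then show ?case using M by (intro exI[of _ ?P]) simp
qed

text \<open>
  The zero set of a relation between characters on \<open>S\<close> contains every \<open>\<epsilon>\<close> that satisfies all
  equations \<open>\<chi> = \<chi>'\<close> valid on \<open>S\<close>: by Dedekind's theorem the coefficients of the characters with a given
  restriction to \<open>S\<close> add up to 0, and these characters agree at \<open>\<epsilon>\<close>.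
\<close>

lemma character_sum_zero:
  assumes S: "S \<subseteq> carrier (torus r)" "s0 \<in> S"
    and mult: "\<And>s t. s \<in> S \<Longrightarrow> t \<in> S \<Longrightarrow> (\<lambda>k. s k * t k) \<in> S"
    and zero: "\<And>s. s \<in> S \<Longrightarrow> (\<Sum>(c, m)\<leftarrow>M. c * torus_char r m s) = 0"
    and eq: "\<And>m m'. (\<And>s. s \<in> S \<Longrightarrow> torus_char r m s = torus_char r m' s) \<Longrightarrow>
       torus_char r m \<epsilon> = torus_char r m' \<epsilon>"
  shows "(\<Sum>(c, m)\<leftarrow>M. c * torus_char r m \<epsilon>) = 0"
proof -
  let ?n = "length M"
  define f where "f q = restrict (torus_char r (snd (M ! q))) S" for q
  have nz: "torus_char r m s \<noteq> 0" if "s \<in> S" for m s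
    using S that by (intro torus_char_nonzero) auto
  have sums: "(\<Sum>(c, m)\<leftarrow>M. c * torus_char r m t) = (\<Sum>q<?n. fst (M ! q) * torus_char r (snd (M ! q)) t)" for t
    by (simp add: sum_list_sum_nth case_prod_unfold atLeast0LessThan)
  define a where "a g = (\<Sum>q | q < ?n \<and> f q = g. fst (M ! q))" for g
  have group: "(\<Sum>q<?n. fst (M ! q) * h (f q)) = (\<Sum>g\<in>f ` {..<?n}. a g * h g)" for h
  proof -
    have "(\<Sum>q<?n. fst (M ! q) * h (f q))
        = (\<Sum>g\<in>f ` {..<?n}. \<Sum>q | q \<in> {..<?n} \<and> f q = g. fst (M ! q) * h (f q))"
      by (rule sum.group[symmetric]) auto
    also have "\<dots> = (\<Sum>g\<in>f ` {..<?n}. a g * h g)"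
      by (intro sum.cong refl) (simp add: a_def sum_distrib_right)
    finally show ?thesis .
  qed
  have a0: "a g = 0" if g: "g \<in> f ` {..<?n}" for g
  proof (rule independent_characters[of "f ` {..<?n}" S "\<lambda>s t k. s k * t k" a g])
    show "\<exists>s\<in>S. g s \<noteq> 0" if "g \<in> f ` {..<?n}" for g
      using that S(2) nz by (intro bexI[of _ s0]) (auto simp: f_def)
    show "(\<Sum>g\<in>f ` {..<?n}. a g * g s) = 0" if s: "s \<in> S" for s
      using group[of "\<lambda>g. g s"] zero[OF s] s unfolding sums by (simp add: f_def)
    show "g = h" if "g \<in> f ` {..<?n}" "h \<in> f ` {..<?n}" "\<And>s. s \<in> S \<Longrightarrow> g s = h s" for g h
      using that by (auto simp: f_def fun_eq_iff restrict_def)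
  qed (use g mult in \<open>auto simp: f_def torus_char_mult\<close>)
  \<comment> \<open>The value at \<open>\<epsilon>\<close> depends only on the restriction of the character to \<open>S\<close>.\<close>
  define h where "h g = torus_char r (snd (M ! (SOME q. f q = g))) \<epsilon>" for g
  have "h (f q) = torus_char r (snd (M ! q)) \<epsilon>" for q
  proof -
    have "f (SOME q'. f q' = f q) = f q" by (rule someI[of _ q]) simp
    then show ?thesis
      unfolding h_def by (intro eq) (metis f_def restrict_apply')
  qed
  then show ?thesis unfolding sums using group[of h] a0 by simp
qed

text \<open>
  Gaussian elimination in which every pivot is odd. The condition says that \<open>L\<close> spans the whole space
  modulo 2. Columns are cleared from the last to the first; in column \<open>q\<close> the vector \<open>\<epsilon>\<close> is chosen with
  \<open>\<epsilon>\<^sub>q = 1\<close>, with \<open>\<epsilon>\<^sub>k = 0\<close> for \<open>k < q\<close>, and orthogonal modulo 2 to the rows already reduced, so a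
  vector of \<open>L\<close> that is not orthogonal to \<open>\<epsilon>\<close> still has an odd entry in column \<open>q\<close> after its later
  entries are cleared.
\<close>

lemma odd_diagonal_exists:
  fixes L :: "(nat \<Rightarrow> int) set"
  assumes add: "\<And>m n. m \<in> L \<Longrightarrow> n \<in> L \<Longrightarrow> (\<lambda>k. m k + n k) \<in> L"
    and cmult: "\<And>c m. m \<in> L \<Longrightarrow> (\<lambda>k. c * m k) \<in> L"
    and zero: "(\<lambda>_. 0) \<in> L"
    and odd: "\<And>\<epsilon> :: nat \<Rightarrow> int. (\<exists>k<r. odd (\<epsilon> k)) \<Longrightarrow> \<exists>l\<in>L. odd (\<Sum>k<r. \<epsilon> k * l k)"
  shows "\<exists>d. odd d \<and> (\<forall>k<r. \<exists>n\<in>L. n k = d \<and> (\<forall>k'<r. k' \<noteq> k \<longrightarrow> n k' = 0))"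
proof -
  have sum_L: "(\<lambda>l. \<Sum>k\<in>A. c k * n k l) \<in> L" if "finite A" "\<And>k. k \<in> A \<Longrightarrow> n k \<in> L"
    for A :: "nat set" and c :: "nat \<Rightarrow> int" and n
    using that
  proof (induction A rule: finite_induct)
    case (insert a A)
    have "n a \<in> L" by (rule insert.prems) simp
    moreover have "(\<lambda>l. \<Sum>k\<in>A. c k * n k l) \<in> L"
      by (rule insert.IH) (rule insert.prems, simp)
    ultimately have "(\<lambda>l. c a * n a l + (\<Sum>k\<in>A. c k * n k l)) \<in> L"
      by (rule add[OF cmult])
    then show ?case unfolding sum.insert[OF insert.hyps] .
  next
    case empty
    show ?case unfolding sum.empty by (rule zero)
  qed
  define P where "P d q \<longleftrightarrow> odd d \<and>
    (\<forall>k\<in>{q..<r}. \<exists>n\<in>L. n k = d \<and> (\<forall>k'\<in>{q..<r} - {k}. n k' = 0))" for d :: int and q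
  have "q \<le> r \<Longrightarrow> \<exists>d. P d q" for q
  proof (induction "r - q" arbitrary: q)
    case 0
    then show ?case by (intro exI[of _ 1]) (simp add: P_def)
  next
    case (Suc x)
    then have q: "q < r" "x = r - Suc q" "Suc q \<le> r" by simp_all
    obtain d where "P d (Suc q)" using Suc.hyps(1)[OF q(2,3)] by (rule exE)
    then have d: "odd d"
      and "\<forall>k\<in>{Suc q..<r}. \<exists>n. n \<in> L \<and> n k = d \<and> (\<forall>k'\<in>{Suc q..<r} - {k}. n k' = 0)"
      unfolding P_def by blast+
    from bchoice[OF this(2)] obtain n where
      nn: "\<forall>k\<in>{Suc q..<r}. n k \<in> L \<and> n k k = d \<and> (\<forall>k'\<in>{Suc q..<r} - {k}. n k k' = 0)" by (rule exE)
    have n: "n k \<in> L" "n k k = d" if "Suc q \<le> k" "k < r" for k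
      using nn that by simp_all
    have n0: "n k k' = 0" if "Suc q \<le> k" "k < r" "Suc q \<le> k'" "k' < r" "k' \<noteq> k" for k k'
      using nn that by simp
    define \<epsilon> :: "nat \<Rightarrow> int" where "\<epsilon> k = (if k < q then 0 else if k = q then 1 else n k q)" for k
    obtain l where l: "l \<in> L" "odd (\<Sum>k<r. \<epsilon> k * l k)"
    proof -
      have "odd (\<epsilon> q)" by (simp add: \<epsilon>_def)
      then have "\<exists>k<r. odd (\<epsilon> k)" using q(1) by blast
      from odd[OF this] show thesis using that by blast
    qed
    define l' where "l' k = d * l k - (\<Sum>a\<in>{Suc q..<r}. l a * n a k)" for k
    have l'_L: "l' \<in> L"
    proof -
      have "(\<lambda>k. \<Sum>a\<in>{Suc q..<r}. l a * n a k) \<in> L" by (rule sum_L) (auto intro: n)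
      from add[OF cmult[OF l(1), of d] cmult[OF this, of "-1"]] show ?thesis
        by (simp add: l'_def[abs_def])
    qed
    have l'_0: "l' k = 0" if k: "Suc q \<le> k" "k < r" for k
    proof -
      have "(\<Sum>a\<in>{Suc q..<r}. l a * n a k) = (\<Sum>a\<in>{Suc q..<r}. if a = k then l k * d else 0)"
        using n n0 k by (intro sum.cong) auto
      then show ?thesis using k n(2) by (simp add: l'_def)
    qed
    have "odd (l' q)"
    proof -
      have split: "(\<Sum>k<r. g k) = (\<Sum>k<q. g k) + g q + (\<Sum>k\<in>{Suc q..<r}. g k)" for g :: "nat \<Rightarrow> int"
      proof -
        have "{..<r} = {..<q} \<union> {q} \<union> {Suc q..<r}" using q(1) by auto
        moreover have "{..<q} \<inter> {Suc q..<r} = {}" by auto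
        ultimately show ?thesis by (simp add: sum.union_disjoint)
      qed
      have "(\<Sum>k<r. \<epsilon> k * l k) = l q + (\<Sum>k\<in>{Suc q..<r}. l k * n k q)"
        unfolding split[of "\<lambda>k. \<epsilon> k * l k"] by (auto simp: \<epsilon>_def intro!: sum.cong)
      then have "odd (l q + (\<Sum>k\<in>{Suc q..<r}. l k * n k q))" using l by simp
      then show ?thesis using d by (auto simp: l'_def)
    qed
    show ?case
    proof (intro exI[of _ "d * l' q"], unfold P_def, intro conjI ballI)
      show "odd (d * l' q)" using d \<open>odd (l' q)\<close> by simp
      fix k assume "k \<in> {q..<r}"
      then have k: "q \<le> k" "k < r" by simp_all
      show "\<exists>n\<in>L. n k = d * l' q \<and> (\<forall>k'\<in>{q..<r} - {k}. n k' = 0)"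
      proof (cases "k = q")
        case True
        show ?thesis
          by (rule bexI[OF _ cmult[OF l'_L, of d]]) (use True l'_0 in auto)
      next
        case False
        then have k': "Suc q \<le> k" using k by simp
        have "(\<lambda>a. l' q * n k a + (- n k q) * l' a) \<in> L"
          by (rule add[OF cmult[OF n(1)[OF k' k(2)]] cmult[OF l'_L]])
        moreover have "l' q * n k k + (- n k q) * l' k = d * l' q"
          using n(2) l'_0 k' k by simp
        moreover have "l' q * n k a + (- n k q) * l' a = 0" if a: "q \<le> a" "a < r" "a \<noteq> k" for a
        proof (cases "a = q")
          case False
          then show ?thesis using a k k' n0[of k a] l'_0[of a] by simp
        qed simp
        ultimately show ?thesis by (intro bexI[of _ "\<lambda>a. l' q * n k a + (- n k q) * l' a"]) auto
      qed
    qed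
  qed
  from this[of 0] obtain d where "P d 0" by auto
  show ?thesis
  proof (intro exI conjI allI impI)
    show "odd d" using \<open>P d 0\<close> unfolding P_def by blast
    fix k assume "k < r"
    then have "k \<in> {0..<r}" by simp
    then obtain n where "n \<in> L" "n k = d" "\<forall>k'\<in>{0..<r} - {k}. n k' = 0"
      using \<open>P d 0\<close> unfolding P_def by blast
    then show "\<exists>n\<in>L. n k = d \<and> (\<forall>k'<r. k' \<noteq> k \<longrightarrow> n k' = 0)" by (intro bexI[of _ n]) auto
  qed
qed

text \<open>
  Let \<open>L\<close> be the lattice of characters that are trivial on \<open>S\<close>. The separation hypothesis says that
  no vector of signs other than 1 is annihilated by \<open>L\<close>, so \<open>L\<close> is everything modulo 2 and contains an
  odd multiple \<open>d\<close> of each unit vector. Hence all coordinates of all elements of \<open>S\<close> are roots of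
  unity of order dividing \<open>d\<close>.
\<close>

lemma separated_from_signs_finite:
  assumes S: "S \<subseteq> carrier (torus r)" "s0 \<in> S"
    and sep: "\<And>\<epsilon>. \<epsilon> \<in> carrier (torus r) \<Longrightarrow> (\<And>k. k < r \<Longrightarrow> \<epsilon> k = 1 \<or> \<epsilon> k = - 1) \<Longrightarrow> \<epsilon> \<noteq> \<one>\<^bsub>torus r\<^esub> \<Longrightarrow>
       \<exists>m m'. (\<forall>s\<in>S. torus_char r m s = torus_char r m' s) \<and> torus_char r m \<epsilon> \<noteq> torus_char r m' \<epsilon>"
  shows "finite S"
proof -
  define L where "L = {m. \<forall>s\<in>S. torus_char r m s = 1}"
  have nz: "s k \<noteq> 0" if "s \<in> S" "k < r" for s k using that S by auto
  have "\<exists>d. odd d \<and> (\<forall>k<r. \<exists>n\<in>L. n k = d \<and> (\<forall>k'<r. k' \<noteq> k \<longrightarrow> n k' = 0))"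
  proof (rule odd_diagonal_exists)
    show "(\<lambda>k. m k + n k) \<in> L" if "m \<in> L" "n \<in> L" for m n
      using that nz by (auto simp: L_def torus_char_add)
    show "(\<lambda>k. c * m k) \<in> L" if "m \<in> L" for c m
      using that by (auto simp: L_def torus_char_cmult)
    show "(\<lambda>_. 0) \<in> L" by (auto simp: L_def torus_char_def)
    fix a :: "nat \<Rightarrow> int" assume a: "\<exists>k<r. odd (a k)"
    define \<epsilon> :: Defs.vec where "\<epsilon> k = (if k < r then (- 1) powi a k else 0)" for k
    have pm: "\<epsilon> k = 1 \<or> \<epsilon> k = - 1" if "k < r" for k
      using that by (auto simp: \<epsilon>_def power_int_minus_left)
    have \<epsilon>: "\<epsilon> \<in> carrier (torus r)" by (auto simp: \<epsilon>_def cspace_def)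
    have "\<epsilon> \<noteq> \<one>\<^bsub>torus r\<^esub>"
    proof
      obtain k where k: "k < r" "odd (a k)" using a by blast
      assume "\<epsilon> = \<one>\<^bsub>torus r\<^esub>"
      then have "\<epsilon> k = 1" using k by simp
      then show False using k by (simp add: \<epsilon>_def power_int_minus_left)
    qed
    then obtain m m' where m: "\<And>s. s \<in> S \<Longrightarrow> torus_char r m s = torus_char r m' s"
      "torus_char r m \<epsilon> \<noteq> torus_char r m' \<epsilon>" using sep[OF \<epsilon> pm] by blast
    let ?l = "\<lambda>k. m k + (-1) * m' k"
    have div: "torus_char r ?l t = torus_char r m t / torus_char r m' t" if "\<And>k. k < r \<Longrightarrow> t k \<noteq> 0" for t
      using torus_char_add[where m = m and n = "\<lambda>k. (-1) * m' k" and t = t and r = r] that torus_char_cmult[of r "-1" m' t]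
      by (simp add: power_int_minus field_simps)
    have "?l \<in> L"
    proof -
      have "torus_char r ?l s = 1" if "s \<in> S" for s
        using div[of s] m(1)[OF that] torus_char_nonzero[of r s m'] nz[OF that] by simp
      then show ?thesis by (simp add: L_def)
    qed
    moreover have "odd (\<Sum>k<r. a k * ?l k)"
    proof
      assume ev: "even (\<Sum>k<r. a k * ?l k)"
      have "torus_char r ?l \<epsilon> = (\<Prod>k<r. (- 1) powi (a k * ?l k))"
        unfolding torus_char_def by (intro prod.cong) (auto simp: \<epsilon>_def power_int_mult)
      also have "\<dots> = (- 1) powi (\<Sum>k<r. a k * ?l k)"
        by (induction r) (simp_all add: power_int_add)
      also have "\<dots> = 1" using ev by (simp add: power_int_minus_left)
      finally have "torus_char r m \<epsilon> / torus_char r m' \<epsilon> = 1" using div[of \<epsilon>] \<epsilon> by auto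
      then show False using m(2) by auto
    qed
    ultimately show "\<exists>l\<in>L. odd (\<Sum>k<r. a k * l k)" by (intro bexI[of _ ?l])
  qed
  then obtain d where d: "odd d" "\<forall>k<r. \<exists>n\<in>L. n k = d \<and> (\<forall>k'<r. k' \<noteq> k \<longrightarrow> n k' = 0)" by blast
  define D where "D = nat \<bar>d\<bar>"
  have D: "D > 0" using d(1) by (auto simp: D_def)
  have root: "s k ^ D = 1" if s: "s \<in> S" and k: "k < r" for s k
  proof -
    obtain n where n: "n \<in> L" "n k = d" "\<forall>k'<r. k' \<noteq> k \<longrightarrow> n k' = 0" using d(2) k by blast
    have "torus_char r n s = (\<Prod>l<r. if l = k then s k powi d else 1)"
      unfolding torus_char_def using n by (intro prod.cong) auto
    also have "\<dots> = s k powi d" using k by simp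
    finally have "s k powi d = 1" using n(1) s by (simp add: L_def)
    then show ?thesis unfolding D_def
      by (cases "d \<ge> 0") (auto simp: power_int_def field_simps split: if_splits)
  qed
  have "finite {x :: complex. x ^ D = 1}"
    using D finite_roots_unity[of D] by simp
  then have "finite (Pi\<^sub>E {..<r} (\<lambda>_. {x :: complex. x ^ D = 1}))" by (intro finite_PiE) auto
  moreover have "(\<lambda>s. restrict s {..<r}) ` S \<subseteq> Pi\<^sub>E {..<r} (\<lambda>_. {x :: complex. x ^ D = 1})"
    by (intro image_subsetI, rule PiE_I) (use root in auto)
  moreover have "inj_on (\<lambda>s. restrict s {..<r}) S"
  proof (rule inj_onI)
    fix s t assume st: "s \<in> S" "t \<in> S" "restrict s {..<r} = restrict t {..<r}"
    then show "s = t" using S(1)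
      by (intro torus_eqI[of s r t]) (auto simp: restrict_def fun_eq_iff split: if_splits)
  qed
  ultimately show ?thesis using finite_imageD finite_subset by blast
qed

section \<open>Irreducibility of the hypersurface\<close>

lemma nonzero_poly_curve:
  fixes p :: "complex poly"
  assumes "poly p s0 \<noteq> 0" shows "finite {s. poly p s = 0}"
  using assms poly_roots_finite[of p] by fastforce

text \<open>
  A property shared by polynomials with \<open>t\<close> held fixed that is closed under products for different
  \<open>t\<close>; it is all that the irreducibility argument needs to know about functions on the cone.
\<close>

definition poly_on_curves :: "(Defs.vec \<times> Defs.vec \<Rightarrow> complex) \<Rightarrow> bool" where
  "poly_on_curves f \<longleftrightarrow>
     (\<forall>Z W. \<exists>p. \<forall>s. f (\<lambda>k. poly (Z k) s, \<lambda>k. poly (W k) s) = poly p s)"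

lemma poly_on_curves_bihom: "bihom_poly r i j d e F \<Longrightarrow> poly_on_curves (\<lambda>(z, w). F (t, z, w))"
  unfolding poly_on_curves_def using bihom_poly_on_curve by simp

lemma poly_on_curves_mult:
  assumes "poly_on_curves f" "poly_on_curves g" shows "poly_on_curves (\<lambda>p. f p * g p)"
  unfolding poly_on_curves_def
proof (intro allI)
  fix Z W :: "nat \<Rightarrow> complex poly"
  obtain p q where "\<forall>s. f (\<lambda>k. poly (Z k) s, \<lambda>k. poly (W k) s) = poly p s"
    "\<forall>s. g (\<lambda>k. poly (Z k) s, \<lambda>k. poly (W k) s) = poly q s"
    using assms unfolding poly_on_curves_def by blast
  then show "\<exists>p. \<forall>s. f (\<lambda>k. poly (Z k) s, \<lambda>k. poly (W k) s) * g (\<lambda>k. poly (Z k) s, \<lambda>k. poly (W k) s) = poly p s"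
    by (intro exI[of _ "p * q"]) simp
qed

lemma poly_on_curves_coord: "poly_on_curves (\<lambda>p. fst p k)" "poly_on_curves (\<lambda>p. snd p k)"
  unfolding poly_on_curves_def by auto

lemma finite_family_nonroot:
  fixes P :: "complex poly set"
  assumes "finite P" "\<And>p. p \<in> P \<Longrightarrow> \<exists>s. poly p s \<noteq> 0"
  shows "\<exists>s. \<forall>p\<in>P. poly p s \<noteq> 0"
proof -
  have "finite (\<Union>p\<in>P. {s. poly p s = 0})"
    using assms nonzero_poly_curve by auto
  from ex_new_if_finite[OF infinite_UNIV_char_0 this] show ?thesis by blast
qed

text \<open>
  A single polynomial curve in the cone on which each function of a finite family is somewhere
  nonzero: the zeros of each are finite in number, so some parameter avoids all of them. Requiring
  that some coordinates \<open>Z a\<close> and \<open>W b\<close> do not vanish identically keeps both vectors nonzero.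
\<close>

lemma common_nonzero_on_curve:
  assumes Z: "\<And>s. (\<Sum>k\<le>min i j. poly (Z k) s * poly (W k) s) = 0"
    and deg: "\<And>k. k > i \<Longrightarrow> Z k = 0" "\<And>k. k > j \<Longrightarrow> W k = 0"
    and A: "finite A" "\<And>f. f \<in> A \<Longrightarrow> poly_on_curves f"
    and nz: "\<And>f. f \<in> A \<Longrightarrow> \<exists>s. f (\<lambda>k. poly (Z k) s, \<lambda>k. poly (W k) s) \<noteq> 0"
    and z: "poly (Z a) s1 \<noteq> 0" and w: "poly (W b) s2 \<noteq> 0"
  shows "\<exists>p\<in>milnor_cone i j. \<forall>f\<in>A. f p \<noteq> 0"
proof -
  have "\<forall>f\<in>A. \<exists>p. \<forall>s. f (\<lambda>k. poly (Z k) s, \<lambda>k. poly (W k) s) = poly p s"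
    using A(2) unfolding poly_on_curves_def by blast
  from bchoice[OF this] obtain p where
    p: "\<And>f s. f \<in> A \<Longrightarrow> f (\<lambda>k. poly (Z k) s, \<lambda>k. poly (W k) s) = poly (p f) s" by blast
  have "\<exists>s. \<forall>q\<in>insert (Z a) (insert (W b) (p ` A)). poly q s \<noteq> 0"
    using A(1) z w nz p by (intro finite_family_nonroot) auto
  then obtain s where s: "poly (Z a) s \<noteq> 0" "poly (W b) s \<noteq> 0" "\<forall>f\<in>A. poly (p f) s \<noteq> 0" by auto
  have "(\<lambda>k. poly (Z k) s) \<in> nonzero_vecs i" "(\<lambda>k. poly (W k) s) \<in> nonzero_vecs j"
    using s deg by (auto simp: nonzero_vecs_def cspace_def fun_eq_iff)
  then have "(\<lambda>k. poly (Z k) s, \<lambda>k. poly (W k) s) \<in> milnor_cone i j"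
    using Z by (simp add: milnor_cone_def)
  then show ?thesis using s(3) p by (intro bexI) auto
qed

text \<open>
  If \<open>w\<^sub>0 = \<dots> = w\<^sub>i = 0\<close>, then \<open>w\<close> is moved in the direction of a vector \<open>u\<close> orthogonal to \<open>z\<close>. This
  reaches the part of the cone that is parametrised in the next lemma.
\<close>

lemma perturb_w:
  assumes i: "1 \<le> i" and ij: "i \<le> j" and f: "poly_on_curves f" and zw: "(z, w) \<in> milnor_cone i j" "f (z, w) \<noteq> 0"
  shows "\<exists>(z, w)\<in>milnor_cone i j. f (z, w) \<noteq> 0 \<and> (\<exists>k\<le>i. w k \<noteq> 0)"
proof (cases "\<exists>k\<le>i. w k \<noteq> 0")
  case False
  obtain a where a: "a \<le> i" "z a \<noteq> 0" using nonzero_vecs_coord[OF milnor_coneD(1)[OF zw(1)]] by blast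
  define b :: nat where "b = (if a = 0 then 1 else 0)"
  have b: "b \<le> i" "b \<noteq> a" using i by (auto simp: b_def)
  define u :: Defs.vec where "u k = (if k = b then z a else if k = a then - z b else 0)" for k
  have wd: "w \<in> nonzero_vecs j" by (rule milnor_coneD(2)[OF zw(1)])
  have orth: "(\<Sum>k\<le>i. z k * u k) = 0"
  proof -
    have "(\<Sum>k\<le>i. z k * u k) = (\<Sum>k\<in>{a, b}. z k * u k)"
      using a b by (intro sum.mono_neutral_right) (auto simp: u_def)
    then show ?thesis using b by (simp add: u_def)
  qed
  obtain c where c: "w c \<noteq> 0" using nonzero_vecs_coord[OF wd] by blast
  have "\<exists>p\<in>milnor_cone i j. \<forall>g\<in>{f, \<lambda>p. snd p b}. g p \<noteq> 0"
  proof (rule common_nonzero_on_curve[where Z = "\<lambda>k. [:z k:]" and W = "\<lambda>k. [:w k, u k:]" and a = a and b = c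
        and ?s1.0 = 0 and ?s2.0 = 0])
    show "(\<Sum>k\<le>min i j. poly [:z k:] s * poly [:w k, u k:] s) = 0" for s
    proof -
      have "(\<Sum>k\<le>min i j. poly [:z k:] s * poly [:w k, u k:] s)
          = (\<Sum>k\<le>min i j. z k * w k) + s * (\<Sum>k\<le>i. z k * u k)"
        using ij by (simp add: sum_distrib_left sum.distrib algebra_simps)
      then show ?thesis using orth milnor_coneD(3)[OF zw(1)] by simp
    qed
    show "[:z k:] = 0" if "k > i" for k
      using milnor_coneD(1)[OF zw(1)] that by (simp add: nonzero_vecs_def cspace_def)
    show "[:w k, u k:] = 0" if "k > j" for k
      using wd that a b ij by (auto simp: nonzero_vecs_def cspace_def u_def)
    show "poly_on_curves g" if "g \<in> {f, \<lambda>p. snd p b}" for g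
      using that f poly_on_curves_coord by auto
    show "\<exists>s. g (\<lambda>k. poly [:z k:] s, \<lambda>k. poly [:w k, u k:] s) \<noteq> 0" if g: "g \<in> {f, \<lambda>p. snd p b}" for g
    proof (cases "g = f")
      case True
      then show ?thesis using zw(2) by (intro exI[of _ 0]) simp
    next
      case neq: False
      have "w b = 0" using False b by blast
      then show ?thesis using neq g a by (intro exI[of _ 1]) (auto simp: u_def)
    qed
  qed (use a c in auto)
  then show ?thesis using b by fastforce
qed (use zw in blast)

text \<open>
  The points with \<open>(w\<^sub>0, \<dots>, w\<^sub>i) \<noteq> 0\<close> are images of the polynomial map
  \<open>(a, c, w) \<mapsto> ((c \<cdot> w) a - (a \<cdot> w) c, w)\<close>, whose values always satisfy the equation: take \<open>a = z\<close> and \<open>c\<close>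
  with \<open>c \<cdot> w = 1\<close>. Hence a line in the affine space of triples \<open>(a, c, w)\<close> gives a polynomial curve
  that joins any two such points.
\<close>

lemma milnor_cone_irreducible_2:
  assumes i: "1 \<le> i" and ij: "i \<le> j" and f: "poly_on_curves f" and g: "poly_on_curves g"
    and fp: "p \<in> milnor_cone i j" "f p \<noteq> 0" and gp: "q \<in> milnor_cone i j" "g q \<noteq> 0"
  shows "\<exists>p\<in>milnor_cone i j. f p \<noteq> 0 \<and> g p \<noteq> 0"
proof -
  obtain z1 w1 k1 where 1: "(z1, w1) \<in> milnor_cone i j" "f (z1, w1) \<noteq> 0" "k1 \<le> i" "w1 k1 \<noteq> 0"
    using perturb_w[OF i ij f, of "fst p" "snd p"] fp by auto
  obtain z2 w2 k2 where 2: "(z2, w2) \<in> milnor_cone i j" "g (z2, w2) \<noteq> 0" "k2 \<le> i" "w2 k2 \<noteq> 0"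
    using perturb_w[OF i ij g, of "fst q" "snd q"] gp by auto
  define c1 :: Defs.vec where "c1 k = (if k = k1 then 1 / w1 k1 else 0)" for k
  define c2 :: Defs.vec where "c2 k = (if k = k2 then 1 / w2 k2 else 0)" for k
  have cw: "(\<Sum>k\<le>i. c1 k * w1 k) = 1" "(\<Sum>k\<le>i. c2 k * w2 k) = 1"
    using 1 2 by (simp_all add: c1_def c2_def if_distrib[of "\<lambda>x. x * _"] cong: if_cong)
  have zw: "(\<Sum>k\<le>i. z1 k * w1 k) = 0" "(\<Sum>k\<le>i. z2 k * w2 k) = 0"
    using milnor_coneD(3)[OF 1(1)] milnor_coneD(3)[OF 2(1)] ij by simp_all
  define A where "A k = [:z1 k, z2 k - z1 k:]" for k
  define C where "C k = [:c1 k, c2 k - c1 k:]" for k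
  define W where "W k = [:w1 k, w2 k - w1 k:]" for k
  define Z where "Z k = (\<Sum>l\<le>i. C l * W l) * A k - (\<Sum>l\<le>i. A l * W l) * C k" for k
  have Z: "poly (Z k) s = (\<Sum>l\<le>i. poly (C l) s * poly (W l) s) * poly (A k) s
      - (\<Sum>l\<le>i. poly (A l) s * poly (W l) s) * poly (C k) s" for k s
    by (simp only: Z_def poly_sum poly_mult poly_diff)
  have ends: "poly (A k) 0 = z1 k" "poly (C k) 0 = c1 k" "poly (W k) 0 = w1 k"
    "poly (A k) 1 = z2 k" "poly (C k) 1 = c2 k" "poly (W k) 1 = w2 k" for k
    by (simp_all add: A_def C_def W_def)
  have at0: "(\<lambda>k. poly (Z k) 0) = z1" "(\<lambda>k. poly (W k) 0) = w1"
    and at1: "(\<lambda>k. poly (Z k) 1) = z2" "(\<lambda>k. poly (W k) 1) = w2"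
    by (simp_all add: Z ends cw zw)
  obtain a where a: "z1 a \<noteq> 0" using nonzero_vecs_coord[OF milnor_coneD(1)[OF 1(1)]] by blast
  have "\<exists>p\<in>milnor_cone i j. \<forall>h\<in>{f, g}. h p \<noteq> 0"
  proof (rule common_nonzero_on_curve[where Z = Z and W = W and a = a and b = k1
        and ?s1.0 = 0 and ?s2.0 = 0])
    show "(\<Sum>k\<le>min i j. poly (Z k) s * poly (W k) s) = 0" for s
    proof -
      have "(\<Sum>k\<le>i. Z k * W k)
          = (\<Sum>l\<le>i. C l * W l) * (\<Sum>k\<le>i. A k * W k) - (\<Sum>l\<le>i. A l * W l) * (\<Sum>k\<le>i. C k * W k)"
        unfolding Z_def left_diff_distrib sum_subtractf mult.assoc sum_distrib_left[symmetric] ..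
      then have "(\<Sum>k\<le>i. Z k * W k) = 0" by (simp add: mult.commute)
      then have "poly (\<Sum>k\<le>i. Z k * W k) s = 0" by simp
      then show ?thesis using ij by (simp add: poly_sum)
    qed
    have out: "z1 k = 0" "z2 k = 0" "c1 k = 0" "c2 k = 0" if "k > i" for k
      using that milnor_coneD(1)[OF 1(1)] milnor_coneD(1)[OF 2(1)] 1(3) 2(3)
      by (auto simp: nonzero_vecs_def cspace_def c1_def c2_def)
    show "Z k = 0" if "k > i" for k using out[OF that] by (simp add: Z_def A_def C_def)
    show "W k = 0" if "k > j" for k
      using that milnor_coneD(2)[OF 1(1)] milnor_coneD(2)[OF 2(1)]
      by (simp add: nonzero_vecs_def cspace_def W_def)
    show "\<exists>s. h (\<lambda>k. poly (Z k) s, \<lambda>k. poly (W k) s) \<noteq> 0" if "h \<in> {f, g}" for h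
    proof (cases "h = f")
      case True
      then show ?thesis using 1(2) by (intro exI[of _ 0]) (simp add: at0)
    next
      case False
      then show ?thesis using that 2(2) by (intro exI[of _ 1]) (simp add: at1)
    qed
    show "poly (Z a) 0 \<noteq> 0" using fun_cong[OF at0(1), of a] a by simp
    show "poly (W k1) 0 \<noteq> 0" using fun_cong[OF at0(2), of k1] 1(4) by simp
  qed (use f g in auto)
  then show ?thesis by simp
qed

lemma milnor_cone_irreducible:
  assumes i: "1 \<le> i" and ij: "i \<le> j" and "finite A"
    and "\<And>f. f \<in> A \<Longrightarrow> poly_on_curves f" "\<And>f. f \<in> A \<Longrightarrow> \<exists>p\<in>milnor_cone i j. f p \<noteq> 0"
    and ne: "milnor_cone i j \<noteq> {}"
  shows "\<exists>p\<in>milnor_cone i j. \<forall>f\<in>A. f p \<noteq> 0"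
proof -
  have "\<exists>g. poly_on_curves g \<and> (\<forall>p. g p \<noteq> 0 \<longleftrightarrow> (\<forall>f\<in>A. f p \<noteq> 0)) \<and> (\<exists>p\<in>milnor_cone i j. g p \<noteq> 0)"
    using assms(3-5)
  proof (induction A rule: finite_induct)
    case empty
    have "poly_on_curves (\<lambda>_. 1)" unfolding poly_on_curves_def by (intro allI exI[of _ 1]) simp
    then show ?case using ne by (intro exI[of _ "\<lambda>_. 1"]) auto
  next
    case (insert f A)
    have "\<exists>g. poly_on_curves g \<and> (\<forall>p. g p \<noteq> 0 \<longleftrightarrow> (\<forall>f\<in>A. f p \<noteq> 0)) \<and> (\<exists>p\<in>milnor_cone i j. g p \<noteq> 0)"
      by (rule insert.IH) (use insert.prems in auto)
    then obtain g where g: "poly_on_curves g" "\<forall>p. g p \<noteq> 0 \<longleftrightarrow> (\<forall>f\<in>A. f p \<noteq> 0)" "\<exists>p\<in>milnor_cone i j. g p \<noteq> 0"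
      by blast
    have f: "poly_on_curves f" "\<exists>p\<in>milnor_cone i j. f p \<noteq> 0" using insert.prems by auto
    obtain p q where "p \<in> milnor_cone i j" "f p \<noteq> 0" "q \<in> milnor_cone i j" "g q \<noteq> 0" using f(2) g(3) by blast
    from milnor_cone_irreducible_2[OF i ij f(1) g(1) this]
    show ?case using g f by (intro exI[of _ "\<lambda>p. f p * g p"]) (auto intro: poly_on_curves_mult)
  qed
  then show ?thesis by metis
qed

section \<open>Invariance of domain in complex coordinates\<close>

text \<open>
  The real and imaginary parts of \<open>t\<^sub>k\<close> occupy the positions \<open>2k\<close> and \<open>2k + 1\<close>. The shift by 1 makes
  the origin correspond to the neutral element of the torus.
\<close>

definition complexify :: "nat \<Rightarrow> (nat \<Rightarrow> real) \<Rightarrow> Defs.vec" where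
  "complexify r x = (\<lambda>k. if k < r then Complex (1 + x (2 * k)) (x (2 * k + 1)) else 0)"

lemma continuous_map_Euclidean_subtopology:
  "continuous_on (topspace (Euclidean_space m) \<inter> U) f \<Longrightarrow> (\<And>x. x \<in> U \<Longrightarrow> f x \<in> topspace (Euclidean_space n)) \<Longrightarrow>
   continuous_map (subtopology (Euclidean_space m) U) (Euclidean_space n) f"
proof -
  assume c: "continuous_on (topspace (Euclidean_space m) \<inter> U) f" and f: "\<And>x. x \<in> U \<Longrightarrow> f x \<in> topspace (Euclidean_space n)"
  have E: "Euclidean_space k = top_of_set (topspace (Euclidean_space k))" for k
    by (simp add: Euclidean_space_def euclidean_product_topology topspace_Euclidean_space)
  have "subtopology (Euclidean_space m) U = top_of_set (topspace (Euclidean_space m) \<inter> U)"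
    by (subst E) (simp add: subtopology_subtopology)
  moreover have "continuous_map (top_of_set (topspace (Euclidean_space m) \<inter> U)) (top_of_set (topspace (Euclidean_space n))) f"
    using c f by (auto simp: continuous_map_in_subtopology)
  ultimately show ?thesis using E[of n] by simp
qed

lemma complexify_continuous: "continuous_on UNIV (complexify r)"
proof (rule continuous_on_coordinatewise_then_product)
  fix k
  have "continuous_on UNIV (\<lambda>x :: nat \<Rightarrow> real. Complex (1 + x (2 * k)) (x (2 * k + 1)))"
    unfolding complex_eq
    by (intro continuous_intros continuous_on_product_then_coordinatewise[OF continuous_on_id] continuous_on_of_real)
  then show "continuous_on UNIV (\<lambda>x. complexify r x k)"
    by (cases "k < r") (simp_all add: complexify_def)
qed

lemma complexify_inj: "inj_on (complexify r) (topspace (Euclidean_space (2 * r)))"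
proof (rule inj_onI)
  fix x y assume xy: "x \<in> topspace (Euclidean_space (2 * r))" "y \<in> topspace (Euclidean_space (2 * r))"
    "complexify r x = complexify r y"
  show "x = y"
  proof
    fix a
    show "x a = y a"
    proof (cases "a < 2 * r")
      case True
      then have "a div 2 < r" by simp
      then have "x (2 * (a div 2)) = y (2 * (a div 2))" "x (2 * (a div 2) + 1) = y (2 * (a div 2) + 1)"
        using fun_cong[OF xy(3), of "a div 2"] by (simp_all add: complexify_def)
      then show ?thesis by (cases "even a") (auto elim!: evenE oddE)
    next
      case False
      then show ?thesis using xy by (simp add: topspace_Euclidean_space)
    qed
  qed
qed

text \<open>
  If \<open>j < r\<close>, the image of a neighbourhood of 1 would be open in \<open>\<real>\<^sup>2\<^sup>r\<close> by invariance of domain, although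
  its coordinate with index \<open>2j\<close> vanishes identically.
\<close>

lemma no_injection_into_smaller_dimension:
  assumes N: "open N" "\<one>\<^bsub>torus r\<^esub> \<in> N"
    and cont: "\<And>l. l < j \<Longrightarrow> continuous_on N (f l)"
    and inj: "\<And>s t. s \<in> N \<inter> carrier (torus r) \<Longrightarrow> t \<in> N \<inter> carrier (torus r) \<Longrightarrow>
       (\<And>l. l < j \<Longrightarrow> f l s = (f l t :: complex)) \<Longrightarrow> s = t"
  shows "r \<le> j"
proof (rule ccontr)
  assume "\<not> r \<le> j"
  then have rj: "j < r" by simp
  let ?E = "Euclidean_space (2 * r)"
  define M where "M = N \<inter> (\<Inter>k\<in>{..<r}. {t. t k \<noteq> 0})"
  define U where "U = topspace ?E \<inter> complexify r -` M"
  define g where "g x a = (if a < 2 * j then (if even a then Re (f (a div 2) (complexify r x)) else Im (f (a div 2) (complexify r x))) else 0)" for x a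
  have "open M" unfolding M_def
    by (intro open_Int N(1) open_INT) (auto intro!: open_Collect_neq continuous_on_product_then_coordinatewise[OF continuous_on_id])
  then have oV: "open (complexify r -` M)"
    using complexify_continuous by (simp add: open_vimage)
  have E: "?E = top_of_set (topspace ?E)"
    by (simp add: Euclidean_space_def euclidean_product_topology topspace_Euclidean_space)
  have oU: "openin ?E U" unfolding U_def by (subst E) (use oV in \<open>simp add: openin_open_Int\<close>)
  have UT: "complexify r x \<in> N \<inter> carrier (torus r)" if "x \<in> U" for x
    using that unfolding U_def M_def by (auto simp: complexify_def cspace_def)
  have "continuous_on U g"
  proof (rule continuous_on_coordinatewise_then_product)
    fix a
    have cf: "continuous_on U (\<lambda>x. f l (complexify r x))" if "l < j" for l
      by (rule continuous_on_compose2[OF cont[OF that] continuous_on_subset[OF complexify_continuous]]) (use UT in auto)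
    show "continuous_on U (\<lambda>x. g x a)"
    proof (cases "a < 2 * j")
      case True
      then have "a div 2 < j" by simp
      from cf[OF this] True show ?thesis
        by (cases "even a") (auto simp: g_def intro!: continuous_intros)
    qed (simp add: g_def)
  qed
  moreover have "U = topspace ?E \<inter> U" by (auto simp: U_def)
  moreover have g_in: "g x \<in> topspace ?E" for x using rj by (auto simp: g_def topspace_Euclidean_space)
  ultimately have cg: "continuous_map (subtopology ?E U) ?E g"
    by (intro continuous_map_Euclidean_subtopology) auto
  have "inj_on g U"
  proof (rule inj_onI)
    fix x y assume xy: "x \<in> U" "y \<in> U" "g x = g y"
    have "f l (complexify r x) = f l (complexify r y)" if "l < j" for l
      using fun_cong[OF xy(3), of "2 * l"] fun_cong[OF xy(3), of "2 * l + 1"] that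
      by (simp add: g_def complex_eq_iff)
    then have "complexify r x = complexify r y" using inj UT xy by blast
    then show "x = y" using complexify_inj xy unfolding U_def by (auto dest: inj_onD)
  qed
  from invariance_of_domain_Euclidean_space[OF oU cg this] have "openin ?E (g ` U)" .
  then obtain V where V: "open V" "g ` U = topspace ?E \<inter> V"
    by (subst (asm) E) (auto simp: openin_open)
  have "complexify r (\<lambda>_. 0) = \<one>\<^bsub>torus r\<^esub>" by (auto simp: complexify_def complex_eq_iff)
  then have "(\<lambda>_. 0) \<in> U" using N(2) unfolding U_def M_def by (simp add: topspace_Euclidean_space)
  then have g0: "g (\<lambda>_. 0) \<in> V" using V(2) by blast
  \<comment> \<open>A point of the image, moved in the direction of the coordinate that vanishes on the image.\<close>
  define c where "c \<delta> a = (if a = 2 * j then \<delta> else g (\<lambda>_. 0) a)" for \<delta> :: real and a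
  have "continuous_on UNIV c"
  proof (rule continuous_on_coordinatewise_then_product)
    show "continuous_on UNIV (\<lambda>\<delta>. c \<delta> a)" for a
      by (cases "a = 2 * j") (simp_all add: c_def)
  qed
  then have "open (c -` V)" using V(1) by (simp add: open_vimage)
  moreover have "c 0 = g (\<lambda>_. 0)" by (auto simp: c_def g_def)
  then have "0 \<in> c -` V" using g0 by simp
  ultimately obtain \<epsilon> where \<epsilon>: "\<epsilon> > 0" "ball 0 \<epsilon> \<subseteq> c -` V" using open_contains_ball by blast
  then have "c (\<epsilon> / 2) \<in> V" by (auto simp: subset_iff)
  moreover have "c (\<epsilon> / 2) \<in> topspace ?E"
    using g_in[of "\<lambda>_. 0"] rj by (auto simp: c_def topspace_Euclidean_space)
  ultimately have "c (\<epsilon> / 2) \<in> g ` U" using V(2) by blast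
  then have "c (\<epsilon> / 2) (2 * j) = 0" by (auto simp: g_def)
  then show False using \<epsilon>(1) by (simp add: c_def)
qed

section \<open>Actions that are effective on a projection\<close>

context milnor_torus_action
begin

text \<open>
  The stabiliser of the image in \<open>\<P>\<^sup>j\<close> of the point \<open>([z], [w])\<close>.
\<close>

definition stab :: "Defs.vec \<Rightarrow> Defs.vec \<Rightarrow> Defs.vec set" where
  "stab z w = {t \<in> T. snd (\<phi> t (pt z w)) = proj_class j w}"

lemma fibre_preservingD:
  "t \<in> T \<Longrightarrow> x \<in> X \<Longrightarrow> y \<in> X \<Longrightarrow> snd x = snd y \<Longrightarrow> snd (\<phi> t x) = snd (\<phi> t y)"
  using action_preserves_fibres unfolding fibre_preserving_def by blast

lemma snd_pt: "snd (pt z w) = proj_class j w"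
  by (simp add: biproj_point_def)

lemma one_in_stab: "(z, w) \<in> milnor_cone i j \<Longrightarrow> e \<in> stab z w"
  using one_in_T act_one[OF milnor_coneD(4)] by (simp add: stab_def snd_pt del: torus_simps)

lemma stab_mult:
  assumes p: "(z, w) \<in> milnor_cone i j" and st: "s \<in> stab z w" "t \<in> stab z w"
  shows "(\<lambda>k. s k * t k) \<in> stab z w"
proof -
  have T: "s \<in> T" "t \<in> T" "snd (\<phi> s (pt z w)) = proj_class j w" "snd (\<phi> t (pt z w)) = proj_class j w"
    using st unfolding stab_def by blast+
  have x: "pt z w \<in> X" by (rule milnor_coneD(4)[OF p])
  have "snd (\<phi> s (\<phi> t (pt z w))) = snd (\<phi> s (pt z w))"
    by (rule fibre_preservingD[OF T(1) act_in[OF T(2) x] x]) (simp add: T(4) snd_pt)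
  then show ?thesis
    using act_mult[OF T(1,2) x] mult_in_T[OF T(1,2)] T(3) unfolding stab_def by simp
qed

lemma quotient_in_stab:
  assumes p: "(z, w) \<in> milnor_cone i j" and st: "s \<in> T" "t \<in> T"
    and eq: "snd (\<phi> s (pt z w)) = snd (\<phi> t (pt z w))"
  shows "(\<lambda>k. inverse (s k) * t k) \<in> stab z w"
proof -
  have x: "pt z w \<in> X" by (rule milnor_coneD(4)[OF p])
  let ?i = "\<lambda>k. inverse (s k)"
  have i: "?i \<in> T" using st(1) by (auto simp: cspace_def)
  have "(\<lambda>k. inverse (s k) * s k) = e" using st(1) by (auto simp: cspace_def fun_eq_iff)
  then have one: "\<phi> ?i (\<phi> s (pt z w)) = pt z w"
    using act_mult[OF i st(1) x] act_one[OF x] by simp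
  have "snd (\<phi> ?i (\<phi> t (pt z w))) = snd (\<phi> ?i (\<phi> s (pt z w)))"
    by (rule fibre_preservingD[OF i act_in[OF st(2) x] act_in[OF st(1) x]]) (simp add: eq)
  then show ?thesis
    using act_mult[OF i st(2) x] mult_in_T[OF i st(2)] one unfolding stab_def by (simp add: snd_pt)
qed

text \<open>
  The condition \<open>t \<notin> stab z w\<close> is Zariski open in \<open>t\<close> and \<open>(z, w)\<close> jointly: near a point where it holds,
  the ratio \<open>F / G\<close> of two coordinates of the image differs from \<open>w\<^sub>l / w\<^sub>k\<close>, which is the nonvanishing of
  \<open>G w\<^sub>l - F w\<^sub>k\<close>. The factor \<open>H\<close> restricts to the neighbourhood where \<open>F / G\<close> is the ratio. This gives both
  the closedness of the stabilisers and the openness of the set of points that a given \<open>t\<close> moves.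
\<close>

lemma separating_polynomial:
  assumes p: "(z, w) \<in> milnor_cone i j" and \<epsilon>: "\<epsilon> \<in> T" "\<epsilon> \<notin> stab z w"
  shows "\<exists>d d' P. bihom_poly r i j d d' P \<and> P (\<epsilon>, z, w) \<noteq> 0 \<and>
    (\<forall>t z' w'. (z', w') \<in> milnor_cone i j \<longrightarrow> t \<in> stab z' w' \<longrightarrow> P (t, z', w') = 0)"
proof -
  obtain z1 w1 where 1: "(z1, w1) \<in> milnor_cone i j" "\<phi> \<epsilon> (pt z w) = pt z1 w1"
    by (rule act_class[OF p \<epsilon>(1)])
  have w1: "w1 \<in> nonzero_vecs j" and w: "w \<in> nonzero_vecs j" using milnor_coneD(2) 1(1) p by blast+
  have ne: "proj_class j w \<noteq> proj_class j w1" using \<epsilon> 1(2) unfolding stab_def by (auto simp: snd_pt)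
  obtain k where k: "k \<le> j" "w1 k \<noteq> 0" using nonzero_vecs_coord[OF w1] by blast
  have "\<not> (\<forall>l. w l * w1 k = w1 l * w k)" using proj_class_eqI[OF w w1 k(2)] ne by blast
  then obtain l where l: "w l * w1 k \<noteq> w1 l * w k" by blast
  have lj: "l \<le> j"
  proof (rule ccontr)
    assume "\<not> l \<le> j"
    then have "w l = 0" "w1 l = 0" using w w1 by (auto simp: nonzero_vecs_def cspace_def)
    then show False using l by simp
  qed
  have m: "w1 \<in> snd (\<phi> \<epsilon> (pt z w))" unfolding 1(2) snd_pt by (rule self_mem_proj_class[OF w1])
  obtain d d' d'' f H F G where
    b: "bihom_poly r i j d d' H" "bihom_poly r i j d'' f F" "bihom_poly r i j d'' f G"
    and h: "H (\<epsilon>, z, w) \<noteq> 0"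
    and G: "\<And>t z w. t \<in> T \<Longrightarrow> (z, w) \<in> milnor_cone i j \<Longrightarrow> H (t, z, w) \<noteq> 0 \<Longrightarrow> G (t, z, w) \<noteq> 0"
    and q: "\<And>t z w w'. t \<in> T \<Longrightarrow> (z, w) \<in> milnor_cone i j \<Longrightarrow> H (t, z, w) \<noteq> 0 \<Longrightarrow>
      w' \<in> snd (\<phi> t (pt z w)) \<Longrightarrow> w' k \<noteq> 0 \<and> w' l / w' k = F (t, z, w) / G (t, z, w)"
    by (rule local_ratio[OF \<epsilon>(1) p m k(2,1) lj]) (rule that)
  define P where "P v = H v * (G v * (case v of (t, z, w) \<Rightarrow> w l) - F v * (case v of (t, z, w) \<Rightarrow> w k))" for v
  have "bihom_poly r i j (d + (d'' + 0)) (d' + (f + 1)) P"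
    unfolding P_def[abs_def]
    by (intro bihom_poly.mult bihom_poly_diff b bihom_poly.var_w k lj)
  moreover have "P (\<epsilon>, z, w) \<noteq> 0"
  proof -
    have *: "w1 l * G (\<epsilon>, z, w) = F (\<epsilon>, z, w) * w1 k"
      using G[OF \<epsilon>(1) p h] q[OF \<epsilon>(1) p h m] by (auto simp: field_simps)
    have "G (\<epsilon>, z, w) * w l \<noteq> F (\<epsilon>, z, w) * w k"
    proof
      assume "G (\<epsilon>, z, w) * w l = F (\<epsilon>, z, w) * w k"
      then have "G (\<epsilon>, z, w) * (w l * w1 k) = (F (\<epsilon>, z, w) * w1 k) * w k" by (simp add: ac_simps)
      also have "\<dots> = G (\<epsilon>, z, w) * (w1 l * w k)" unfolding *[symmetric] by (simp add: ac_simps)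
      finally show False using G[OF \<epsilon>(1) p h] l by simp
    qed
    then show ?thesis using h by (simp add: P_def)
  qed
  moreover have "P (t, z', w') = 0" if c: "(z', w') \<in> milnor_cone i j" and t: "t \<in> stab z' w'" for t z' w'
  proof (cases "H (t, z', w') = 0")
    case False
    have tT: "t \<in> T" and "snd (\<phi> t (pt z' w')) = proj_class j w'" using t unfolding stab_def by blast+
    then have "w' \<in> snd (\<phi> t (pt z' w'))" using milnor_coneD(6)[OF c] by simp
    from q[OF tT c False this] G[OF tT c False] show ?thesis by (auto simp: P_def field_simps)
  qed (simp add: P_def)
  ultimately show ?thesis by blast
qed

lemma finite_stab:
  assumes p: "(z, w) \<in> milnor_cone i j"
    and free: "\<And>\<epsilon>. \<epsilon> \<in> T \<Longrightarrow> (\<And>k. k < r \<Longrightarrow> \<epsilon> k = 1 \<or> \<epsilon> k = - 1) \<Longrightarrow> \<epsilon> \<noteq> e \<Longrightarrow> \<epsilon> \<notin> stab z w"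
  shows "finite (stab z w)"
proof (rule separated_from_signs_finite)
  show ST: "stab z w \<subseteq> T" unfolding stab_def by blast
  show "e \<in> stab z w" by (rule one_in_stab[OF p])
  fix \<epsilon> assume \<epsilon>: "\<epsilon> \<in> T" "\<And>k. k < r \<Longrightarrow> \<epsilon> k = 1 \<or> \<epsilon> k = - 1" "\<epsilon> \<noteq> e"
  then have "\<epsilon> \<notin> stab z w" by (rule free)
  from separating_polynomial[OF p \<epsilon>(1) this] obtain d d' P where
    P: "bihom_poly r i j d d' P" "P (\<epsilon>, z, w) \<noteq> 0" "\<And>t. t \<in> stab z w \<Longrightarrow> P (t, z, w) = 0"
    using p by blast
  obtain M :: "(complex \<times> (nat \<Rightarrow> int)) list" where
    M: "\<And>t. (\<forall>k<r. t k \<noteq> 0) \<Longrightarrow> P (t, z, w) = (\<Sum>(c, m)\<leftarrow>M. c * torus_char r m t)"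
    using bihom_poly_expansion[OF P(1)] by blast
  show "\<exists>m m'. (\<forall>s\<in>stab z w. torus_char r m s = torus_char r m' s) \<and> torus_char r m \<epsilon> \<noteq> torus_char r m' \<epsilon>"
  proof (rule ccontr)
    assume neg: "\<not> ?thesis"
    have "(\<Sum>(c, m)\<leftarrow>M. c * torus_char r m \<epsilon>) = 0"
    proof (rule character_sum_zero[OF ST one_in_stab[OF p] stab_mult[OF p]])
      fix s assume s: "s \<in> stab z w"
      then have "\<forall>k<r. s k \<noteq> 0" using ST by auto
      from M[OF this] P(3)[OF s] show "(\<Sum>(c, m)\<leftarrow>M. c * torus_char r m s) = 0" by simp
    qed (use neg in blast)+
    moreover have "\<forall>k<r. \<epsilon> k \<noteq> 0" using \<epsilon>(1) by simp
    ultimately show False using M[of \<epsilon>] P(2) by simp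
  qed
qed

lemma stab_isolated:
  assumes "finite (stab z w)"
  shows "\<exists>\<eta>>0. \<forall>u\<in>stab z w. u \<noteq> e \<longrightarrow> (\<exists>k<r. \<eta> \<le> cmod (u k - 1))"
proof -
  have "\<exists>\<eta>>0. \<forall>u\<in>A. u \<noteq> e \<longrightarrow> (\<exists>k<r. \<eta> \<le> cmod (u k - 1))" if "finite A" "A \<subseteq> T" for A
    using that
  proof (induction A rule: finite_induct)
    case empty
    then show ?case by (intro exI[of _ 1]) simp
  next
    case (insert v A)
    then obtain \<eta> where \<eta>: "\<eta> > 0" "\<forall>u\<in>A. u \<noteq> e \<longrightarrow> (\<exists>k<r. \<eta> \<le> cmod (u k - 1))" by blast
    show ?case
    proof (cases "v = e")
      case True
      then show ?thesis using \<eta> by blast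
    next
      case False
      have "\<exists>k<r. v k \<noteq> 1"
      proof (rule ccontr)
        assume "\<not> ?thesis"
        then have "v = e" using insert.prems by (intro torus_eqI[of v r]) (auto simp: cspace_def)
        then show False using False by simp
      qed
      then obtain k where k: "k < r" "v k \<noteq> 1" by blast
      show ?thesis
      proof (intro exI[of _ "min \<eta> (cmod (v k - 1))"] conjI ballI impI)
        show "min \<eta> (cmod (v k - 1)) > 0" using \<eta>(1) k(2) by simp
        fix u assume u: "u \<in> insert v A" "u \<noteq> e"
        show "\<exists>a<r. min \<eta> (cmod (v k - 1)) \<le> cmod (u a - 1)"
        proof (cases "u = v")
          case True
          then show ?thesis using k by (intro exI[of _ k]) simp
        next
          case False
          then obtain a where "a < r" "\<eta> \<le> cmod (u a - 1)" using u \<eta>(2) by blast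
          then show ?thesis by (intro exI[of _ a]) simp
        qed
      qed
    qed
  qed
  from this[OF assms] show ?thesis unfolding stab_def by blast
qed

lemma orbit_map_local:
  assumes p: "(z, w) \<in> milnor_cone i j" and w0: "w 0 \<noteq> 0" and l: "l \<le> j"
  shows "\<exists>N f. open N \<and> e \<in> N \<and> continuous_on N f \<and>
    (\<forall>t\<in>N \<inter> T. \<forall>w'\<in>snd (\<phi> t (pt z w)). w' 0 \<noteq> 0 \<and> w' l / w' 0 = f t)"
proof -
  have "w \<in> snd (\<phi> e (pt z w))"
    using act_one[OF milnor_coneD(4)[OF p]] milnor_coneD(6)[OF p] by (simp add: snd_pt del: torus_simps)
  from local_ratio[OF one_in_T p this w0 _ l] obtain d d' d'' f H F G where
    b: "bihom_poly r i j d d' H" "bihom_poly r i j d'' f F" "bihom_poly r i j d'' f G"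
    and h: "H (e, z, w) \<noteq> 0"
    and G: "\<And>t z w. t \<in> T \<Longrightarrow> (z, w) \<in> milnor_cone i j \<Longrightarrow> H (t, z, w) \<noteq> 0 \<Longrightarrow> G (t, z, w) \<noteq> 0"
    and q: "\<And>t z w w'. t \<in> T \<Longrightarrow> (z, w) \<in> milnor_cone i j \<Longrightarrow> H (t, z, w) \<noteq> 0 \<Longrightarrow>
      w' \<in> snd (\<phi> t (pt z w)) \<Longrightarrow> w' 0 \<noteq> 0 \<and> w' l / w' 0 = F (t, z, w) / G (t, z, w)"
    by (metis zero_le)
  have c: "continuous_on UNIV (\<lambda>t. E (t, z, w))" if "bihom_poly r i j a a' E" for a a' E
    by (rule continuous_on_compose2[OF continuous_on_bihom_poly[OF that]]) (auto intro!: continuous_intros)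
  let ?N = "{t. H (t, z, w) \<noteq> 0} \<inter> {t. G (t, z, w) \<noteq> 0}"
  show ?thesis
  proof (intro exI conjI)
    show "open ?N" by (intro open_Int open_Collect_neq c[OF b(1)] c[OF b(3)] continuous_on_const)
    show "e \<in> ?N" using h G[OF one_in_T p h] by simp
    show "continuous_on ?N (\<lambda>t. F (t, z, w) / G (t, z, w))"
      by (intro continuous_on_divide continuous_on_subset[OF c[OF b(2)]] continuous_on_subset[OF c[OF b(3)]]) auto
    show "\<forall>t\<in>?N \<inter> T. \<forall>w'\<in>snd (\<phi> t (pt z w)). w' 0 \<noteq> 0 \<and> w' l / w' 0 = F (t, z, w) / G (t, z, w)"
      using q p by blast
  qed
qed

text \<open>
  Two elements near 1 with the same image of \<open>([z], [w])\<close> differ by an element of the stabiliser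
  near 1, so they are equal because the stabiliser is finite. Hence the affine coordinates
  \<open>w\<^sub>l / w\<^sub>0\<close> of the orbit map give an injection of a neighbourhood of 1 into \<open>\<complex>\<^sup>j\<close>.
\<close>

lemma dim_le_of_finite_stab:
  assumes p: "(z, w) \<in> milnor_cone i j" and w0: "w 0 \<noteq> 0" and fin: "finite (stab z w)"
  shows "r \<le> j"
proof -
  have "\<forall>l\<in>{..j}. \<exists>N f. open N \<and> e \<in> N \<and> continuous_on N f \<and>
    (\<forall>t\<in>N \<inter> T. \<forall>w'\<in>snd (\<phi> t (pt z w)). w' 0 \<noteq> 0 \<and> w' l / w' 0 = f t)"
    using orbit_map_local[OF p w0] by simp
  from bchoice[OF this] obtain N0 where N0: "\<forall>l\<in>{..j}. \<exists>f. open (N0 l) \<and> e \<in> N0 l \<and> continuous_on (N0 l) f \<and>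
    (\<forall>t\<in>N0 l \<inter> T. \<forall>w'\<in>snd (\<phi> t (pt z w)). w' 0 \<noteq> 0 \<and> w' l / w' 0 = f t)" by blast
  from bchoice[OF this] obtain f where f: "\<forall>l\<in>{..j}. open (N0 l) \<and> e \<in> N0 l \<and> continuous_on (N0 l) (f l) \<and>
    (\<forall>t\<in>N0 l \<inter> T. \<forall>w'\<in>snd (\<phi> t (pt z w)). w' 0 \<noteq> 0 \<and> w' l / w' 0 = f l t)" by blast
  obtain \<eta> where \<eta>: "\<eta> > 0" "\<And>u. u \<in> stab z w \<Longrightarrow> u \<noteq> e \<Longrightarrow> \<exists>k<r. \<eta> \<le> cmod (u k - 1)"
    using stab_isolated[OF fin] by blast
  define \<delta> where "\<delta> = min (1 / 2) (\<eta> / 4)"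
  have \<delta>: "\<delta> > 0" "\<delta> \<le> 1 / 2" "4 * \<delta> \<le> \<eta>" using \<eta>(1) by (auto simp: \<delta>_def)
  \<comment> \<open>If \<open>s\<close> and \<open>t\<close> are within \<open>\<delta> \<le> 1/2\<close> of 1, then \<open>t / s\<close> is within \<open>4 \<delta> \<le> \<eta>\<close> of 1 in each coordinate.\<close>
  define N where "N = (\<Inter>l\<in>{..j}. N0 l) \<inter> (\<Inter>k\<in>{..<r}. {t. cmod (t k - 1) < \<delta>})"
  show ?thesis
  proof (rule no_injection_into_smaller_dimension[of N r j "\<lambda>l. f (Suc l)"])
    have "open {t :: Defs.vec. cmod (t k - 1) < \<delta>}" for k
      by (intro open_Collect_less continuous_on_norm continuous_on_diff continuous_coord continuous_on_const)
    then show "open N" unfolding N_def using f by (intro open_Int open_INT) auto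
    show "e \<in> N" unfolding N_def using f \<delta>(1) by (auto simp del: torus_simps(1))
    show "continuous_on N (f (Suc l))" if "l < j" for l
    proof -
      have "continuous_on (N0 (Suc l)) (f (Suc l))" using f that by simp
      then show ?thesis by (rule continuous_on_subset) (use that in \<open>auto simp: N_def\<close>)
    qed
    fix s t assume s: "s \<in> N \<inter> T" and t: "t \<in> N \<inter> T" and eq: "\<And>l. l < j \<Longrightarrow> f (Suc l) s = f (Suc l) t"
    obtain z1 w1 where 1: "(z1, w1) \<in> milnor_cone i j" "\<phi> s (pt z w) = pt z1 w1"
      using act_class[OF p] s by blast
    obtain z2 w2 where 2: "(z2, w2) \<in> milnor_cone i j" "\<phi> t (pt z w) = pt z2 w2"
      using act_class[OF p] t by blast
    have m: "w1 \<in> snd (\<phi> s (pt z w))" "w2 \<in> snd (\<phi> t (pt z w))"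
      unfolding 1(2) 2(2) snd_pt using milnor_coneD(6) 1(1) 2(1) by blast+
    have r1: "w1 0 \<noteq> 0 \<and> w1 l / w1 0 = f l s" if "l \<le> j" for l
      using f s m(1) that by (auto simp: N_def simp del: torus_simps)
    have r2: "w2 0 \<noteq> 0 \<and> w2 l / w2 0 = f l t" if "l \<le> j" for l
      using f t m(2) that by (auto simp: N_def simp del: torus_simps)
    have "proj_class j w1 = proj_class j w2"
    proof (rule proj_class_eqI[OF milnor_coneD(2)[OF 1(1)] milnor_coneD(2)[OF 2(1)]])
      show "w2 0 \<noteq> 0" using r2 by blast
      fix l show "w1 l * w2 0 = w2 l * w1 0"
      proof (cases "l \<le> j")
        case True
        show ?thesis
        proof (cases l)
          case (Suc l')
          then have "w1 l / w1 0 = w2 l / w2 0" using r1[OF True] r2[OF True] eq[of l'] True by simp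
          then show ?thesis using r1[of 0] r2[of 0] by (simp add: field_simps)
        qed simp
      next
        case False
        then have "w1 l = 0" "w2 l = 0"
          using milnor_coneD(2)[OF 1(1)] milnor_coneD(2)[OF 2(1)] by (auto simp: nonzero_vecs_def cspace_def)
        then show ?thesis by simp
      qed
    qed
    then have "snd (\<phi> s (pt z w)) = snd (\<phi> t (pt z w))" unfolding 1(2) 2(2) snd_pt .
    then have u: "(\<lambda>k. inverse (s k) * t k) \<in> stab z w" (is "?u \<in> _")
      using quotient_in_stab[OF p] s t by blast
    have nz: "s k \<noteq> 0" if "k < r" for k using s that by simp
    have "?u = e"
    proof (rule ccontr)
      assume "?u \<noteq> e"
      then obtain k where k: "k < r" "\<eta> \<le> cmod (inverse (s k) * t k - 1)" using \<eta>(2)[OF u] by blast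
      have d: "cmod (s k - 1) < \<delta>" "cmod (t k - 1) < \<delta>" using s t k(1) by (auto simp: N_def)
      have "1 \<le> cmod (s k) + cmod (s k - 1)"
        using norm_triangle_ineq4[of "s k" "s k - 1"] by simp
      then have sk: "1 / 2 < cmod (s k)" using d(1) \<delta>(2) by linarith
      have "cmod (t k - s k) < 2 * \<delta>"
        using norm_triangle_ineq4[of "t k - 1" "s k - 1"] d by simp
      moreover have "(inverse (s k) * t k - 1) * s k = t k - s k"
        using nz[OF k(1)] by (simp add: field_simps)
      then have "cmod (inverse (s k) * t k - 1) * cmod (s k) = cmod (t k - s k)"
        by (metis norm_mult)
      moreover have "\<eta> * (1 / 2) \<le> cmod (inverse (s k) * t k - 1) * cmod (s k)"
        using k(2) sk \<eta>(1) by (intro mult_mono) auto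
      ultimately show False using \<delta>(3) by linarith
    qed
    then have "inverse (s k) * t k = 1" if "k < r" for k using fun_cong[of ?u e k] that by simp
    then have "s k = t k" if "k < r" for k using nz[OF that] that by (simp add: field_simps)
    then show "s = t" using s t by (intro torus_eqI[of s r t]) auto
  qed
qed

text \<open>
  By irreducibility there is a point in the chart \<open>w\<^sub>0 \<noteq> 0\<close> whose image in \<open>\<P>\<^sup>j\<close> is moved by all
  \<open>\<epsilon> \<noteq> 1\<close> in \<open>{1, -1}\<^sup>r\<close>; its stabiliser is finite.
\<close>

lemma dim_le_if_effective_on_projection:
  assumes i: "1 \<le> i" and ij: "i \<le> j"
    and eff: "\<And>t. t \<in> T \<Longrightarrow> (\<And>z w. (z, w) \<in> milnor_cone i j \<Longrightarrow> t \<in> stab z w) \<Longrightarrow> t = e"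
  shows "r \<le> j"
proof -
  define E where "E = {\<epsilon> \<in> T. (\<forall>k<r. \<epsilon> k = 1 \<or> \<epsilon> k = - 1) \<and> \<epsilon> \<noteq> e}"
  have finE: "finite E"
  proof -
    have "finite (Pi\<^sub>E {..<r} (\<lambda>_. {1, - 1 :: complex}))" by (intro finite_PiE) auto
    moreover have "(\<lambda>s. restrict s {..<r}) ` E \<subseteq> Pi\<^sub>E {..<r} (\<lambda>_. {1, - 1 :: complex})"
      by (intro image_subsetI, rule PiE_I) (auto simp: E_def)
    moreover have "inj_on (\<lambda>s. restrict s {..<r}) E"
    proof (rule inj_onI)
      fix s t assume st: "s \<in> E" "t \<in> E" "restrict s {..<r} = restrict t {..<r}"
      have "s k = t k" if "k < r" for k
      proof -
        have "restrict s {..<r} k = restrict t {..<r} k" by (rule fun_cong[OF st(3)])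
        then show ?thesis using that by simp
      qed
      then show "s = t" using st(1,2) unfolding E_def by (intro torus_eqI[of s r t]) auto
    qed
    ultimately show ?thesis using finite_imageD finite_subset by blast
  qed
  have "\<forall>\<epsilon>\<in>E. \<exists>P. (\<exists>d d'. bihom_poly r i j d d' P) \<and> (\<exists>(z, w)\<in>milnor_cone i j. P (\<epsilon>, z, w) \<noteq> 0) \<and>
    (\<forall>z w. (z, w) \<in> milnor_cone i j \<longrightarrow> \<epsilon> \<in> stab z w \<longrightarrow> P (\<epsilon>, z, w) = 0)"
  proof
    fix \<epsilon> assume \<epsilon>: "\<epsilon> \<in> E"
    then obtain z w where p: "(z, w) \<in> milnor_cone i j" "\<epsilon> \<notin> stab z w"
      using eff[of \<epsilon>] unfolding E_def by blast
    have "\<epsilon> \<in> T" using \<epsilon> by (simp add: E_def)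
    from separating_polynomial[OF p(1) this p(2)] p(1)
    show "\<exists>P. (\<exists>d d'. bihom_poly r i j d d' P) \<and> (\<exists>(z, w)\<in>milnor_cone i j. P (\<epsilon>, z, w) \<noteq> 0) \<and>
      (\<forall>z w. (z, w) \<in> milnor_cone i j \<longrightarrow> \<epsilon> \<in> stab z w \<longrightarrow> P (\<epsilon>, z, w) = 0)"
      by blast
  qed
  from bchoice[OF this] obtain P where P: "\<forall>\<epsilon>\<in>E. (\<exists>d d'. bihom_poly r i j d d' (P \<epsilon>)) \<and>
    (\<exists>(z, w)\<in>milnor_cone i j. P \<epsilon> (\<epsilon>, z, w) \<noteq> 0) \<and>
    (\<forall>z w. (z, w) \<in> milnor_cone i j \<longrightarrow> \<epsilon> \<in> stab z w \<longrightarrow> P \<epsilon> (\<epsilon>, z, w) = 0)" by blast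
  define A where "A = insert (\<lambda>p. snd p 0) ((\<lambda>\<epsilon> (z, w). P \<epsilon> (\<epsilon>, z, w)) ` E)"
  define z1 :: Defs.vec where "z1 k = (if k = 1 then 1 else 0)" for k
  define w1 :: Defs.vec where "w1 k = (if k = 0 then 1 else 0)" for k
  have "(\<Sum>k\<le>min i j. z1 k * w1 k) = 0" by (intro sum.neutral) (auto simp: z1_def w1_def)
  moreover have "z1 1 = 1" "w1 0 = 1" by (auto simp: z1_def w1_def)
  then have "z1 \<noteq> (\<lambda>_. 0)" "w1 \<noteq> (\<lambda>_. 0)" by auto
  ultimately have c1: "(z1, w1) \<in> milnor_cone i j"
    using i by (auto simp: milnor_cone_def nonzero_vecs_def cspace_def z1_def w1_def)
  have "\<exists>p\<in>milnor_cone i j. \<forall>f\<in>A. f p \<noteq> 0"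
  proof (rule milnor_cone_irreducible[OF i ij])
    show "finite A" using finE by (simp add: A_def)
    show "milnor_cone i j \<noteq> {}" using c1 by blast
    show "poly_on_curves f" if "f \<in> A" for f
      using that P poly_on_curves_bihom poly_on_curves_coord(2) unfolding A_def by blast
    show "\<exists>p\<in>milnor_cone i j. f p \<noteq> 0" if f: "f \<in> A" for f
    proof (cases "f = (\<lambda>p. snd p 0)")
      case True
      then show ?thesis using c1 by (intro bexI[of _ "(z1, w1)"]) (simp_all add: w1_def)
    next
      case False
      then obtain \<epsilon> where "\<epsilon> \<in> E" "f = (\<lambda>(z, w). P \<epsilon> (\<epsilon>, z, w))" using f unfolding A_def by blast
      moreover then obtain z w where "(z, w) \<in> milnor_cone i j" "P \<epsilon> (\<epsilon>, z, w) \<noteq> 0" using P by blast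
      ultimately show ?thesis by (intro bexI[of _ "(z, w)"]) simp_all
    qed
  qed
  then obtain z w where p: "(z, w) \<in> milnor_cone i j" and A: "\<forall>f\<in>A. f (z, w) \<noteq> 0" by auto
  have w0: "w 0 \<noteq> 0" using A unfolding A_def by simp
  have "\<epsilon> \<notin> stab z w" if "\<epsilon> \<in> E" for \<epsilon>
  proof
    assume "\<epsilon> \<in> stab z w"
    then have "P \<epsilon> (\<epsilon>, z, w) = 0" using P that p by blast
    moreover have "(\<lambda>(z, w). P \<epsilon> (\<epsilon>, z, w)) \<in> A" using that unfolding A_def by blast
    then have "(\<lambda>(z, w). P \<epsilon> (\<epsilon>, z, w)) (z, w) \<noteq> 0" using A by blast
    ultimately show False by simp
  qed
  then have "finite (stab z w)"
    using finite_stab[OF p] unfolding E_def by blast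
  then show ?thesis by (rule dim_le_of_finite_stab[OF p w0])
qed

text \<open>
  The vectors \<open>u = z\<^sub>a e\<^sub>b - z\<^sub>b e\<^sub>a\<close> are orthogonal to \<open>z\<close>, and they are vectors of \<open>\<complex>\<^sup>j\<^sup>+\<^sup>1\<close> because
  \<open>i \<le> j\<close>. The image of \<open>([z], [u])\<close> is \<open>([z\<^sub>1], [u])\<close> with the same \<open>z\<^sub>1\<close> for all \<open>u\<close>, so \<open>z\<^sub>1\<close> is orthogonal
  to all these \<open>u\<close>, which says that it is proportional to \<open>z\<close>.
\<close>

lemma trivial_if_trivial_on_projection:
  assumes i: "1 \<le> i" and ij: "i \<le> j" and t: "t \<in> T"
    and base: "\<And>x y. x \<in> X \<Longrightarrow> y \<in> X \<Longrightarrow> fst x = fst y \<Longrightarrow> fst (\<phi> t x) = fst (\<phi> t y)"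
    and triv: "\<And>z w. (z, w) \<in> milnor_cone i j \<Longrightarrow> t \<in> stab z w" and x: "x \<in> X"
  shows "\<phi> t x = x"
proof -
  obtain z w where p: "(z, w) \<in> milnor_cone i j" "x = pt z w" by (rule milnor_hypersurface_cases[OF x])
  obtain z1 w1 where 1: "(z1, w1) \<in> milnor_cone i j" "\<phi> t x = pt z1 w1"
    using act_class[OF p(1) t] p(2) by blast
  have z: "z \<in> nonzero_vecs i" and z1: "z1 \<in> nonzero_vecs i" using milnor_coneD(1) p(1) 1(1) by blast+
  obtain a where a: "a \<le> i" "z a \<noteq> 0" using nonzero_vecs_coord[OF z] by blast
  have "z1 b * z a = z b * z1 a" for b
  proof (cases "b \<le> i \<and> b \<noteq> a")
    case True
    define u :: Defs.vec where "u k = (if k = b then z a else if k = a then - z b else 0)" for k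
    have dot: "(\<Sum>k\<le>min i j. v k * u k) = v b * z a - v a * z b" for v :: Defs.vec
    proof -
      have "(\<Sum>k\<le>min i j. v k * u k) = (\<Sum>k\<in>{a, b}. v k * u k)"
        using a True ij by (intro sum.mono_neutral_right) (auto simp: u_def)
      then show ?thesis using True by (simp add: u_def)
    qed
    have "u b \<noteq> 0" using a by (simp add: u_def)
    then have "u \<noteq> (\<lambda>_. 0)" by metis
    then have u: "u \<in> nonzero_vecs j"
      using a True ij by (auto simp: nonzero_vecs_def cspace_def u_def)
    have zu: "(z, u) \<in> milnor_cone i j" using dot[of z] z u by (simp add: milnor_cone_def)
    have "fst (\<phi> t (pt z u)) = fst (\<phi> t x)"
      by (rule base[OF milnor_coneD(4)[OF zu] x]) (simp add: p(2) biproj_point_def)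
    moreover have "snd (\<phi> t (pt z u)) = proj_class j u" using triv[OF zu] unfolding stab_def by blast
    ultimately have "\<phi> t (pt z u) = pt z1 u" unfolding 1(2) by (simp add: biproj_point_def prod_eq_iff)
    then have "pt z1 u \<in> X" using act_in[OF t milnor_coneD(4)[OF zu]] by simp
    then have "(z1, u) \<in> milnor_cone i j" using biproj_point_mem_iff[OF z1 u] by simp
    then have "z1 b * z a - z1 a * z b = 0" unfolding dot[symmetric] by (rule milnor_coneD(3))
    then show ?thesis by (simp add: mult.commute)
  next
    case False
    then show ?thesis using z z1 by (auto simp: nonzero_vecs_def cspace_def)
  qed
  then have "proj_class i z1 = proj_class i z" by (intro proj_class_eqI[OF z1 z a(2)])
  moreover have "proj_class j w1 = proj_class j w"
    using triv[OF p(1)] 1(2) unfolding stab_def p(2) by (simp add: snd_pt)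
  ultimately show ?thesis unfolding 1(2) by (simp add: p(2) biproj_point_def)
qed

end

section \<open>Exchanging the two factors\<close>

lemma swap_milnor:
  assumes "x \<in> milnor_hypersurface i j"
  shows "prod.swap x \<in> milnor_hypersurface j i"
proof -
  have "(\<Sum>k\<le>min j i. z k * w k) = 0" if "z \<in> snd x" "w \<in> fst x" for z w :: Defs.vec
  proof -
    have "(\<Sum>k\<le>min i j. w k * z k) = 0"
      using assms that by (auto simp: milnor_hypersurface_def)
    then show ?thesis by (simp only: min.commute[of j i] mult.commute[of "z _"])
  qed
  then show ?thesis using assms by (auto simp: milnor_hypersurface_def)
qed

lemma bihom_poly_swap:
  assumes "bihom_poly r j i d e F"
  shows "bihom_poly r i j e d (\<lambda>v. F (fst v, snd (snd v), fst (snd v)))"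
proof -
  have "bihom_poly r i j 0 0 (\<lambda>v. fst v k)" if "k < r" for k
    using bihom_poly.var_t[OF that, of i j] by (simp add: case_prod_unfold)
  moreover have "bihom_poly r i j 1 0 (\<lambda>v. fst (snd v) k)" if "k \<le> i" for k
    using bihom_poly.var_z[OF that, of r j] by (simp add: case_prod_unfold)
  moreover have "bihom_poly r i j 0 1 (\<lambda>v. snd (snd v) k)" if "k \<le> j" for k
    using bihom_poly.var_w[OF that, of r i] by (simp add: case_prod_unfold)
  ultimately show ?thesis
    using bihom_poly_subst[OF assms, of r i j "\<lambda>v. fst v" 0 1 "\<lambda>v. snd (snd v)" 1 0 "\<lambda>v. fst (snd v)"] by simp
qed

lemma swap_morphism:
  "variety_morphism (biproj_variety i j (milnor_hypersurface i j))
     (biproj_variety j i (milnor_hypersurface j i)) prod.swap"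
  unfolding biproj_variety_def
proof (rule variety_morphism_subst[where \<sigma> = "\<lambda>v. (fst v, snd (snd v), fst (snd v))" and D = "\<lambda>d e. e" and E = "\<lambda>d e. d"])
  show "homogeneous_coords (\<lambda>(P, Q). {\<lambda>_. 0} \<times> P \<times> Q) (milnor_hypersurface j i)"
    by (rule homogeneous_coords_biproj[OF milnor_subset])
  fix x :: "Defs.vec set \<times> Defs.vec set" assume x: "x \<in> milnor_hypersurface i j"
  show "(case x of (P, Q) \<Rightarrow> {(\<lambda>_. 0) :: Defs.vec} \<times> P \<times> Q) \<noteq> {}"
    by (rule homogeneous_coords_nonempty[OF homogeneous_coords_biproj[OF milnor_subset] x])
  show "prod.swap x \<in> milnor_hypersurface j i" by (rule swap_milnor[OF x])
  fix v :: "Defs.vec \<times> Defs.vec \<times> Defs.vec" assume "v \<in> (case x of (P, Q) \<Rightarrow> {\<lambda>_. 0} \<times> P \<times> Q)"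
  then show "(fst v, snd (snd v), fst (snd v)) \<in> (case prod.swap x of (P, Q) \<Rightarrow> {\<lambda>_. 0} \<times> P \<times> Q)"
    by (cases x) auto
qed (rule bihom_poly_swap)

lemma torus_swap_morphism:
  "variety_morphism (torus_times_variety r i j (milnor_hypersurface i j))
     (torus_times_variety r j i (milnor_hypersurface j i)) (\<lambda>(t, x). (t, prod.swap x))"
  unfolding torus_times_variety_def
proof (rule variety_morphism_subst[where \<sigma> = "\<lambda>v. (fst v, snd (snd v), fst (snd v))" and D = "\<lambda>d e. e" and E = "\<lambda>d e. d"])
  show "homogeneous_coords (\<lambda>(t, P, Q). {t} \<times> P \<times> Q) (carrier (torus r) \<times> milnor_hypersurface j i)"
    by (rule homogeneous_coords_torus_times[OF milnor_subset])
  fix x :: "Defs.vec \<times> Defs.vec set \<times> Defs.vec set"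
  assume x: "x \<in> carrier (torus r) \<times> milnor_hypersurface i j"
  show "(case x of (t, P, Q) \<Rightarrow> {t} \<times> P \<times> Q) \<noteq> {}"
    by (rule homogeneous_coords_nonempty[OF homogeneous_coords_torus_times[OF milnor_subset] x])
  obtain t P Q where tx: "x = (t, P, Q)" by (metis prod_cases3)
  show "(\<lambda>(t, x). (t, prod.swap x)) x \<in> carrier (torus r) \<times> milnor_hypersurface j i"
    using x swap_milnor[of "(P, Q)" i j] unfolding tx by (simp del: torus_simps)
  fix v assume "v \<in> (case x of (t, P, Q) \<Rightarrow> {t} \<times> P \<times> Q)"
  then show "(fst v, snd (snd v), fst (snd v))
      \<in> (case (\<lambda>(t, x). (t, prod.swap x)) x of (t, P, Q) \<Rightarrow> {t} \<times> P \<times> Q)"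
    unfolding tx by auto
qed (rule bihom_poly_swap)

definition swap_action where
  "swap_action X \<phi> t = restrict (\<lambda>x. prod.swap (\<phi> t (prod.swap x))) X"

lemma swap_algebraic_action:
  assumes "algebraic_torus_action r i j (milnor_hypersurface i j) \<phi>"
  shows "algebraic_torus_action r j i (milnor_hypersurface j i) (swap_action (milnor_hypersurface j i) \<phi>)"
proof -
  interpret milnor_torus_action r i j \<phi> by unfold_locales fact
  let ?Y = "milnor_hypersurface j i"
  let ?\<psi> = "swap_action ?Y \<phi>"
  have "group_action (torus r) ?Y ?\<psi>"
  proof (rule group_actionI[OF torus_group])
    show "?\<psi> t x \<in> ?Y" if "t \<in> T" "x \<in> ?Y" for t x
      using swap_milnor[OF act_in[OF that(1) swap_milnor[OF that(2)]]] that by (simp add: swap_action_def)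
    show "?\<psi> e x = x" if "x \<in> ?Y" for x
      using act_one[OF swap_milnor[OF that]] that by (simp add: swap_action_def del: torus_simps)
    show "?\<psi> (s \<otimes>\<^bsub>torus r\<^esub> t) x = ?\<psi> s (?\<psi> t x)" if st: "s \<in> T" "t \<in> T" and x: "x \<in> ?Y" for s t x
      using act_mult[OF st swap_milnor[OF x]] swap_milnor[OF act_in[OF st(2) swap_milnor[OF x]]] x
      by (simp add: swap_action_def)
  qed (auto simp: swap_action_def)
  moreover have "variety_automorphism (biproj_variety j i ?Y) (?\<psi> t)" if t: "t \<in> T" for t
  proof -
    obtain g where f: "variety_morphism (biproj_variety i j X) (biproj_variety i j X) (\<phi> t)"
      and g: "variety_morphism (biproj_variety i j X) (biproj_variety i j X) g"
      and inv: "\<And>x. x \<in> X \<Longrightarrow> g (\<phi> t x) = x \<and> \<phi> t (g x) = x"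
      using action t unfolding algebraic_torus_action_def variety_automorphism_def by auto
    have conj: "variety_morphism (biproj_variety j i ?Y) (biproj_variety j i ?Y) (prod.swap \<circ> (h \<circ> prod.swap))"
      if "variety_morphism (biproj_variety i j X) (biproj_variety i j X) h" for h
      by (rule variety_morphism_compose[OF variety_morphism_compose[OF swap_morphism that] swap_morphism])
    have "variety_morphism (biproj_variety j i ?Y) (biproj_variety j i ?Y) (?\<psi> t)"
      using conj[OF f] unfolding biproj_variety_def
      by (rule variety_morphism_cong) (simp add: swap_action_def)
    moreover have gX: "g x \<in> X" if "x \<in> X" for x
      using g that continuous_map_image_subset_topspace[of "zariski (biproj_variety i j X)" "zariski (biproj_variety i j X)" g]
      unfolding variety_morphism_def by auto
    have "(prod.swap \<circ> (g \<circ> prod.swap)) (?\<psi> t x) = x \<and> ?\<psi> t ((prod.swap \<circ> (g \<circ> prod.swap)) x) = x"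
      if x: "x \<in> ?Y" for x
      using inv[OF swap_milnor[OF x]] swap_milnor[OF gX[OF swap_milnor[OF x]]] x
      by (simp add: swap_action_def)
    ultimately show ?thesis
      using conj[OF g] unfolding variety_automorphism_def topspace_biproj by blast
  qed
  moreover have "variety_morphism (torus_times_variety r j i ?Y) (biproj_variety j i ?Y) (\<lambda>(t, x). ?\<psi> t x)"
  proof -
    have "variety_morphism (torus_times_variety r i j X) (biproj_variety i j X) (\<lambda>(t, x). \<phi> t x)"
      using action unfolding algebraic_torus_action_def by blast
    from variety_morphism_compose[OF variety_morphism_compose[OF torus_swap_morphism this] swap_morphism]
    show ?thesis unfolding torus_times_variety_def
      by (rule variety_morphism_cong) (auto simp: swap_action_def)
  qed
  ultimately show ?thesis unfolding algebraic_torus_action_def by blast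
qed

lemma swap_effective_action:
  assumes eff: "effective_torus_action r i j (milnor_hypersurface i j) \<phi>"
  shows "effective_torus_action r j i (milnor_hypersurface j i) (swap_action (milnor_hypersurface j i) \<phi>)"
  unfolding effective_torus_action_def
proof (intro conjI ballI impI)
  show "algebraic_torus_action r j i (milnor_hypersurface j i) (swap_action (milnor_hypersurface j i) \<phi>)"
    using eff swap_algebraic_action unfolding effective_torus_action_def by blast
  fix t assume t: "t \<in> carrier (torus r)"
    and triv: "\<forall>x\<in>milnor_hypersurface j i. swap_action (milnor_hypersurface j i) \<phi> t x = x"
  have "\<phi> t x = x" if x: "x \<in> milnor_hypersurface i j" for x
  proof -
    have "prod.swap (\<phi> t x) = prod.swap x"
      using bspec[OF triv swap_milnor[OF x]] swap_milnor[OF x] by (simp add: swap_action_def)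
    then show ?thesis by (metis swap_swap)
  qed
  then show "t = \<one>\<^bsub>torus r\<^esub>" using eff t unfolding effective_torus_action_def by blast
qed

lemma swap_is_largest:
  assumes "is_largest_torus_action_dim j i (milnor_hypersurface j i) m"
  shows "is_largest_torus_action_dim i j (milnor_hypersurface i j) m"
  using assms swap_effective_action unfolding is_largest_torus_action_dim_def by blast

text \<open>
  The exchanged action preserves the fibres of its second projection, which is the first projection
  of the original action; so the action descends to both factors.
\<close>

lemma effective_torus_action_dim_le:
  assumes i: "1 \<le> i" and ij: "i \<le> j"
    and eff: "effective_torus_action r i j (milnor_hypersurface i j) \<phi>"
  shows "r \<le> j"
proof -
  have alg: "algebraic_torus_action r i j (milnor_hypersurface i j) \<phi>"
    using eff unfolding effective_torus_action_def by blast
  interpret milnor_torus_action r i j \<phi> by unfold_locales (rule alg)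
  let ?Y = "milnor_hypersurface j i"
  interpret swapped: milnor_torus_action r j i "swap_action ?Y \<phi>"
    by unfold_locales (rule swap_algebraic_action[OF alg])
  have base: "fst (\<phi> t x) = fst (\<phi> t y)"
    if "t \<in> T" "x \<in> X" "y \<in> X" "fst x = fst y" for t x y
    using swapped.fibre_preservingD[of t "prod.swap x" "prod.swap y"] that swap_milnor
    by (simp add: swap_action_def del: torus_simps)
  show ?thesis
  proof (rule dim_le_if_effective_on_projection[OF i ij])
    fix t assume t: "t \<in> T" and triv: "\<And>z w. (z, w) \<in> milnor_cone i j \<Longrightarrow> t \<in> stab z w"
    have "\<phi> t x = x" if "x \<in> X" for x
      by (rule trivial_if_trivial_on_projection[OF i ij t base[OF t] triv that])
    then show "t = e" using eff t unfolding effective_torus_action_def by blast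
  qed
qed

section \<open>An action of the largest dimension\<close>

definition scale_z :: "Defs.vec \<Rightarrow> Defs.vec \<Rightarrow> Defs.vec" where
  "scale_z t z k = (if k = 0 then z 0 else t (k - 1) * z k)"

text \<open>
  This is \<open>w\<^sub>k \<mapsto> t\<^sub>k\<inverse> w\<^sub>k\<close> (with the parameters numbered from 0, and \<open>w\<^sub>0\<close> fixed), multiplied by the
  product of all parameters: the same map of \<open>\<P>\<^sup>j\<close>, but polynomial in \<open>t\<close>.
\<close>

definition scale_w :: "nat \<Rightarrow> Defs.vec \<Rightarrow> Defs.vec \<Rightarrow> Defs.vec" where
  "scale_w j t w k = (\<Prod>l\<in>{..<j} - (if k = 0 then {} else {k - 1}). t l) * w k"

lemma scale_zw:
  assumes "k \<le> j"
  shows "scale_z t z k * scale_w j t w k = (\<Prod>l<j. t l) * (z k * w k)"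
proof (cases "k = 0")
  case False
  then have "(\<Prod>l<j. t l) = t (k - 1) * (\<Prod>l\<in>{..<j} - {k - 1}. t l)"
    using assms by (intro prod.remove) auto
  then show ?thesis using False by (simp add: scale_z_def scale_w_def)
qed (simp add: scale_z_def scale_w_def)

lemma scale_cone:
  assumes ij: "i \<le> j" and t: "t \<in> carrier (torus j)" and p: "(z, w) \<in> milnor_cone i j"
  shows "(scale_z t z, scale_w j t w) \<in> milnor_cone i j"
proof -
  have tk: "t l \<noteq> 0" if "l < j" for l using t that by simp
  obtain a where a: "a \<le> i" "z a \<noteq> 0" using nonzero_vecs_coord[OF milnor_coneD(1)[OF p]] by blast
  obtain b where b: "b \<le> j" "w b \<noteq> 0" using nonzero_vecs_coord[OF milnor_coneD(2)[OF p]] by blast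
  have "scale_z t z a \<noteq> 0" using a ij tk[of "a - 1"] by (auto simp: scale_z_def)
  moreover have "scale_w j t w b \<noteq> 0" using b tk by (auto simp: scale_w_def)
  moreover have "scale_z t z \<in> cspace (Suc i)" "scale_w j t w \<in> cspace (Suc j)"
    using milnor_coneD(1,2)[OF p] by (auto simp: scale_z_def scale_w_def cspace_def nonzero_vecs_def)
  ultimately have "scale_z t z \<in> nonzero_vecs i" "scale_w j t w \<in> nonzero_vecs j"
    unfolding nonzero_vecs_def by auto
  moreover have "(\<Sum>k\<le>min i j. scale_z t z k * scale_w j t w k) = (\<Prod>l<j. t l) * (\<Sum>k\<le>min i j. z k * w k)"
    unfolding sum_distrib_left by (intro sum.cong) (use ij in \<open>auto simp: scale_zw\<close>)
  ultimately show ?thesis using milnor_coneD(3)[OF p] by (simp add: milnor_cone_def)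
qed

text \<open>
  The choice of representatives is immaterial by \<open>standard_action_point\<close>. The restriction makes the
  map extensional, as a permutation of a carrier set has to be.
\<close>

definition standard_action :: "nat \<Rightarrow> nat \<Rightarrow> Defs.vec \<Rightarrow> Defs.vec set \<times> Defs.vec set \<Rightarrow> Defs.vec set \<times> Defs.vec set" where
  "standard_action i j t = restrict
     (\<lambda>(P, Q). biproj_point i j (scale_z t (SOME z. z \<in> P)) (scale_w j t (SOME w. w \<in> Q))) (milnor_hypersurface i j)"

lemma standard_action_point:
  assumes ij: "i \<le> j" and t: "t \<in> carrier (torus j)" and p: "(z, w) \<in> milnor_cone i j"
  shows "standard_action i j t (biproj_point i j z w) = biproj_point i j (scale_z t z) (scale_w j t w)"
proof -
  have "(SOME u. u \<in> proj_class i z) \<in> proj_class i z" "(SOME u. u \<in> proj_class j w) \<in> proj_class j w"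
    using milnor_coneD(5,6)[OF p] by (metis someI_ex)+
  then obtain a b where ab: "a \<noteq> 0" "(SOME u. u \<in> proj_class i z) = (\<lambda>k. a * z k)"
    "b \<noteq> 0" "(SOME u. u \<in> proj_class j w) = (\<lambda>k. b * w k)"
    using mem_proj_class milnor_coneD(1,2)[OF p] by metis
  have "scale_z t (\<lambda>k. a * z k) = (\<lambda>k. a * scale_z t z k)" "scale_w j t (\<lambda>k. b * w k) = (\<lambda>k. b * scale_w j t w k)"
    by (auto simp: scale_z_def scale_w_def)
  then show ?thesis
    using milnor_coneD(4)[OF p] milnor_cone_scale(2)[OF scale_cone[OF ij t p] ab(1,3)] ab(2,4)
    by (simp add: standard_action_def biproj_point_def)
qed

lemma scale_z_poly:
  assumes "k \<le> i" "i \<le> j"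
  shows "bihom_poly j i j' 1 0 (\<lambda>v. scale_z (fst v) (fst (snd v)) k)"
    and "bihom_poly 0 i j' 1 0 (\<lambda>v. scale_z t (fst (snd v)) k)"
proof -
  have z: "bihom_poly r i j' 1 0 (\<lambda>v. fst (snd v) k)" for r
    using bihom_poly.var_z[OF assms(1), of r j'] by (simp add: case_prod_unfold)
  show "bihom_poly j i j' 1 0 (\<lambda>v. scale_z (fst v) (fst (snd v)) k)"
  proof (cases "k = 0")
    case False
    then have "bihom_poly j i j' 0 0 (\<lambda>v. fst v (k - 1))"
      using bihom_poly.var_t[of "k - 1" j i j'] assms by (simp add: case_prod_unfold)
    from bihom_poly.mult[OF this z] False show ?thesis by (simp add: scale_z_def)
  qed (use z in \<open>simp add: scale_z_def\<close>)
  show "bihom_poly 0 i j' 1 0 (\<lambda>v. scale_z t (fst (snd v)) k)"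
    using z bihom_poly_cmult[OF z, where c = "t (k - 1)"] by (cases "k = 0") (simp_all add: scale_z_def)
qed

lemma scale_w_poly:
  assumes "k \<le> j"
  shows "bihom_poly j i j 0 1 (\<lambda>v. scale_w j (fst v) (snd (snd v)) k)"
    and "bihom_poly 0 i j 0 1 (\<lambda>v. scale_w j t (snd (snd v)) k)"
proof -
  have w: "bihom_poly r i j 0 1 (\<lambda>v. snd (snd v) k)" for r
    using bihom_poly.var_w[OF assms, of r i] by (simp add: case_prod_unfold)
  have "bihom_poly j i j 0 0 (\<lambda>v. \<Prod>l\<in>{..<j} - (if k = 0 then {} else {k - 1}). fst v l)"
  proof (rule bihom_poly_prod)
    fix l assume "l \<in> {..<j} - (if k = 0 then {} else {k - 1})"
    then show "bihom_poly j i j 0 0 (\<lambda>v. fst v l)"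
      using bihom_poly.var_t[of l j i j] by (simp add: case_prod_unfold)
  qed simp
  from bihom_poly.mult[OF this w] show "bihom_poly j i j 0 1 (\<lambda>v. scale_w j (fst v) (snd (snd v)) k)"
    by (simp add: scale_w_def)
  show "bihom_poly 0 i j 0 1 (\<lambda>v. scale_w j t (snd (snd v)) k)"
    unfolding scale_w_def by (rule bihom_poly_cmult[OF w])
qed

lemma standard_action_morphisms:
  assumes ij: "i \<le> j"
  shows "variety_morphism (torus_times_variety j i j (milnor_hypersurface i j))
      (biproj_variety i j (milnor_hypersurface i j)) (\<lambda>(t, x). standard_action i j t x)"
    and "t \<in> carrier (torus j) \<Longrightarrow> variety_morphism (biproj_variety i j (milnor_hypersurface i j))
      (biproj_variety i j (milnor_hypersurface i j)) (standard_action i j t)"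
proof -
  let ?X = "milnor_hypersurface i j"
  let ?hc = "\<lambda>(P, Q). {\<lambda>_. 0} \<times> P \<times> Q :: (Defs.vec \<times> Defs.vec \<times> Defs.vec) set"
  have coords: "standard_action i j t x \<in> ?X \<and>
      (\<lambda>_. 0, scale_z t z, scale_w j t w) \<in> ?hc (standard_action i j t x)"
    if t: "t \<in> carrier (torus j)" and x: "x \<in> ?X" "z \<in> fst x" "w \<in> snd x" for t x z w
  proof -
    note p = milnor_hypersurface_coords[OF x]
    have c: "(scale_z t z, scale_w j t w) \<in> milnor_cone i j" by (rule scale_cone[OF ij t p(1)])
    show ?thesis
      using milnor_coneD(4-6)[OF c] standard_action_point[OF ij t p(1)] p(2) by (simp add: biproj_point_def)
  qed
  have hom: "homogeneous_coords ?hc ?X" by (rule homogeneous_coords_biproj[OF milnor_subset])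
  have ne: "fst x \<noteq> {}" "snd x \<noteq> {}" if "x \<in> ?X" for x
    using that milnor_subset[of i j] proj_space_nonempty[of "fst x" i] proj_space_nonempty[of "snd x" j] by auto
  show "variety_morphism (torus_times_variety j i j ?X) (biproj_variety i j ?X) (\<lambda>(t, x). standard_action i j t x)"
    unfolding torus_times_variety_def biproj_variety_def
  proof (rule variety_morphism_subst[OF hom, where D = "\<lambda>d e. d" and E = "\<lambda>d e. e" and
        \<sigma> = "\<lambda>v. (\<lambda>_. 0, scale_z (fst v) (fst (snd v)), scale_w j (fst v) (snd (snd v)))"])
    fix x assume x: "x \<in> carrier (torus j) \<times> ?X"
    show "(case x of (t, P, Q) \<Rightarrow> {t} \<times> P \<times> Q) \<noteq> {}"
      by (rule homogeneous_coords_nonempty[OF homogeneous_coords_torus_times[OF milnor_subset] x])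
    obtain t P Q where tx: "x = (t, P, Q)" by (metis prod_cases3)
    obtain z w where "z \<in> P" "w \<in> Q" using x tx ne[of "(P, Q)"] by auto
    then show "(\<lambda>(t, x). standard_action i j t x) x \<in> ?X"
      using coords[of t "(P, Q)" z w] x unfolding tx by (simp del: torus_simps)
    fix v assume "v \<in> (case x of (t, P, Q) \<Rightarrow> {t} \<times> P \<times> Q)"
    then obtain z w where "v = (t, z, w)" "z \<in> P" "w \<in> Q" unfolding tx by auto
    then show "(\<lambda>_. 0, scale_z (fst v) (fst (snd v)), scale_w j (fst v) (snd (snd v)))
        \<in> ?hc ((\<lambda>(t, x). standard_action i j t x) x)"
      using coords[of t "(P, Q)" z w] x unfolding tx by (simp del: torus_simps)
  next
    fix d e F assume F: "bihom_poly 0 i j d e F"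
    from bihom_poly_subst[OF F, of j i j "\<lambda>v. \<lambda>_. 0" 1 0 "\<lambda>v. scale_z (fst v) (fst (snd v))" 0 1
        "\<lambda>v. scale_w j (fst v) (snd (snd v))", OF _ scale_z_poly(1)[OF _ ij] scale_w_poly(1)]
    show "bihom_poly j i j d e (\<lambda>v. F (\<lambda>_. 0, scale_z (fst v) (fst (snd v)), scale_w j (fst v) (snd (snd v))))"
      by simp
  qed
  show "variety_morphism (biproj_variety i j ?X) (biproj_variety i j ?X) (standard_action i j t)"
    if t: "t \<in> carrier (torus j)"
    unfolding biproj_variety_def
  proof (rule variety_morphism_subst[OF hom, where D = "\<lambda>d e. d" and E = "\<lambda>d e. e" and
        \<sigma> = "\<lambda>v. (\<lambda>_. 0, scale_z t (fst (snd v)), scale_w j t (snd (snd v)))"])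
    fix x assume x: "x \<in> ?X"
    show "?hc x \<noteq> {}" by (rule homogeneous_coords_nonempty[OF hom x])
    obtain z w where "z \<in> fst x" "w \<in> snd x" using ne[OF x] by blast
    then show "standard_action i j t x \<in> ?X" using coords[OF t x] by blast
    fix v assume "v \<in> ?hc x"
    then have v: "fst (snd v) \<in> fst x" "snd (snd v) \<in> snd x" by (auto simp: case_prod_unfold)
    show "(\<lambda>_. 0, scale_z t (fst (snd v)), scale_w j t (snd (snd v))) \<in> ?hc (standard_action i j t x)"
      by (rule conjunct2[OF coords[OF t x v]])
  next
    fix d e F assume F: "bihom_poly 0 i j d e F"
    from bihom_poly_subst[OF F, of 0 i j "\<lambda>v. \<lambda>_. 0" 1 0 "\<lambda>v. scale_z t (fst (snd v))" 0 1
        "\<lambda>v. scale_w j t (snd (snd v))", OF _ scale_z_poly(2)[OF _ ij] scale_w_poly(2)]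
    show "bihom_poly 0 i j d e (\<lambda>v. F (\<lambda>_. 0, scale_z t (fst (snd v)), scale_w j t (snd (snd v))))"
      by simp
  qed
qed

text \<open>
  For effectiveness, the points with \<open>w = e\<^sub>0 + e\<^sub>k\<close> suffice: if such a point is fixed, then the ratio
  of \<open>w\<^sub>0\<close> and \<open>w\<^sub>k\<close> is unchanged, and this ratio is multiplied by the parameter with index \<open>k - 1\<close>.
\<close>

lemma standard_action_effective:
  assumes ij: "i \<le> j" and i: "1 \<le> i \<or> j = 0"
  shows "effective_torus_action j i j (milnor_hypersurface i j) (standard_action i j)"
proof -
  let ?X = "milnor_hypersurface i j"
  let ?T = "carrier (torus j)"
  have mult: "standard_action i j (s \<otimes>\<^bsub>torus j\<^esub> t) x = standard_action i j s (standard_action i j t x)"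
    if st: "s \<in> ?T" "t \<in> ?T" and x: "x \<in> ?X" for s t x
  proof -
    obtain z w where p: "(z, w) \<in> milnor_cone i j" "x = biproj_point i j z w" by (rule milnor_hypersurface_cases[OF x])
    have st': "s \<otimes>\<^bsub>torus j\<^esub> t \<in> ?T" using st by (auto simp: cspace_def)
    have "scale_z (s \<otimes>\<^bsub>torus j\<^esub> t) z = scale_z s (scale_z t z)"
      "scale_w j (s \<otimes>\<^bsub>torus j\<^esub> t) w = scale_w j s (scale_w j t w)"
      by (auto simp: scale_z_def scale_w_def prod.distrib)
    then show ?thesis
      unfolding p(2) standard_action_point[OF ij st' p(1)] standard_action_point[OF ij st(2) p(1)]
        standard_action_point[OF ij st(1) scale_cone[OF ij st(2) p(1)]] by simp
  qed
  have oneT: "\<one>\<^bsub>torus j\<^esub> \<in> ?T" by (auto simp: cspace_def)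
  have one: "standard_action i j \<one>\<^bsub>torus j\<^esub> x = x" if x: "x \<in> ?X" for x
  proof -
    obtain z w where p: "(z, w) \<in> milnor_cone i j" "x = biproj_point i j z w" by (rule milnor_hypersurface_cases[OF x])
    have "scale_z \<one>\<^bsub>torus j\<^esub> z = z"
      using milnor_coneD(1)[OF p(1)] ij by (auto simp: scale_z_def fun_eq_iff nonzero_vecs_def cspace_def)
    moreover have "scale_w j \<one>\<^bsub>torus j\<^esub> w = w"
      by (auto simp: scale_w_def fun_eq_iff)
    ultimately show ?thesis unfolding p(2) standard_action_point[OF ij oneT p(1)] by simp
  qed
  have closed: "standard_action i j t x \<in> ?X" if t: "t \<in> ?T" and x: "x \<in> ?X" for t x
  proof -
    obtain z w where p: "(z, w) \<in> milnor_cone i j" "x = biproj_point i j z w" by (rule milnor_hypersurface_cases[OF x])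
    show ?thesis unfolding p(2) standard_action_point[OF ij t p(1)] by (rule milnor_coneD(4)[OF scale_cone[OF ij t p(1)]])
  qed
  have act: "group_action (torus j) ?X (standard_action i j)"
  proof (rule group_actionI[OF torus_group])
    show "standard_action i j t \<in> extensional ?X" for t by (simp add: standard_action_def)
  qed (rule closed one mult; assumption)+
  have "variety_automorphism (biproj_variety i j ?X) (standard_action i j t)" if t: "t \<in> ?T" for t
    unfolding variety_automorphism_def topspace_biproj
  proof (intro conjI exI ballI)
    let ?s = "\<lambda>k. inverse (t k)"
    have s: "?s \<in> ?T" using t by (auto simp: cspace_def)
    have st: "?s \<otimes>\<^bsub>torus j\<^esub> t = \<one>\<^bsub>torus j\<^esub>" "t \<otimes>\<^bsub>torus j\<^esub> ?s = \<one>\<^bsub>torus j\<^esub>"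
      using t by (auto simp: cspace_def fun_eq_iff)
    show "variety_morphism (biproj_variety i j ?X) (biproj_variety i j ?X) (standard_action i j t)"
      "variety_morphism (biproj_variety i j ?X) (biproj_variety i j ?X) (standard_action i j ?s)"
      by (rule standard_action_morphisms(2)[OF ij], fact)+
    fix x assume x: "x \<in> ?X"
    show "standard_action i j ?s (standard_action i j t x) = x"
      unfolding mult[OF s t x, symmetric] st by (rule one[OF x])
    show "standard_action i j t (standard_action i j ?s x) = x"
      unfolding mult[OF t s x, symmetric] st by (rule one[OF x])
  qed
  then have alg: "algebraic_torus_action j i j ?X (standard_action i j)"
    unfolding algebraic_torus_action_def using act standard_action_morphisms(1)[OF ij] by blast
  have "t = \<one>\<^bsub>torus j\<^esub>" if t: "t \<in> ?T" and triv: "\<forall>x\<in>?X. standard_action i j t x = x" for t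
  proof -
    have "t a = 1" if a: "a < j" for a
    proof -
      have i1: "1 \<le> i" using i a by auto
      define k where "k = Suc a"
      \<comment> \<open>The point \<open>w = e\<^sub>0 + e\<^sub>k\<close> with a suitable \<open>z\<close> orthogonal to it: \<open>e\<^sub>0 - e\<^sub>k\<close>, or \<open>e\<^sub>1\<close> if \<open>k > i\<close>.\<close>
      define z :: Defs.vec where "z l = (if k \<le> i then (if l = 0 then 1 else if l = k then - 1 else 0)
        else if l = 1 then 1 else 0)" for l
      define w :: Defs.vec where "w l = (if l = 0 \<or> l = k then 1 else 0)" for l
      have sum0: "(\<Sum>l\<le>min i j. z l * w l) = 0"
      proof (cases "k \<le> i")
        case True
        have "(\<Sum>l\<le>min i j. z l * w l) = (\<Sum>l\<in>{0, k}. z l * w l)"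
          using True ij by (intro sum.mono_neutral_right) (auto simp: w_def)
        then show ?thesis using True by (simp add: z_def w_def k_def)
      next
        case False
        then show ?thesis using i1 by (intro sum.neutral) (auto simp: z_def w_def)
      qed
      have "z 0 \<noteq> 0 \<or> z 1 \<noteq> 0" "w 0 \<noteq> 0" by (auto simp: z_def w_def)
      then have "z \<noteq> (\<lambda>_. 0)" "w \<noteq> (\<lambda>_. 0)" by auto
      then have p: "(z, w) \<in> milnor_cone i j"
        using sum0 i1 a by (auto simp: milnor_cone_def nonzero_vecs_def cspace_def z_def w_def k_def)
      have "biproj_point i j (scale_z t z) (scale_w j t w) = biproj_point i j z w"
        using triv milnor_coneD(4)[OF p] standard_action_point[OF ij t p] by metis
      then have "proj_class j w = proj_class j (scale_w j t w)" by (simp add: biproj_point_def)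
      then obtain c where c: "scale_w j t w = (\<lambda>l. c * w l)"
        using proj_class_eq_iff[OF milnor_coneD(2)[OF p] milnor_coneD(2)[OF scale_cone[OF ij t p]]] by blast
      have "(\<Prod>l<j. t l) = c" using fun_cong[OF c, of 0] by (simp add: scale_w_def w_def)
      moreover have "(\<Prod>l\<in>{..<j} - {a}. t l) = c" using fun_cong[OF c, of k] by (simp add: scale_w_def w_def k_def)
      moreover have "(\<Prod>l<j. t l) = t a * (\<Prod>l\<in>{..<j} - {a}. t l)"
        using a by (intro prod.remove) auto
      moreover have "(\<Prod>l<j. t l) \<noteq> 0" using t by simp
      ultimately show ?thesis by simp
    qed
    then show ?thesis using t by (intro torus_eqI[of t j]) (auto simp: cspace_def)
  qed
  then show ?thesis unfolding effective_torus_action_def using alg by blast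
qed

lemma is_largest_torus_action_dim_of_le:
  assumes ij: "i \<le> j" and "i = 0 \<longleftrightarrow> j = 0"
  shows "is_largest_torus_action_dim i j (milnor_hypersurface i j) j"
  unfolding is_largest_torus_action_dim_def
proof (intro conjI allI impI)
  have "1 \<le> i \<or> j = 0" using assms by linarith
  from standard_action_effective[OF ij this]
  show "\<exists>\<phi>. effective_torus_action j i j (milnor_hypersurface i j) \<phi>" by blast
  fix r \<phi> assume eff: "effective_torus_action r i j (milnor_hypersurface i j) \<phi>"
  show "r \<le> j"
  proof (cases "i = 0")
    case True
    \<comment> \<open>\<open>H\<^sub>0\<^sub>,\<^sub>0\<close> is empty, so every element of the torus acts trivially.\<close>
    have empty: "milnor_hypersurface i j = {}"
    proof (rule equals0I)
      fix x assume "x \<in> milnor_hypersurface i j"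
      then obtain z w where p: "(z, w) \<in> milnor_cone i j" by (rule milnor_hypersurface_cases)
      then have "z 0 \<noteq> 0" "w 0 \<noteq> 0"
        using nonzero_vecs_coord[OF milnor_coneD(1)[OF p]] nonzero_vecs_coord[OF milnor_coneD(2)[OF p]]
          True assms(2) by auto
      then show False using milnor_coneD(3)[OF p] True by simp
    qed
    let ?t = "\<lambda>k. if k < r then 2 else 0 :: complex"
    have "?t \<in> carrier (torus r)" by (auto simp: cspace_def)
    then have t: "?t = \<one>\<^bsub>torus r\<^esub>"
      using eff unfolding effective_torus_action_def empty by blast
    have "r = 0"
    proof (rule ccontr)
      assume "r \<noteq> 0"
      then show False using fun_cong[OF t, of 0] by simp
    qed
    then show ?thesis by simp
  next
    case False
    then show ?thesis using effective_torus_action_dim_le[OF _ ij eff] by simp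
  qed
qed

theorem theorem1p1:
  fixes i j :: nat
  assumes "i = 0 \<longleftrightarrow> j = 0"
  shows "is_largest_torus_action_dim i j (milnor_hypersurface i j) (max i j)"
proof (cases "i \<le> j")
  case True
  then show ?thesis using is_largest_torus_action_dim_of_le[OF True assms] by (simp add: max_def)
next
  case False
  then have "is_largest_torus_action_dim j i (milnor_hypersurface j i) i"
    using is_largest_torus_action_dim_of_le[of j i] assms by simp
  from swap_is_largest[OF this] show ?thesis using False by (simp add: max_def)
qed

end
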